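(* For every constant $c\in\mathbb{N}$ there is a constant $c'$ depending only on $c$ such that, given a graph $H$ that has a weak vertex-cover of size at most $c$ and a graph $G$, the number of edge-injective homomorphisms from $H$ to $G$ can be computed in time $O(n^{c'})$, where $n$ is the input size.
   Context: Graphs are simple and loop-free. A homomorphism from $H$ to $G$ is a map $\varphi:V(H)\to V(G)$ with $\{\varphi(u),\varphi(v)\}\in E(G)$ for all $\{u,v\}\in E(H)$; it is edge-injective if distinct edges of $H$ are mapped to distinct edges of $G$. A set $S\subseteq V(H)$ is a weak vertex-cover of $H$ if every edge $e\in E(H)$ either intersects $S$ or has no other edge of $H$ incident to it. *)

theory Defs
  imports Complex_Main "HOL-Library.FuncSet" "HOL-Library.Landau_Symbols" "HOL-Library.Log_Nat"
begin

section \<open>Graphs and edge-injective homomorphisms\<close>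

type_synonym 'a ugraph = "'a set \<times> 'a set set"

abbreviation verts :: "'a ugraph \<Rightarrow> 'a set" where "verts \<equiv> fst"
abbreviation edges :: "'a ugraph \<Rightarrow> 'a set set" where "edges \<equiv> snd"

definition simple_graph :: "'a ugraph \<Rightarrow> bool" where
  "simple_graph G \<longleftrightarrow> finite (verts G) \<and> (\<forall>e\<in>edges G. e \<subseteq> verts G \<and> card e = 2)"

text \<open>Homomorphisms are extensional functions (arbitrary but fixed outside the vertex set
  of \<open>H\<close>), so that distinct elements of \<open>homs H G\<close> differ on some vertex of \<open>H\<close>.\<close>

definition homs :: "'a ugraph \<Rightarrow> 'b ugraph \<Rightarrow> ('a \<Rightarrow> 'b) set" where
  "homs H G = {\<phi> \<in> verts H \<rightarrow>\<^sub>E verts G. \<forall>u v. {u, v} \<in> edges H \<longrightarrow> {\<phi> u, \<phi> v} \<in> edges G}"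

definition edge_inj_homs :: "'a ugraph \<Rightarrow> 'b ugraph \<Rightarrow> ('a \<Rightarrow> 'b) set" where
  "edge_inj_homs H G = {\<phi> \<in> homs H G. inj_on (\<lambda>e. \<phi> ` e) (edges H)}"

definition weak_vertex_cover :: "'a ugraph \<Rightarrow> 'a set \<Rightarrow> bool" where
  "weak_vertex_cover H S \<longleftrightarrow> S \<subseteq> verts H \<and>
     (\<forall>e\<in>edges H. e \<inter> S \<noteq> {} \<or> (\<forall>e'\<in>edges H. e' \<noteq> e \<longrightarrow> e \<inter> e' = {}))"


section \<open>Random access machines with logarithmic cost\<close>

text \<open>Structured programs for a random access machine whose registers and memory cells hold
  natural numbers of unbounded size, charged by the logarithmic cost criterion (as in Aho,
  Hopcroft and Ullman): every use of a number or an address costs its binary length. This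
  model is polynomially equivalent to Turing machines; unit cost would not be, because of the
  multiplication.\<close>

datatype expr =
    Const nat
  | Reg nat
  | Mem expr  \<comment> \<open>indirect access: the content of the memory cell with the computed address\<close>
  | Add expr expr
  | Sub expr expr
  | Mul expr expr
  | Div expr expr

datatype com =
    Skip
  | Assign nat expr
  | Store expr expr  \<comment> \<open>address, value\<close>
  | Seq com com
  | If expr com com  \<comment> \<open>a test succeeds iff its value is nonzero\<close>
  | While expr com

text \<open>A state consists of the register contents and the memory contents.\<close>

type_synonym state = "(nat \<Rightarrow> nat) \<times> (nat \<Rightarrow> nat)"

text \<open>Subtraction and division are those of \<open>nat\<close>: \<open>m - n = 0\<close> for \<open>m \<le> n\<close> and \<open>m div 0 = 0\<close>.\<close>

fun val :: "state \<Rightarrow> expr \<Rightarrow> nat" where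
  "val s (Const n) = n"
| "val s (Reg i) = fst s i"
| "val s (Mem e) = snd s (val s e)"
| "val s (Add e1 e2) = val s e1 + val s e2"
| "val s (Sub e1 e2) = val s e1 - val s e2"
| "val s (Mul e1 e2) = val s e1 * val s e2"
| "val s (Div e1 e2) = val s e1 div val s e2"

text \<open>\<open>floorlog 2 n\<close> is the number of binary digits of \<open>n > 0\<close>, and \<open>floorlog 2 0 = 0\<close>.\<close>

definition bit_length :: "nat \<Rightarrow> nat" where
  "bit_length n = max 1 (floorlog 2 n)"

text \<open>The cost of an expression always bounds the binary length of its value, so the lengths of
  operands and computed addresses are accounted for by the costs of the subexpressions.\<close>

fun cost :: "state \<Rightarrow> expr \<Rightarrow> nat" where
  "cost s (Const n) = bit_length n"
| "cost s (Reg i) = bit_length i + bit_length (fst s i)"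
| "cost s (Mem e) = cost s e + bit_length (val s (Mem e))"
| "cost s (Add e1 e2) = cost s e1 + cost s e2 + bit_length (val s (Add e1 e2))"
| "cost s (Sub e1 e2) = cost s e1 + cost s e2 + bit_length (val s (Sub e1 e2))"
| "cost s (Mul e1 e2) = cost s e1 + cost s e2 + bit_length (val s (Mul e1 e2))"
| "cost s (Div e1 e2) = cost s e1 + cost s e2 + bit_length (val s (Div e1 e2))"

lemma bit_length_val_le_cost: "bit_length (val s e) \<le> cost s e"
  by (cases e) auto

text \<open>\<open>exec P s t s'\<close>: program \<open>P\<close> started in state \<open>s\<close> terminates in state \<open>s'\<close> after time \<open>t\<close>.\<close>

inductive exec :: "com \<Rightarrow> state \<Rightarrow> nat \<Rightarrow> state \<Rightarrow> bool" where
  Skip: "exec Skip s 1 s"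
| Assign: "exec (Assign i e) s (bit_length i + cost s e) ((fst s)(i := val s e), snd s)"
| Store: "exec (Store e1 e2) s (cost s e1 + cost s e2) (fst s, (snd s)(val s e1 := val s e2))"
| Seq: "exec P s t1 s1 \<Longrightarrow> exec Q s1 t2 s2 \<Longrightarrow> exec (Seq P Q) s (t1 + t2) s2"
| IfTrue: "val s e \<noteq> 0 \<Longrightarrow> exec P s t s' \<Longrightarrow> exec (If e P Q) s (cost s e + t) s'"
| IfFalse: "val s e = 0 \<Longrightarrow> exec Q s t s' \<Longrightarrow> exec (If e P Q) s (cost s e + t) s'"
| WhileFalse: "val s e = 0 \<Longrightarrow> exec (While e P) s (cost s e) s"
| WhileTrue: "val s e \<noteq> 0 \<Longrightarrow> exec P s t1 s1 \<Longrightarrow> exec (While e P) s1 t2 s2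
    \<Longrightarrow> exec (While e P) s (cost s e + t1 + t2) s2"

lemma exec_deterministic: "exec P s t s' \<Longrightarrow> exec P s u s'' \<Longrightarrow> u = t \<and> s'' = s'"
proof (induction arbitrary: u s'' rule: exec.induct)
  case (Seq P s t1 s1 Q t2 s2)
  from Seq.prems obtain u1 u2 r where "exec P s u1 r" "exec Q r u2 s''" "u = u1 + u2"
    by (cases rule: exec.cases) auto
  with Seq.IH show ?case by metis
next
  case (WhileTrue s e P t1 s1 t2 s2)
  from WhileTrue.prems WhileTrue.hyps(1) obtain u1 u2 r
    where "exec P s u1 r" "exec (While e P) r u2 s''" "u = cost s e + u1 + u2"
    by (cases rule: exec.cases) auto
  with WhileTrue.IH show ?case by metis
next
  case (IfTrue s e P t s' Q)
  from IfTrue.prems IfTrue.hyps(1) obtain u1 where "exec P s u1 s''" "u = cost s e + u1"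
    by (cases rule: exec.cases) auto
  with IfTrue.IH show ?case by metis
next
  case (IfFalse s e Q t s' P)
  from IfFalse.prems IfFalse.hyps(1) obtain u1 where "exec Q s u1 s''" "u = cost s e + u1"
    by (cases rule: exec.cases) auto
  with IfFalse.IH show ?case by metis
next
  case (WhileFalse s e P)
  from WhileFalse.prems WhileFalse.hyps show ?case
    by (cases rule: exec.cases) auto
next
  case (Skip s)
  then show ?case by (cases rule: exec.cases) auto
next
  case (Assign i e s)
  then show ?case by (cases rule: exec.cases) auto
next
  case (Store e1 e2 s)
  then show ?case by (cases rule: exec.cases) auto
qed

text \<open>The input, a bit string, is placed in memory cells \<open>0, 1, \<dots>\<close> and its length in
  register \<open>0\<close>; everything else is \<open>0\<close>. The output is the final content of register \<open>0\<close>.\<close>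

definition initial_state :: "bool list \<Rightarrow> state" where
  "initial_state x = ((\<lambda>_. 0)(0 := length x),
                      (\<lambda>i. if i < length x then of_bool (x ! i) else 0))"

definition outputs_within :: "com \<Rightarrow> bool list \<Rightarrow> nat \<Rightarrow> nat \<Rightarrow> bool" where
  "outputs_within P x y t \<longleftrightarrow> (\<exists>k s. exec P (initial_state x) k s \<and> k \<le> t \<and> fst s 0 = y)"


section \<open>Graphs as inputs\<close>

text \<open>Relative to an enumeration \<open>vs\<close> of its vertices, a graph is given by the number of its
  vertices in unary, followed by its adjacency matrix, row by row.\<close>

definition encode_graph :: "'a list \<Rightarrow> 'a ugraph \<Rightarrow> bool list" where
  "encode_graph vs G = replicate (length vs) True @ [False] @
     concat (map (\<lambda>u. map (\<lambda>v. {u, v} \<in> edges G) vs) vs)"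

definition represents :: "bool list \<Rightarrow> 'a ugraph \<Rightarrow> 'b ugraph \<Rightarrow> bool" where
  "represents x H G \<longleftrightarrow> (\<exists>vs ws. distinct vs \<and> set vs = verts H \<and> distinct ws \<and> set ws = verts G \<and>
     x = encode_graph vs H @ encode_graph ws G)"

end

theory Submission
  imports Defs "HOL-Library.Disjoint_Sets" "HOL-Library.Nat_Bijection"
begin

text \<open>Guess a weak vertex-cover \<open>s 0, \<dots>, s (c - 1)\<close> of \<open>H\<close> and its image under the homomorphism. Up to
  isolated vertices and isolated edges, which contribute explicit factors because an
  edge-injective homomorphism always uses up the same number of edges of \<open>G\<close>, every other vertex
  of \<open>H\<close> has one of the \<open>2 ^ c - 1\<close> types given by its set of neighbours in the cover. A map
  of these vertices is determined, up to permuting vertices of the same type, by the set of pairs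
  (vertex of \<open>G\<close>, type) that it hits, and the admissibility of such a set is a
  separate condition at each vertex of \<open>G\<close> outside the image of the cover. Hence the admissible sets
  have a generating function, with one variable per type, that is a product of polynomials of
  constant size, and the number sought is one of its coefficients. Instead of multiplying
  polynomials, the machine evaluates the product at powers of a huge number \<open>B\<close> (Kronecker
  substitution) and reads off the coefficient by division.

  The outcome is a closed arithmetic expression with sums and products of polynomial length, and
  the functions computable in polynomial time are closed under these operations. The guesses are summed over,
  and the sum is divided by the number of valid covers.\<close>

subsection \<open>Polynomial bounds\<close>

text \<open>Logarithmic cost admits numbers of exponential size as long as their binary length is
  polynomial; this makes evaluation at powers of \<open>B\<close> affordable. Loops, however, need
  polynomially many rounds, so a bound on the value (\<open>bounded_value\<close>) is kept apart
  from computability. Two parameters make the coefficient readable. \<open>M\<close> exceeds all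
  type counts and fibre sizes, so a vector of such numbers is the base-\<open>M\<close> expansion of
  one exponent. \<open>B = 2 ^ (card X * card (types c) + 1)\<close> exceeds the number of sets of
  pairs, so coefficients never carry. Type \<theta> gets the exponent
  \<open>M ^ set_encode \<theta>\<close>, where \<open>set_encode \<theta> < 2 ^ c\<close>; hence
  exponents are polynomial in the input length, with a degree depending only on \<open>c\<close>.
  The obstacle is the image of the cover, where edges at different vertices can collide and no
  product formula holds. It has at most \<open>c\<close> vertices, so all choices there are summed
  by brute force. Every valid cover yields the same value, so dividing by their number spares the
  selection of one, and everything remains plain arithmetic.\<close>

definition pbound :: "(nat \<Rightarrow> nat) \<Rightarrow> bool" where
  "pbound g \<longleftrightarrow> (\<exists>k. \<forall>n. g n \<le> (n + 2) ^ k)"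

text \<open>The base \<open>n + 2\<close> is at least 2 for every \<open>n\<close>, so a large
  exponent alone dominates any constant, without exceptions at \<open>n = 0\<close> and
  \<open>n = 1\<close>.\<close>

lemma pbound_const: "pbound (\<lambda>n. c)"
  unfolding pbound_def
proof (intro exI allI)
  fix n
  have "c \<le> 2 ^ c" by (rule less_imp_le[OF less_exp])
  also have "\<dots> \<le> (n + 2) ^ c" by (rule power_mono) auto
  finally show "c \<le> (n + 2) ^ c" .
qed

lemma pbound_id: "pbound (\<lambda>n. n)"
  unfolding pbound_def by (rule exI[of _ 1]) auto

lemma pbound_add:
  assumes "pbound f" "pbound g"
  shows "pbound (\<lambda>n. f n + g n)"
proof -
  obtain k l where kl: "\<And>n. f n \<le> (n + 2) ^ k" "\<And>n. g n \<le> (n + 2) ^ l"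
    using assms unfolding pbound_def by blast
  have "f n + g n \<le> (n + 2) ^ Suc (k + l)" for n
  proof -
    have "(n + 2) ^ k \<le> (n + 2) ^ (k + l)" "(n + 2) ^ l \<le> (n + 2) ^ (k + l)"
      by (rule power_increasing; simp)+
    then have "f n + g n \<le> 2 * (n + 2) ^ (k + l)" using kl[of n] by linarith
    also have "\<dots> \<le> (n + 2) ^ Suc (k + l)" by simp
    finally show ?thesis .
  qed
  then show ?thesis unfolding pbound_def by blast
qed

lemma pbound_mult:
  assumes "pbound f" "pbound g"
  shows "pbound (\<lambda>n. f n * g n)"
proof -
  obtain k l where kl: "\<And>n. f n \<le> (n + 2) ^ k" "\<And>n. g n \<le> (n + 2) ^ l"
    using assms unfolding pbound_def by blast
  have "f n * g n \<le> (n + 2) ^ (k + l)" for n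
    unfolding power_add using kl by (rule mult_le_mono)
  then show ?thesis unfolding pbound_def by blast
qed

lemma pbound_power: "pbound f \<Longrightarrow> pbound (\<lambda>n. f n ^ k)"
  by (induction k) (simp_all add: pbound_const pbound_mult)

lemmas pbound_intros = pbound_const pbound_id pbound_add pbound_mult pbound_power


subsection \<open>Binary length\<close>

lemma bit_length_le_iff: "L > 0 \<Longrightarrow> bit_length n \<le> L \<longleftrightarrow> n < 2 ^ L"
  by (simp add: bit_length_def floorlog_le_iff)

lemma less_two_power_bit_length: "n < 2 ^ bit_length n"
  using bit_length_le_iff[of "bit_length n" n] by (simp add: bit_length_def)

lemma bit_length_pos: "bit_length n \<ge> 1"
  by (simp add: bit_length_def)

lemma bit_length_mono: "m \<le> n \<Longrightarrow> bit_length m \<le> bit_length n"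
  unfolding bit_length_def using floorlog_mono[of m n 2] by simp

lemma bit_length_le_Suc: "bit_length n \<le> n + 1"
proof -
  have "n < 2 ^ (n + 1)" by (induction n) auto
  then show ?thesis by (subst bit_length_le_iff) auto
qed

lemma bit_length_mult: "bit_length (a * b) \<le> bit_length a + bit_length b"
proof -
  have "a * b < 2 ^ bit_length a * 2 ^ bit_length b"
    using less_two_power_bit_length[of a] less_two_power_bit_length[of b]
    by (intro mult_strict_mono) auto
  then show ?thesis
    using bit_length_pos[of a] by (subst bit_length_le_iff) (auto simp: power_add)
qed

text \<open>Far from sharp, but of the same shape as the bound for products, so that sums and
  products can share the closure lemmas. It rests on both powers of two being at least 2, whence
  their sum is at most their product.\<close>

lemma bit_length_add: "bit_length (a + b) \<le> bit_length a + bit_length b"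
proof -
  let ?A = "2 ^ bit_length a :: nat" and ?B = "2 ^ bit_length b :: nat"
  have "?A \<ge> 2" "?B \<ge> 2"
    using power_increasing[OF bit_length_pos, of "2 :: nat" a] power_increasing[OF bit_length_pos, of "2 :: nat" b]
    by auto
  then have "?A * 2 \<le> ?A * ?B" "2 * ?B \<le> ?A * ?B" by simp_all
  then have "a + b < ?A * ?B"
    using less_two_power_bit_length[of a] less_two_power_bit_length[of b] by linarith
  then show ?thesis
    using bit_length_pos[of a] by (subst bit_length_le_iff) (auto simp: power_add)
qed

subsection \<open>Verification of programs\<close>

definition runs :: "com \<Rightarrow> state \<Rightarrow> nat \<Rightarrow> (state \<Rightarrow> bool) \<Rightarrow> bool" where
  "runs P s \<tau> \<Phi> \<longleftrightarrow> (\<exists>t s'. exec P s t s' \<and> t \<le> \<tau> \<and> \<Phi> s')"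

lemma runs_weaken: "runs P s \<tau> \<Phi> \<Longrightarrow> \<tau> \<le> \<tau>' \<Longrightarrow> (\<And>s'. \<Phi> s' \<Longrightarrow> \<Psi> s') \<Longrightarrow> runs P s \<tau>' \<Psi>"
  unfolding runs_def by (meson le_trans)

lemma runs_Assign:
  "\<Phi> ((fst s)(i := val s e), snd s) \<Longrightarrow> bit_length i + cost s e \<le> \<tau> \<Longrightarrow> runs (Assign i e) s \<tau> \<Phi>"
  unfolding runs_def using exec.Assign by blast

lemma runs_Seq:
  assumes "runs P s \<tau>1 \<Psi>" "\<And>s'. \<Psi> s' \<Longrightarrow> runs Q s' \<tau>2 \<Phi>"
  shows "runs (Seq P Q) s (\<tau>1 + \<tau>2) \<Phi>"
  using assms exec.Seq unfolding runs_def by (meson add_mono)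

text \<open>The invariant is indexed by the round, and the exact number \<open>B\<close> of rounds
  replaces a termination measure. The extra \<kappa> pays for the final, failing test.\<close>

lemma runs_While:
  assumes "Inv 0 s"
    and step: "\<And>i s. i < B \<Longrightarrow> Inv i s \<Longrightarrow> val s e \<noteq> 0 \<and> cost s e \<le> \<kappa> \<and> runs P s \<tau> (Inv (Suc i))"
    and last: "\<And>s. Inv B s \<Longrightarrow> val s e = 0 \<and> cost s e \<le> \<kappa>"
  shows "runs (While e P) s (B * (\<kappa> + \<tau>) + \<kappa>) (Inv B)"
proof -
  have "runs (While e P) s (j * (\<kappa> + \<tau>) + \<kappa>) (Inv B)" if "i + j = B" "Inv i s" for i j s
    using that
  proof (induction j arbitrary: i s)
    case 0
    then have "val s e = 0" "cost s e \<le> \<kappa>" using last by auto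
    with exec.WhileFalse[of s e P] 0 show ?case
      unfolding runs_def by (metis add_0 add_0_right mult_0)
  next
    case (Suc j)
    then have "i < B" by simp
    from step[OF this Suc.prems(2)] obtain t1 s1
      where 1: "val s e \<noteq> 0" "cost s e \<le> \<kappa>" "exec P s t1 s1" "t1 \<le> \<tau>" "Inv (Suc i) s1"
      unfolding runs_def by blast
    from Suc.IH[of "Suc i" s1] Suc.prems 1 obtain t2 s2
      where 2: "exec (While e P) s1 t2 s2" "t2 \<le> j * (\<kappa> + \<tau>) + \<kappa>" "Inv B s2"
      unfolding runs_def by auto
    have "exec (While e P) s (cost s e + t1 + t2) s2"
      using exec.WhileTrue 1 2 by blast
    moreover have "cost s e + t1 + t2 \<le> Suc j * (\<kappa> + \<tau>) + \<kappa>" using 1 2 by simp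
    ultimately show ?case using 2 unfolding runs_def by blast
  qed
  from this[of 0 B s] assms(1) show ?thesis by simp
qed

subsection \<open>Functions computable in polynomial time\<close>

abbreviation input_memory :: "bool list \<Rightarrow> nat \<Rightarrow> nat" where
  "input_memory x \<equiv> snd (initial_state x)"

text \<open>The second argument of a function is an environment that assigns values to variables; variable
  \<open>v\<close> lives in register \<open>v\<close>, register \<open>0\<close> keeps the input length. A program with
  index \<open>r\<close> leaves its result in register \<open>r\<close> and may overwrite only the registers from
  \<open>r\<close> onwards, so that programs can be nested.\<close>

definition computes ::
  "nat \<Rightarrow> nat \<Rightarrow> com \<Rightarrow> (bool list \<Rightarrow> (nat \<Rightarrow> nat) \<Rightarrow> nat) \<Rightarrow> (nat \<Rightarrow> nat) \<Rightarrow> (nat \<Rightarrow> nat) \<Rightarrow> bool"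
where
  "computes m r P f G g \<longleftrightarrow> (\<forall>x s. snd s = input_memory x \<and> fst s 0 = length x \<and>
       (\<forall>v<m. fst s v \<le> G (length x)) \<longrightarrow>
     bit_length (f x (fst s)) \<le> g (length x) \<and>
     runs P s (g (length x)) (\<lambda>s'. snd s' = snd s \<and> (\<forall>v<r. fst s' v = fst s v) \<and>
       fst s' r = f x (fst s)))"

text \<open>Variables hold the counters of enclosing loops, whose ranges are unknown at this point,
  so every polynomial bound \<open>G\<close> on them must be tolerated. Since \<open>f\<close> sees
  only variables below \<open>m\<close> and the program writes only from \<open>r \<ge> m\<close>
  on, earlier intermediate results never disturb later evaluations; \<open>m > 0\<close> protects
  the input length in register 0.\<close>

definition ptime_upto :: "nat \<Rightarrow> (bool list \<Rightarrow> (nat \<Rightarrow> nat) \<Rightarrow> nat) \<Rightarrow> bool" where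
  "ptime_upto m f \<longleftrightarrow> m > 0 \<and>
     (\<forall>x \<rho> \<rho>'. (\<forall>v<m. \<rho> v = \<rho>' v) \<longrightarrow> f x \<rho> = f x \<rho>') \<and>
     (\<forall>r\<ge>m. \<exists>P. \<forall>G. pbound G \<longrightarrow> (\<exists>g. pbound g \<and> computes m r P f G g))"

definition ptime :: "(bool list \<Rightarrow> (nat \<Rightarrow> nat) \<Rightarrow> nat) \<Rightarrow> bool" where
  "ptime f \<longleftrightarrow> (\<exists>m. ptime_upto m f)"

lemma ptime_upto_mono:
  assumes "ptime_upto m f" "m \<le> m'"
  shows "ptime_upto m' f"
proof -
  have "computes m r P f G g \<Longrightarrow> computes m' r P f G g" for r P G g
    using assms(2) unfolding computes_def by (meson less_le_trans)
  moreover have "\<exists>P. \<forall>G. pbound G \<longrightarrow> (\<exists>g. pbound g \<and> computes m r P f G g)" if "r \<ge> m'" for r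
    using assms that unfolding ptime_upto_def by (meson le_trans)
  moreover have "f x \<rho> = f x \<rho>'" if "\<forall>v<m'. \<rho> v = \<rho>' v" for x \<rho> \<rho>'
    using assms that unfolding ptime_upto_def by (meson less_le_trans)
  ultimately show ?thesis
    using assms unfolding ptime_upto_def by (meson less_le_trans)
qed

lemma ptime_simpleI:
  assumes "m > 0"
    and "\<And>x \<rho> \<rho>'. \<forall>v<m. \<rho> v = \<rho>' v \<Longrightarrow> f x \<rho> = f x \<rho>'"
    and val: "\<And>s x. snd s = input_memory x \<Longrightarrow> fst s 0 = length x \<Longrightarrow> val s e = f x (fst s)"
    and "\<And>G. pbound G \<Longrightarrow> \<exists>g. pbound g \<and> (\<forall>s x. snd s = input_memory x \<longrightarrow> fst s 0 = length x \<longrightarrow>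
       (\<forall>v<m. fst s v \<le> G (length x)) \<longrightarrow> cost s e \<le> g (length x))"
  shows "ptime f"
  unfolding ptime_def ptime_upto_def
proof (intro exI[of _ m] conjI allI impI)
  fix r :: nat assume "r \<ge> m"
  show "\<exists>P. \<forall>G. pbound G \<longrightarrow> (\<exists>g. pbound g \<and> computes m r P f G g)"
  proof (intro exI[of _ "Assign r e"] allI impI)
    fix G assume "pbound G"
    then obtain g where g: "pbound g" "\<And>s x. snd s = input_memory x \<Longrightarrow> fst s 0 = length x \<Longrightarrow>
       (\<forall>v<m. fst s v \<le> G (length x)) \<Longrightarrow> cost s e \<le> g (length x)"
      using assms(4) by blast
    have "computes m r (Assign r e) f G (\<lambda>n. bit_length r + g n)"
      unfolding computes_def
    proof (intro allI impI conjI; elim conjE)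
      fix x s assume s: "snd s = input_memory x" "fst s 0 = length x" "\<forall>v<m. fst s v \<le> G (length x)"
      show "bit_length (f x (fst s)) \<le> bit_length r + g (length x)"
        using bit_length_val_le_cost[of s e] g(2)[OF s] val[OF s(1,2)] by simp
      show "runs (Assign r e) s (bit_length r + g (length x))
         (\<lambda>s'. snd s' = snd s \<and> (\<forall>v<r. fst s' v = fst s v) \<and> fst s' r = f x (fst s))"
        using g(2)[OF s] val[OF s(1,2)] by (intro runs_Assign) auto
    qed
    moreover have "pbound (\<lambda>n. bit_length r + g n)" using g by (intro pbound_intros)
    ultimately show "\<exists>g. pbound g \<and> computes m r (Assign r e) f G g" by blast
  qed
qed (use assms in auto)

lemma ptime_const: "ptime (\<lambda>x \<rho>. k)"
  by (rule ptime_simpleI[of 1 _ "Const k"]) (auto intro: exI[of _ "\<lambda>_. bit_length k"] pbound_const)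

lemma ptime_length: "ptime (\<lambda>x \<rho>. length x)"
proof (rule ptime_simpleI[of 1 _ "Reg 0"])
  have "pbound (\<lambda>n. bit_length 0 + (n + 1))" by (intro pbound_intros)
  then show "\<exists>g. pbound g \<and> (\<forall>s x. snd s = input_memory x \<longrightarrow> fst s 0 = length x \<longrightarrow>
       (\<forall>v<1. fst s v \<le> G (length x)) \<longrightarrow> cost s (Reg 0) \<le> g (length x))" for G
    using bit_length_le_Suc by (intro exI[of _ "\<lambda>n. bit_length 0 + (n + 1)"]) auto
qed auto

lemma ptime_var: "ptime (\<lambda>x \<rho>. \<rho> v)"
proof (rule ptime_simpleI[of "Suc v" _ "Reg v"])
  fix G assume "pbound G"
  then have "pbound (\<lambda>n. bit_length v + (G n + 1))" by (intro pbound_intros)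
  moreover have "cost s (Reg v) \<le> bit_length v + (G (length x) + 1)"
    if "\<forall>w<Suc v. fst s w \<le> G (length x)" for s x
    using bit_length_mono[of "fst s v" "G (length x)"] bit_length_le_Suc[of "G (length x)"] that
    by simp
  ultimately show "\<exists>g. pbound g \<and> (\<forall>s x. snd s = input_memory x \<longrightarrow> fst s 0 = length x \<longrightarrow>
       (\<forall>w<Suc v. fst s w \<le> G (length x)) \<longrightarrow> cost s (Reg v) \<le> g (length x))"
    by (intro exI[of _ "\<lambda>n. bit_length v + (G n + 1)"]) blast
qed auto

lemma computesD:
  assumes "computes m r P f G g" "snd s = input_memory x" "fst s 0 = length x"
    "\<And>v. v < m \<Longrightarrow> fst s v \<le> G (length x)"
  shows "bit_length (f x (fst s)) \<le> g (length x)"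
    and "runs P s (g (length x)) (\<lambda>s'. snd s' = snd s \<and> (\<forall>v<r. fst s' v = fst s v) \<and>
       fst s' r = f x (fst s))"
  using assms unfolding computes_def by blast+

definition input_bit :: "bool list \<Rightarrow> nat \<Rightarrow> bool" where
  "input_bit x i \<longleftrightarrow> i < length x \<and> x ! i"

lemma ptime_bit:
  assumes "ptime f"
  shows "ptime (\<lambda>x \<rho>. of_bool (input_bit x (f x \<rho>)))"
proof -
  obtain m where m: "ptime_upto m f" using assms unfolding ptime_def by blast
  have "ptime_upto m (\<lambda>x \<rho>. of_bool (input_bit x (f x \<rho>)))"
    unfolding ptime_upto_def
  proof (intro conjI allI impI)
    fix r assume "r \<ge> m"
    then obtain P where P: "\<And>G. pbound G \<Longrightarrow> \<exists>g. pbound g \<and> computes m r P f G g"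
      using m unfolding ptime_upto_def by blast
    let ?P = "Seq P (Assign r (Mem (Reg r)))"
    have "\<exists>g. pbound g \<and> computes m r ?P (\<lambda>x \<rho>. of_bool (input_bit x (f x \<rho>))) G g" if "pbound G" for G
    proof -
      from P[OF that] obtain g where g: "pbound g" "computes m r P f G g" by blast
      define g' where "g' n = g n + (2 * bit_length r + g n + 2)" for n
      have "pbound g'" unfolding g'_def using g by (intro pbound_intros)
      moreover have "computes m r ?P (\<lambda>x \<rho>. of_bool (input_bit x (f x \<rho>))) G g'"
        unfolding computes_def
      proof (intro allI impI conjI; elim conjE)
        fix x s assume s: "snd s = input_memory x" "fst s 0 = length x" "\<forall>v<m. fst s v \<le> G (length x)"
        \<comment> \<open>Memory cells beyond the input hold 0, which agrees with
          \<open>input_bit\<close> being false there.\<close>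
        have *: "input_memory x i = of_bool (input_bit x i)" for i
          by (simp add: initial_state_def input_bit_def)
        have b: "bit_length (of_bool B) \<le> 2" for B
          using bit_length_le_Suc[of "of_bool B"] by (cases B) auto
        show "bit_length (of_bool (input_bit x (f x (fst s)))) \<le> g' (length x)"
          using b[of "input_bit x (f x (fst s))"] unfolding g'_def by linarith
        show "runs ?P s (g' (length x)) (\<lambda>s'. snd s' = snd s \<and> (\<forall>v<r. fst s' v = fst s v) \<and>
           fst s' r = of_bool (input_bit x (f x (fst s))))"
          unfolding g'_def
        proof (rule runs_Seq[OF computesD(2)[OF g(2) s(1,2)]])
          fix s' assume s': "snd s' = snd s \<and> (\<forall>v<r. fst s' v = fst s v) \<and> fst s' r = f x (fst s)"
          show "runs (Assign r (Mem (Reg r))) s' (2 * bit_length r + g (length x) + 2)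
              (\<lambda>s'. snd s' = snd s \<and> (\<forall>v<r. fst s' v = fst s v) \<and>
              fst s' r = of_bool (input_bit x (f x (fst s))))"
            using s' s * computesD(1)[OF g(2) s(1,2)] b[of "input_bit x (f x (fst s))"]
            by (intro runs_Assign) auto
        qed (use s in auto)
      qed
      ultimately show ?thesis by blast
    qed
    then show "\<exists>P. \<forall>G. pbound G \<longrightarrow>
      (\<exists>g. pbound g \<and> computes m r P (\<lambda>x \<rho>. of_bool (input_bit x (f x \<rho>))) G g)" by blast
  next
    fix x and \<rho> \<rho>' :: "nat \<Rightarrow> nat" assume "\<forall>v<m. \<rho> v = \<rho>' v"
    then have "f x \<rho> = f x \<rho>'" using m unfolding ptime_upto_def by blast
    then show "of_bool (input_bit x (f x \<rho>)) = of_bool (input_bit x (f x \<rho>'))" by simp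
  qed (use m in \<open>auto simp: ptime_upto_def\<close>)
  then show ?thesis unfolding ptime_def by blast
qed

text \<open>The first operand waits in register \<open>r\<close> while the second is computed with
  index \<open>Suc r\<close>, which leaves \<open>r\<close> intact. Assumption \<open>len\<close>
  keeps the result short; it holds for all four machine operations, because differences and
  quotients do not exceed their first operand.\<close>

lemma ptime_op:
  assumes "ptime f1" "ptime f2"
    and val: "\<And>s e1 e2. val s (con e1 e2) = opr (val s e1) (val s e2)"
    and cost: "\<And>s e1 e2. cost s (con e1 e2) = cost s e1 + cost s e2 + bit_length (val s (con e1 e2))"
    and len: "\<And>a b. bit_length (opr a b) \<le> bit_length a + bit_length b"
  shows "ptime (\<lambda>x \<rho>. opr (f1 x \<rho>) (f2 x \<rho>))"
proof -
  obtain m1 m2 where m12: "ptime_upto m1 f1" "ptime_upto m2 f2" using assms unfolding ptime_def by blast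
  define m where "m = max m1 m2"
  have m: "ptime_upto m f1" "ptime_upto m f2"
    using m12 ptime_upto_mono unfolding m_def by (meson max.cobounded1 max.cobounded2)+
  let ?f = "\<lambda>x \<rho>. opr (f1 x \<rho>) (f2 x \<rho>)"
  have cong: "?f x \<rho> = ?f x \<rho>'" "f2 x \<rho> = f2 x \<rho>'" if "\<forall>v<m. \<rho> v = \<rho>' v" for x \<rho> \<rho>'
    using m that unfolding ptime_upto_def by metis+
  have "ptime_upto m ?f"
    unfolding ptime_upto_def
  proof (intro conjI allI impI)
    fix r assume r: "r \<ge> m"
    then obtain P1 where P1: "\<And>G. pbound G \<Longrightarrow> \<exists>g. pbound g \<and> computes m r P1 f1 G g"
      using m unfolding ptime_upto_def by blast
    from r have "Suc r \<ge> m" by simp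
    then obtain P2 where P2: "\<And>G. pbound G \<Longrightarrow> \<exists>g. pbound g \<and> computes m (Suc r) P2 f2 G g"
      using m unfolding ptime_upto_def by blast
    let ?A = "Assign r (con (Reg r) (Reg (Suc r)))"
    let ?P = "Seq P1 (Seq P2 ?A)"
    have "\<exists>g. pbound g \<and> computes m r ?P ?f G g" if "pbound G" for G
    proof -
      from P1[OF that] P2[OF that] obtain g1 g2
        where g: "pbound g1" "computes m r P1 f1 G g1" "pbound g2" "computes m (Suc r) P2 f2 G g2" by blast
      define g' where "g' n = g1 n + (g2 n + (2 * bit_length r + bit_length (Suc r) + 2 * g1 n + 2 * g2 n))" for n
      have "pbound g'" unfolding g'_def using g by (intro pbound_intros)
      moreover have "computes m r ?P ?f G g'"
        unfolding computes_def
      proof (intro allI impI conjI; elim conjE)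
        fix x s assume s: "snd s = input_memory x" "fst s 0 = length x" "\<forall>v<m. fst s v \<le> G (length x)"
        have s0: "v < m \<Longrightarrow> fst s v \<le> G (length x)" for v using s by blast
        note b1 = computesD(1)[OF g(2) s(1,2) s0] and b2 = computesD(1)[OF g(4) s(1,2) s0]
        have b: "bit_length (?f x (fst s)) \<le> g1 (length x) + g2 (length x)"
          using len[of "f1 x (fst s)" "f2 x (fst s)"] b1 b2 by linarith
        then show "bit_length (?f x (fst s)) \<le> g' (length x)"
          unfolding g'_def by linarith
        show "runs ?P s (g' (length x)) (\<lambda>s'. snd s' = snd s \<and> (\<forall>v<r. fst s' v = fst s v) \<and>
           fst s' r = ?f x (fst s))"
          unfolding g'_def
        proof (rule runs_Seq[OF computesD(2)[OF g(2) s(1,2) s0]])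
          fix s1 assume s1: "snd s1 = snd s \<and> (\<forall>v<r. fst s1 v = fst s v) \<and> fst s1 r = f1 x (fst s)"
          have m1: "\<forall>v<m. fst s1 v = fst s v" using s1 r by auto
          then have f2: "f2 x (fst s1) = f2 x (fst s)" using cong(2) by blast
          have a: "snd s1 = input_memory x" "fst s1 0 = length x" "\<And>v. v < m \<Longrightarrow> fst s1 v \<le> G (length x)"
            using s s1 m1 m(1) unfolding ptime_upto_def by auto
          show "runs (Seq P2 ?A) s1 (g2 (length x) + (2 * bit_length r + bit_length (Suc r)
               + 2 * g1 (length x) + 2 * g2 (length x)))
              (\<lambda>s'. snd s' = snd s \<and> (\<forall>v<r. fst s' v = fst s v) \<and> fst s' r = ?f x (fst s))"
          proof (rule runs_Seq[OF computesD(2)[OF g(4) a]])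
            fix s2 assume s2: "snd s2 = snd s1 \<and> (\<forall>v<Suc r. fst s2 v = fst s1 v) \<and> fst s2 (Suc r) = f2 x (fst s1)"
            show "runs ?A s2 (2 * bit_length r + bit_length (Suc r) + 2 * g1 (length x) + 2 * g2 (length x))
              (\<lambda>s'. snd s' = snd s \<and> (\<forall>v<r. fst s' v = fst s v) \<and> fst s' r = ?f x (fst s))"
              using s2 s1 f2 b b1 b2 by (intro runs_Assign) (auto simp: val cost)
          qed
        qed
      qed
      ultimately show ?thesis by blast
    qed
    then show "\<exists>P. \<forall>G. pbound G \<longrightarrow> (\<exists>g. pbound g \<and> computes m r P ?f G g)" by blast
  qed (use m cong in \<open>auto simp: ptime_upto_def\<close>)
  then show ?thesis unfolding ptime_def by blast
qed

section \<open>Closure under arithmetic, iterated sums and iterated products\<close>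

lemma ptime_add: "ptime f \<Longrightarrow> ptime g \<Longrightarrow> ptime (\<lambda>x \<rho>. f x \<rho> + g x \<rho>)"
  by (rule ptime_op[of f g Add]) (auto simp: bit_length_add)

lemma ptime_mult: "ptime f \<Longrightarrow> ptime g \<Longrightarrow> ptime (\<lambda>x \<rho>. f x \<rho> * g x \<rho>)"
  by (rule ptime_op[of f g Mul]) (auto simp: bit_length_mult)

lemma ptime_sub: "ptime f \<Longrightarrow> ptime g \<Longrightarrow> ptime (\<lambda>x \<rho>. f x \<rho> - g x \<rho>)"
  by (rule ptime_op[of f g Sub]) (auto simp: trans_le_add1 bit_length_mono)

lemma ptime_div: "ptime f \<Longrightarrow> ptime g \<Longrightarrow> ptime (\<lambda>x \<rho>. f x \<rho> div g x \<rho>)"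
  by (rule ptime_op[of f g Div]) (auto simp: trans_le_add1 bit_length_mono)

text \<open>Needed for numbers of rounds and for exponents: a computable value may be exponentially
  large. The bound is uniform in the environment, so it survives any nesting of loops.\<close>

definition bounded_value :: "(bool list \<Rightarrow> (nat \<Rightarrow> nat) \<Rightarrow> nat) \<Rightarrow> bool" where
  "bounded_value b \<longleftrightarrow> (\<exists>g. pbound g \<and> (\<forall>x \<rho>. b x \<rho> \<le> g (length x)))"

text \<open>A single counting loop, abstract in the accumulating operation, from which both sums and
  products are obtained. The variable \<open>v\<close> serves as the counter and is restored
  afterwards.\<close>

lemma ptime_iterate:
  assumes "ptime b" "bounded_value b" "ptime f" "v > 0"
    and F0: "\<And>x \<rho>. F x \<rho> 0 = k"
    and FSuc: "\<And>x \<rho> i. F x \<rho> (Suc i) = opr (F x \<rho> i) (f x (\<rho>(v := i)))"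
    and val: "\<And>s e1 e2. val s (con e1 e2) = opr (val s e1) (val s e2)"
    and cost: "\<And>s e1 e2. cost s (con e1 e2) = cost s e1 + cost s e2 + bit_length (val s (con e1 e2))"
    and len: "\<And>a b. bit_length (opr a b) \<le> bit_length a + bit_length b"
  shows "ptime (\<lambda>x \<rho>. F x \<rho> (b x \<rho>))"
proof -
  obtain m1 m2 where m12: "ptime_upto m1 b" "ptime_upto m2 f" using assms unfolding ptime_def by blast
  define m where "m = max (max m1 m2) (Suc v)"
  have m: "ptime_upto m b" "ptime_upto m f" "v < m"
    using m12 ptime_upto_mono[of m1 b m] ptime_upto_mono[of m2 f m] unfolding m_def by auto
  obtain bb where bb: "pbound bb" "\<And>x \<rho>. b x \<rho> \<le> bb (length x)"
    using assms(2) unfolding bounded_value_def by blast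
  have congf: "f x \<rho> = f x \<rho>'" and congb: "b x \<rho> = b x \<rho>'"
    if "\<forall>w<m. \<rho> w = \<rho>' w" for x \<rho> \<rho>'
    using m that unfolding ptime_upto_def by metis+
  have congF: "F x \<rho> i = F x \<rho>' i" if "\<forall>w<m. \<rho> w = \<rho>' w" for x \<rho> \<rho>' i
  proof (induction i)
    case (Suc i)
    have "f x (\<rho>(v := i)) = f x (\<rho>'(v := i))" using that by (intro congf) auto
    then show ?case using Suc by (simp add: FSuc)
  qed (simp add: F0)
  let ?f = "\<lambda>x \<rho>. F x \<rho> (b x \<rho>)"
  have "ptime_upto m ?f"
    unfolding ptime_upto_def
  proof (intro conjI allI impI)
    fix r assume r: "r \<ge> m"
    then have "r + 2 \<ge> m" "r + 3 \<ge> m" by simp_all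
    then obtain P1 P2
      where P1: "\<And>G. pbound G \<Longrightarrow> \<exists>g. pbound g \<and> computes m (r + 2) P1 b G g"
        and P2: "\<And>G. pbound G \<Longrightarrow> \<exists>g. pbound g \<and> computes m (r + 3) P2 f G g"
      using m unfolding ptime_upto_def by meson
    have vr: "v < r" using m r by simp
    \<comment> \<open>Register plan: \<open>r\<close> is the accumulator, \<open>r + 1\<close> saves
      the old content of \<open>v\<close>, \<open>r + 2\<close> holds the number of rounds, and the
      body works from \<open>r + 3\<close> on.\<close>
    define A1 where "A1 = Assign (r + 1) (Reg v)"
    define A2 where "A2 = Assign r (Const k)"
    define A3 where "A3 = Assign v (Const 0)"
    define A4 where "A4 = Assign r (con (Reg r) (Reg (r + 3)))"
    define A5 where "A5 = Assign v (Add (Reg v) (Const 1))"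
    define A6 where "A6 = Assign v (Reg (r + 1))"
    \<comment> \<open>With truncated subtraction this is nonzero exactly while the counter is below
      the number of rounds.\<close>
    define test where "test = Sub (Reg (r + 2)) (Reg v)"
    define Body where "Body = Seq P2 (Seq A4 A5)"
    define P where "P = Seq P1 (Seq A1 (Seq A2 (Seq A3 (Seq (While test Body) A6))))"
    have "\<exists>g. pbound g \<and> computes m r P ?f G g" if G: "pbound G" for G
    proof -
      from P1[OF G] obtain g1 where g1: "pbound g1" "computes m (r + 2) P1 b G g1" by blast
      \<comment> \<open>Within the body, register \<open>v\<close> contains the counter, bounded by
        \<open>bb\<close>; all other variables still obey \<open>G\<close>.\<close>
      have "pbound (\<lambda>n. G n + bb n)" using G bb by (intro pbound_intros)
      from P2[OF this] obtain g2
        where g2: "pbound g2" "computes m (r + 3) P2 f (\<lambda>n. G n + bb n) g2" by blast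
      define R where "R = bit_length r + bit_length (r + 1) + bit_length (r + 2) + bit_length (r + 3)
        + bit_length v + bit_length k + bit_length 1 + bit_length 0"
      \<comment> \<open>By \<open>len\<close> each round lengthens the accumulator by at most the
        length of one term. Its length thus grows linearly, even when the terms are
        multiplied.\<close>
      define L where "L n = bit_length k + bb n * g2 n" for n
      define tA where "tA n = 2 * R + 2 * (G n + 1)" for n
      define tB where "tB n = g2 n + ((3 * R + 2 * L n + 2 * g2 n) + (3 * R + 2 * (bb n + 2)))" for n
      define \<kappa> where "\<kappa> n = 2 * R + 3 * (bb n + 1)" for n
      define g' where "g' n = g1 n + (tA n + (tA n + (tA n + ((bb n * (\<kappa> n + tB n) + \<kappa> n) + tA n)))) + L n" for n
      have "pbound g'" unfolding g'_def tA_def tB_def \<kappa>_def L_def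
        using G bb g1 g2 by (intro pbound_intros)
      moreover have "computes m r P ?f G g'"
        unfolding computes_def
      proof (intro allI impI; elim conjE)
        fix x s assume s: "snd s = input_memory x" "fst s 0 = length x" "\<forall>v<m. fst s v \<le> G (length x)"
        have s0: "w < m \<Longrightarrow> fst s w \<le> G (length x)" for w using s by blast
        let ?n = "length x" and ?\<rho> = "fst s"
        define B where "B = b x ?\<rho>"
        have B: "B \<le> bb ?n" unfolding B_def by (rule bb)
        define Inv where "Inv i s' \<longleftrightarrow> snd s' = snd s \<and> (\<forall>w<r. w \<noteq> v \<longrightarrow> fst s' w = ?\<rho> w) \<and> fst s' v = i \<and>
          fst s' (r + 1) = ?\<rho> v \<and> fst s' (r + 2) = B \<and> fst s' r = F x ?\<rho> i" for i s'
        have body: "bit_length (f x (?\<rho>(v := i))) \<le> g2 ?n \<and>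
            runs P2 s' (g2 ?n) (\<lambda>s''. Inv i s'' \<and> fst s'' (r + 3) = f x (?\<rho>(v := i)))"
          if "i < B" "Inv i s'" for i s'
        proof -
          have eq: "\<forall>w<m. fst s' w = (?\<rho>(v := i)) w" using that r unfolding Inv_def by auto
          have c: "snd s' = input_memory x" "fst s' 0 = length x" "\<And>w. w < m \<Longrightarrow> fst s' w \<le> G ?n + bb ?n"
            using eq that s assms(4) B m(1) unfolding Inv_def ptime_upto_def by (auto simp: trans_le_add1)
          have f: "f x (fst s') = f x (?\<rho>(v := i))" using eq by (rule congf)
          have "runs P2 s' (g2 ?n) (\<lambda>s''. Inv i s'' \<and> fst s'' (r + 3) = f x (?\<rho>(v := i)))"
            by (rule runs_weaken[OF computesD(2)[OF g2(2) c]])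
              (use that(2) vr in \<open>auto simp: Inv_def f\<close>)
          then show ?thesis using computesD(1)[OF g2(2) c] f by simp
        qed
        have FL: "bit_length (F x ?\<rho> i) \<le> bit_length k + i * g2 ?n" if "i \<le> B" for i
          using that
        proof (induction i)
          case (Suc i)
          have "bit_length (f x (?\<rho>(v := i))) \<le> g2 ?n"
          proof -
            \<comment> \<open>An artificial state: only the length bound contained in
              \<open>computes\<close> is wanted here, not a run of the program.\<close>
            define s' where "s' = (?\<rho>(v := i), snd s)"
            have c: "snd s' = input_memory x" "fst s' 0 = length x" "\<And>w. w < m \<Longrightarrow> fst s' w \<le> G ?n + bb ?n"
              using s assms(4) B Suc.prems unfolding s'_def by (auto simp: trans_le_add1)
            show ?thesis using computesD(1)[OF g2(2) c] by (simp add: s'_def)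
          qed
          then show ?case using len[of "F x ?\<rho> i" "f x (?\<rho>(v := i))"] Suc by (simp add: FSuc)
        qed (simp add: F0)
        have FL': "bit_length (F x ?\<rho> i) \<le> L ?n" if "i \<le> B" for i
        proof -
          have "i * g2 ?n \<le> bb ?n * g2 ?n" using that B by (intro mult_le_mono1) simp
          with FL[OF that] show ?thesis unfolding L_def by linarith
        qed
        have small: "bit_length i \<le> bb ?n + 2" if "i \<le> bb ?n + 1" for i
          using bit_length_mono[OF that] bit_length_le_Suc[of "bb ?n + 1"] by simp
        have small': "bit_length i \<le> bb ?n + 1" if "i \<le> bb ?n" for i
          using bit_length_mono[OF that] bit_length_le_Suc[of "bb ?n"] by simp
        have bv: "bit_length (?\<rho> v) \<le> G ?n + 1"
          using bit_length_mono[OF s0[OF m(3)]] bit_length_le_Suc[of "G ?n"] by linarith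
        have "runs (While test Body) s' (B * (\<kappa> ?n + tB ?n) + \<kappa> ?n) (Inv B)" if "Inv 0 s'" for s'
        proof (rule runs_While[where Inv = Inv, OF that], intro conjI)
          fix i s1 assume i: "i < B" "Inv i s1"
          then show "val s1 test \<noteq> 0" unfolding test_def Inv_def by simp
          have "bit_length i \<le> bb ?n + 1" "bit_length B \<le> bb ?n + 1" "bit_length (B - i) \<le> bb ?n + 1"
            using i B small'[of i] small'[of B] small'[of "B - i"] by linarith+
          then show "cost s1 test \<le> \<kappa> ?n"
            using i unfolding test_def Inv_def \<kappa>_def R_def by simp
          show "runs Body s1 (tB ?n) (Inv (Suc i))"
            unfolding Body_def tB_def
          proof (rule runs_Seq[OF conjunct2[OF body[OF i]]])
            fix s2 assume s2: "Inv i s2 \<and> fst s2 (r + 3) = f x (?\<rho>(v := i))"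
            have l: "bit_length (F x ?\<rho> i) \<le> L ?n" "bit_length (F x ?\<rho> (Suc i)) \<le> L ?n"
                "bit_length (f x (?\<rho>(v := i))) \<le> g2 ?n"
              using FL' i body[OF i] by auto
            show "runs (Seq A4 A5) s2 ((3 * R + 2 * L ?n + 2 * g2 ?n) + (3 * R + 2 * (bb ?n + 2))) (Inv (Suc i))"
            \<comment> \<open>After \<open>A4\<close> the accumulator is one round ahead of the
              counter. The intermediate assertion expresses this by \<open>Inv i\<close> with the
              old accumulator put back.\<close>
            proof (rule runs_Seq[where \<Psi> = "\<lambda>s'. Inv i (( fst s')(r := F x ?\<rho> i), snd s') \<and>
                  fst s' r = F x ?\<rho> (Suc i)"])
              have "fst s2 r = F x ?\<rho> i" using s2 by (simp add: Inv_def)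
              then show "runs A4 s2 (3 * R + 2 * L ?n + 2 * g2 ?n)
                  (\<lambda>s'. Inv i ((fst s')(r := F x ?\<rho> i), snd s') \<and> fst s' r = F x ?\<rho> (Suc i))"
                unfolding A4_def
                using s2 l by (intro runs_Assign) (auto simp: Inv_def val cost FSuc R_def)
            next
              fix s3 assume s3: "Inv i ((fst s3)(r := F x ?\<rho> i), snd s3) \<and> fst s3 r = F x ?\<rho> (Suc i)"
              have "bit_length i \<le> bb ?n + 2" "bit_length (Suc i) \<le> bb ?n + 2"
                using i B small[of i] small[of "Suc i"] by linarith+
              moreover have "fst s3 v = i" using s3 vr by (simp add: Inv_def)
              ultimately show "runs A5 s3 (3 * R + 2 * (bb ?n + 2)) (Inv (Suc i))"
                unfolding A5_def
                using s3 vr by (intro runs_Assign) (auto simp: Inv_def R_def)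
            qed
          qed
        next
          fix s1 assume i: "Inv B s1"
          then have "val s1 test = 0" unfolding test_def Inv_def by simp
          moreover have "bit_length 0 \<le> bb ?n + 1" "bit_length B \<le> bb ?n + 1"
            using B small'[of 0] small'[of B] by linarith+
          then have "cost s1 test \<le> \<kappa> ?n"
            using i unfolding test_def Inv_def \<kappa>_def R_def by simp
          ultimately show "val s1 test = 0 \<and> cost s1 test \<le> \<kappa> ?n" by blast
        qed
        moreover have "B * (\<kappa> ?n + tB ?n) + \<kappa> ?n \<le> bb ?n * (\<kappa> ?n + tB ?n) + \<kappa> ?n"
          using B by (simp add: mult_le_mono1)
        ultimately have while: "runs (While test Body) s' (bb ?n * (\<kappa> ?n + tB ?n) + \<kappa> ?n) (Inv B)"
          if "Inv 0 s'" for s'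
          using that runs_weaken by blast
        have len: "bit_length (?f x ?\<rho>) \<le> L ?n" using FL'[of B] unfolding B_def by simp
        have "runs P s (g1 ?n + (tA ?n + (tA ?n + (tA ?n + ((bb ?n * (\<kappa> ?n + tB ?n) + \<kappa> ?n) + tA ?n)))))
           (\<lambda>s'. snd s' = snd s \<and> (\<forall>v<r. fst s' v = fst s v) \<and> fst s' r = ?f x ?\<rho>)"
          unfolding P_def
        proof (rule runs_Seq[OF computesD(2)[OF g1(2) s(1,2) s0]])
          fix s1 assume s1: "snd s1 = snd s \<and> (\<forall>w<r + 2. fst s1 w = ?\<rho> w) \<and> fst s1 (r + 2) = b x ?\<rho>"
          show "runs (Seq A1 (Seq A2 (Seq A3 (Seq (While test Body) A6)))) s1
              (tA ?n + (tA ?n + (tA ?n + ((bb ?n * (\<kappa> ?n + tB ?n) + \<kappa> ?n) + tA ?n))))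
              (\<lambda>s'. snd s' = snd s \<and> (\<forall>v<r. fst s' v = fst s v) \<and> fst s' r = ?f x ?\<rho>)"
          proof (rule runs_Seq[where \<Psi> = "\<lambda>s'. snd s' = snd s \<and> (\<forall>w<r. fst s' w = ?\<rho> w) \<and>
              fst s' (r + 2) = B \<and> fst s' (r + 1) = ?\<rho> v"])
            show "runs A1 s1 (tA ?n) (\<lambda>s'. snd s' = snd s \<and> (\<forall>w<r. fst s' w = ?\<rho> w) \<and>
              fst s' (r + 2) = B \<and> fst s' (r + 1) = ?\<rho> v)"
              unfolding A1_def using s1 vr bv
              by (intro runs_Assign) (auto simp: B_def tA_def R_def)
          next
            fix s2 assume s2: "snd s2 = snd s \<and> (\<forall>w<r. fst s2 w = ?\<rho> w) \<and> fst s2 (r + 2) = B \<and> fst s2 (r + 1) = ?\<rho> v"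
            show "runs (Seq A2 (Seq A3 (Seq (While test Body) A6))) s2
              (tA ?n + (tA ?n + ((bb ?n * (\<kappa> ?n + tB ?n) + \<kappa> ?n) + tA ?n)))
              (\<lambda>s'. snd s' = snd s \<and> (\<forall>v<r. fst s' v = fst s v) \<and> fst s' r = ?f x ?\<rho>)"
            proof (rule runs_Seq[where \<Psi> = "\<lambda>s'. snd s' = snd s \<and> (\<forall>w<r. fst s' w = ?\<rho> w) \<and>
                fst s' (r + 2) = B \<and> fst s' (r + 1) = ?\<rho> v \<and> fst s' r = k"])
              show "runs A2 s2 (tA ?n) (\<lambda>s'. snd s' = snd s \<and> (\<forall>w<r. fst s' w = ?\<rho> w) \<and>
                  fst s' (r + 2) = B \<and> fst s' (r + 1) = ?\<rho> v \<and> fst s' r = k)"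
                unfolding A2_def using s2 vr bv
                by (intro runs_Assign) (auto simp: tA_def R_def)
            next
              fix s3 assume s3: "snd s3 = snd s \<and> (\<forall>w<r. fst s3 w = ?\<rho> w) \<and>
                fst s3 (r + 2) = B \<and> fst s3 (r + 1) = ?\<rho> v \<and> fst s3 r = k"
              show "runs (Seq A3 (Seq (While test Body) A6)) s3
                (tA ?n + ((bb ?n * (\<kappa> ?n + tB ?n) + \<kappa> ?n) + tA ?n))
                (\<lambda>s'. snd s' = snd s \<and> (\<forall>v<r. fst s' v = fst s v) \<and> fst s' r = ?f x ?\<rho>)"
              proof (rule runs_Seq[where \<Psi> = "Inv 0"])
                show "runs A3 s3 (tA ?n) (Inv 0)"
                  unfolding A3_def using s3 vr bv
                  by (intro runs_Assign) (auto simp: tA_def R_def Inv_def F0)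
              next
                fix s4 assume "Inv 0 s4"
                show "runs (Seq (While test Body) A6) s4 ((bb ?n * (\<kappa> ?n + tB ?n) + \<kappa> ?n) + tA ?n)
                  (\<lambda>s'. snd s' = snd s \<and> (\<forall>v<r. fst s' v = fst s v) \<and> fst s' r = ?f x ?\<rho>)"
                proof (rule runs_Seq[OF while[OF \<open>Inv 0 s4\<close>]])
                  fix s5 assume s5: "Inv B s5"
                  then have "fst s5 (r + 1) = ?\<rho> v" by (simp add: Inv_def)
                  then show "runs A6 s5 (tA ?n)
                    (\<lambda>s'. snd s' = snd s \<and> (\<forall>v<r. fst s' v = fst s v) \<and> fst s' r = ?f x ?\<rho>)"
                    unfolding A6_def using s5 vr bv
                    by (intro runs_Assign) (auto simp: tA_def R_def Inv_def B_def)
                qed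
              qed
            qed
          qed
        qed
        then have "runs P s (g' ?n)
           (\<lambda>s'. snd s' = snd s \<and> (\<forall>v<r. fst s' v = fst s v) \<and> fst s' r = ?f x ?\<rho>)"
          by (rule runs_weaken) (auto simp: g'_def)
        moreover have "bit_length (?f x ?\<rho>) \<le> g' ?n" using len by (simp add: g'_def)
        ultimately show "bit_length (?f x ?\<rho>) \<le> g' ?n \<and> runs P s (g' ?n)
           (\<lambda>s'. snd s' = snd s \<and> (\<forall>v<r. fst s' v = fst s v) \<and> fst s' r = ?f x ?\<rho>)" by blast
      qed
      ultimately show ?thesis by blast
    qed
    then show "\<exists>P. \<forall>G. pbound G \<longrightarrow> (\<exists>g. pbound g \<and> computes m r P ?f G g)" by blast
  next
    fix x and \<rho> \<rho>' :: "nat \<Rightarrow> nat" assume "\<forall>v<m. \<rho> v = \<rho>' v"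
    then show "?f x \<rho> = ?f x \<rho>'" using congF congb by metis
  qed (use m in \<open>auto simp: ptime_upto_def\<close>)
  then show ?thesis unfolding ptime_def by blast
qed

text \<open>Assumption \<open>indep\<close> is the freshness of the loop variable \<open>v\<close>:
  the summand may consult it only through its index.\<close>

lemma ptime_sum:
  assumes "ptime b" "bounded_value b" "v > 0" "ptime (\<lambda>x \<rho>. f x \<rho> (\<rho> v))"
    and indep: "\<And>x \<rho> i j. f x (\<rho>(v := j)) i = f x \<rho> i"
  shows "ptime (\<lambda>x \<rho>. \<Sum>i<b x \<rho>. f x \<rho> i)"
  by (rule ptime_iterate[OF assms(1,2,4,3), of "\<lambda>x \<rho> n. \<Sum>i<n. f x \<rho> i" 0 "(+)" Add])
    (auto simp: indep bit_length_add)

lemma ptime_prod: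
  assumes "ptime b" "bounded_value b" "v > 0" "ptime (\<lambda>x \<rho>. f x \<rho> (\<rho> v))"
    and indep: "\<And>x \<rho> i j. f x (\<rho>(v := j)) i = f x \<rho> i"
  shows "ptime (\<lambda>x \<rho>. \<Prod>i<b x \<rho>. f x \<rho> i)"
  by (rule ptime_iterate[OF assms(1,2,4,3), of "\<lambda>x \<rho> n. \<Prod>i<n. f x \<rho> i" 1 "(*)" Mul])
    (auto simp: indep bit_length_mult)

lemma ptime_power:
  assumes "ptime f" "ptime b" "bounded_value b"
  shows "ptime (\<lambda>x \<rho>. f x \<rho> ^ b x \<rho>)"
proof -
  obtain m where m: "ptime_upto m f" using assms unfolding ptime_def by blast
  \<comment> \<open>The variable \<open>m\<close> is fresh, because \<open>f\<close> depends only on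
    variables below \<open>m\<close>.\<close>
  have "f x (\<rho>(m := j)) = f x \<rho>" for x \<rho> j
    using m unfolding ptime_upto_def by (metis fun_upd_other nat_neq_iff)
  moreover have "m > 0" using m unfolding ptime_upto_def by blast
  ultimately have "ptime (\<lambda>x \<rho>. \<Prod>i<b x \<rho>. f x \<rho>)"
    by (intro ptime_prod[of b m "\<lambda>x \<rho> i. f x \<rho>"] assms)
  then show ?thesis by simp
qed

lemma ptime_power_const: "ptime f \<Longrightarrow> ptime (\<lambda>x \<rho>. f x \<rho> ^ k)"
  by (induction k) (simp_all add: ptime_const ptime_mult)

text \<open>Here the index set is fixed together with the program, so the sum is unrolled; neither a
  loop nor a bound on its length is involved.\<close>

lemma ptime_finite_sum:
  assumes "\<And>a. a \<in> A \<Longrightarrow> ptime (f a)"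
  shows "ptime (\<lambda>x \<rho>. \<Sum>a\<in>A. f a x \<rho>)"
proof (cases "finite A")
  case True
  from this assms show ?thesis
    by (induction A) (auto simp: ptime_const intro!: ptime_add)
qed (simp add: ptime_const)

lemma ptime_finite_prod:
  assumes "\<And>a. a \<in> A \<Longrightarrow> ptime (f a)"
  shows "ptime (\<lambda>x \<rho>. \<Prod>a\<in>A. f a x \<rho>)"
proof (cases "finite A")
  case True
  from this assms show ?thesis
    by (induction A) (auto simp: ptime_const intro!: ptime_mult)
qed (simp add: ptime_const)

lemma ptime_mod:
  assumes "ptime f" "ptime g"
  shows "ptime (\<lambda>x \<rho>. f x \<rho> mod g x \<rho>)"
proof -
  have "ptime (\<lambda>x \<rho>. f x \<rho> - f x \<rho> div g x \<rho> * g x \<rho>)"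
    by (intro ptime_sub ptime_mult ptime_div assms)
  then show ?thesis by (simp add: minus_div_mult_eq_mod)
qed

section \<open>Predicates as functions with values 0 and 1\<close>

abbreviation ptime_pred :: "(bool list \<Rightarrow> (nat \<Rightarrow> nat) \<Rightarrow> bool) \<Rightarrow> bool" where
  "ptime_pred p \<equiv> ptime (\<lambda>x \<rho>. of_bool (p x \<rho>))"

lemma ptime_pred_const: "ptime_pred (\<lambda>x \<rho>. b)"
  by (rule ptime_const)

lemma ptime_pred_not:
  assumes "ptime_pred p"
  shows "ptime_pred (\<lambda>x \<rho>. \<not> p x \<rho>)"
  using ptime_sub[OF ptime_const[of 1] assms] by (rule back_subst[of ptime]) (auto simp: fun_eq_iff)

lemma ptime_pred_conj: "ptime_pred p \<Longrightarrow> ptime_pred q \<Longrightarrow> ptime_pred (\<lambda>x \<rho>. p x \<rho> \<and> q x \<rho>)"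
  unfolding of_bool_conj by (rule ptime_mult)

lemma ptime_pred_disj: "ptime_pred p \<Longrightarrow> ptime_pred q \<Longrightarrow> ptime_pred (\<lambda>x \<rho>. p x \<rho> \<or> q x \<rho>)"
  using ptime_pred_not[OF ptime_pred_conj[OF ptime_pred_not ptime_pred_not]] by simp

lemma ptime_pred_imp: "ptime_pred p \<Longrightarrow> ptime_pred q \<Longrightarrow> ptime_pred (\<lambda>x \<rho>. p x \<rho> \<longrightarrow> q x \<rho>)"
  unfolding imp_conv_disj by (intro ptime_pred_disj ptime_pred_not)

lemma ptime_pred_less:
  assumes "ptime f" "ptime g"
  shows "ptime_pred (\<lambda>x \<rho>. f x \<rho> < g x \<rho>)"
proof -
  let ?d = "\<lambda>x \<rho>. g x \<rho> - f x \<rho>"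
  \<comment> \<open>Division by 0 yields 0, so \<open>d div d\<close> is the indicator of
    \<open>d > 0\<close>.\<close>
  have "ptime (\<lambda>x \<rho>. ?d x \<rho> div ?d x \<rho>)" by (intro ptime_div ptime_sub assms)
  moreover have "(d :: nat) div d = of_bool (d > 0)" for d by simp
  ultimately show ?thesis by (simp only: zero_less_diff)
qed

lemma ptime_pred_eq:
  assumes "ptime f" "ptime g"
  shows "ptime_pred (\<lambda>x \<rho>. f x \<rho> = g x \<rho>)"
proof -
  have "ptime_pred (\<lambda>x \<rho>. \<not> f x \<rho> < g x \<rho> \<and> \<not> g x \<rho> < f x \<rho>)"
    by (intro ptime_pred_conj ptime_pred_not ptime_pred_less assms)
  then show ?thesis by (rule back_subst[of ptime]) (auto simp: fun_eq_iff)
qed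

lemma ptime_pred_iff:
  assumes "ptime_pred p" "ptime_pred q"
  shows "ptime_pred (\<lambda>x \<rho>. p x \<rho> \<longleftrightarrow> q x \<rho>)"
  unfolding iff_conv_conj_imp by (intro ptime_pred_conj ptime_pred_imp assms)

lemma ptime_pred_Ball:
  assumes "finite A" "\<And>a. a \<in> A \<Longrightarrow> ptime_pred (p a)"
  shows "ptime_pred (\<lambda>x \<rho>. \<forall>a\<in>A. p a x \<rho>)"
  using assms
proof (induction A rule: finite_induct)
  case (insert a A)
  then have "ptime_pred (\<lambda>x \<rho>. p a x \<rho> \<and> (\<forall>a\<in>A. p a x \<rho>))"
    by (intro ptime_pred_conj) auto
  then show ?case by simp
qed (simp add: ptime_const)

lemma ptime_pred_Bex:
  assumes "finite A" "\<And>a. a \<in> A \<Longrightarrow> ptime_pred (p a)"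
  shows "ptime_pred (\<lambda>x \<rho>. \<exists>a\<in>A. p a x \<rho>)"
proof -
  have "ptime_pred (\<lambda>x \<rho>. \<not> (\<forall>a\<in>A. \<not> p a x \<rho>))"
    by (intro ptime_pred_not ptime_pred_Ball assms)
  then show ?thesis by simp
qed

lemma prod_of_bool: "(\<Prod>i<(n::nat). of_bool (p i)) = (of_bool (\<forall>i<n. p i) :: nat)"
  by (induction n) (auto simp: less_Suc_eq)

lemma ptime_pred_all_less:
  assumes "ptime b" "bounded_value b" "v > 0" "ptime_pred (\<lambda>x \<rho>. p x \<rho> (\<rho> v))"
    and "\<And>x \<rho> i j. p x (\<rho>(v := j)) i = p x \<rho> i"
  shows "ptime_pred (\<lambda>x \<rho>. \<forall>i<b x \<rho>. p x \<rho> i)"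
  using ptime_prod[of b v "\<lambda>x \<rho> i. of_bool (p x \<rho> i)"] assms by (simp add: prod_of_bool)

text \<open>Selection by arithmetic: both branches are evaluated and weighted by 0 or 1. No
  branching program is required, since both branches are affordable.\<close>

lemma ptime_if:
  assumes "ptime_pred p" "ptime f" "ptime g"
  shows "ptime (\<lambda>x \<rho>. if p x \<rho> then f x \<rho> else g x \<rho>)"
proof -
  have "ptime (\<lambda>x \<rho>. of_bool (p x \<rho>) * f x \<rho> + of_bool (\<not> p x \<rho>) * g x \<rho>)"
    by (intro ptime_add ptime_mult ptime_pred_not assms)
  then show ?thesis by (rule back_subst[of ptime]) (auto simp: fun_eq_iff)
qed

lemma bounded_valueI: "pbound g \<Longrightarrow> (\<And>x \<rho>. b x \<rho> \<le> g (length x)) \<Longrightarrow> bounded_value b"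
  unfolding bounded_value_def by blast

lemma bounded_value_add:
  assumes "bounded_value f" "bounded_value g"
  shows "bounded_value (\<lambda>x \<rho>. f x \<rho> + g x \<rho>)"
proof -
  obtain p q where "pbound p" "\<And>x \<rho>. f x \<rho> \<le> p (length x)" "pbound q" "\<And>x \<rho>. g x \<rho> \<le> q (length x)"
    using assms unfolding bounded_value_def by blast
  then show ?thesis by (intro bounded_valueI[of "\<lambda>n. p n + q n"] pbound_add add_mono)
qed

lemma bounded_value_mult:
  assumes "bounded_value f" "bounded_value g"
  shows "bounded_value (\<lambda>x \<rho>. f x \<rho> * g x \<rho>)"
proof -
  obtain p q where "pbound p" "\<And>x \<rho>. f x \<rho> \<le> p (length x)" "pbound q" "\<And>x \<rho>. g x \<rho> \<le> q (length x)"
    using assms unfolding bounded_value_def by blast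
  then show ?thesis by (intro bounded_valueI[of "\<lambda>n. p n * q n"] pbound_mult mult_le_mono)
qed

lemma bounded_value_const: "bounded_value (\<lambda>x \<rho>. k)"
  by (rule bounded_valueI[of "\<lambda>n. k"]) (auto simp: pbound_const)

lemma bounded_value_power: "bounded_value f \<Longrightarrow> bounded_value (\<lambda>x \<rho>. f x \<rho> ^ k)"
  by (induction k) (simp_all add: bounded_value_const bounded_value_mult)

lemma bounded_value_finite_sum:
  assumes "\<And>a. a \<in> A \<Longrightarrow> bounded_value (f a)"
  shows "bounded_value (\<lambda>x \<rho>. \<Sum>a\<in>A. f a x \<rho>)"
proof (cases "finite A")
  case True
  from this assms show ?thesis
    by (induction A) (auto simp: bounded_value_const intro!: bounded_value_add)
qed (simp add: bounded_value_const)

lemma ptime_program: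
  assumes "ptime f" "\<And>x \<rho>. f x \<rho> = F x"
  obtains P k where "\<And>x. outputs_within P x (F x) ((length x + 2) ^ k)"
proof -
  obtain m where m: "ptime_upto m f" using assms unfolding ptime_def by blast
  then obtain P where P: "\<And>G. pbound G \<Longrightarrow> \<exists>g. pbound g \<and> computes m m P f G g"
    unfolding ptime_upto_def by blast
  \<comment> \<open>Initially register 0 holds the input length and all other registers 0, so the
    identity bounds every variable.\<close>
  from P[OF pbound_id] obtain g where g: "pbound g" "computes m m P f (\<lambda>n. n) g" by blast
  define g' where "g' n = g n + (bit_length 0 + bit_length m + g n)" for n
  have "pbound g'" unfolding g'_def by (intro pbound_intros g)
  then obtain k where k: "\<And>n. g' n \<le> (n + 2) ^ k" unfolding pbound_def by blast
  have "runs (Seq P (Assign 0 (Reg m))) (initial_state x) (g' (length x)) (\<lambda>s. fst s 0 = F x)" for x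
    unfolding g'_def
  proof (rule runs_Seq)
    let ?s = "initial_state x"
    have s: "snd ?s = input_memory x" "fst ?s 0 = length x" "\<And>v. v < m \<Longrightarrow> fst ?s v \<le> length x"
      by (auto simp: initial_state_def)
    show "runs P ?s (g (length x)) (\<lambda>s'. snd s' = snd ?s \<and> (\<forall>v<m. fst s' v = fst ?s v) \<and>
       fst s' m = f x (fst ?s))" by (rule computesD(2)[OF g(2) s])
    fix s' assume "snd s' = snd ?s \<and> (\<forall>v<m. fst s' v = fst ?s v) \<and> fst s' m = f x (fst ?s)"
    then show "runs (Assign 0 (Reg m)) s' (bit_length 0 + bit_length m + g (length x)) (\<lambda>s. fst s 0 = F x)"
      using computesD(1)[OF g(2) s] assms(2) by (intro runs_Assign) auto
  qed
  then have "outputs_within (Seq P (Assign 0 (Reg m))) x (F x) ((length x + 2) ^ k)" for x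
    unfolding outputs_within_def runs_def using le_trans[OF _ k[of "length x"]] by blast
  then show thesis by (rule that)
qed

subsection \<open>Counting edge-injective homomorphisms\<close>

lemma edge_inj_homs_iff:
  assumes "simple_graph H"
  shows "\<phi> \<in> edge_inj_homs H G \<longleftrightarrow> \<phi> \<in> verts H \<rightarrow>\<^sub>E verts G \<and> (\<forall>e\<in>edges H. \<phi> ` e \<in> edges G) \<and>
    inj_on ((`) \<phi>) (edges H)"
proof -
  have "(\<forall>u v. {u, v} \<in> edges H \<longrightarrow> {\<phi> u, \<phi> v} \<in> edges G) \<longleftrightarrow> (\<forall>e\<in>edges H. \<phi> ` e \<in> edges G)"
  proof (intro iffI ballI allI impI)
    fix e assume *: "\<forall>u v. {u, v} \<in> edges H \<longrightarrow> {\<phi> u, \<phi> v} \<in> edges G" "e \<in> edges H"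
    then have "card e = 2" using assms unfolding simple_graph_def by blast
    then obtain u v where "e = {u, v}" by (auto simp: card_2_iff)
    moreover have "{\<phi> u, \<phi> v} \<in> edges G" using * \<open>e = {u, v}\<close> by blast
    ultimately show "\<phi> ` e \<in> edges G"
      unfolding \<open>e = {u, v}\<close> by (simp only: image_insert image_empty)
  next
    fix u v assume "\<forall>e\<in>edges H. \<phi> ` e \<in> edges G" "{u, v} \<in> edges H"
    then have "\<phi> ` {u, v} \<in> edges G" by blast
    then show "{\<phi> u, \<phi> v} \<in> edges G" by (simp only: image_insert image_empty)
  qed
  then show ?thesis unfolding edge_inj_homs_def homs_def by auto
qed

section \<open>Finiteness and invariance under isomorphism\<close>

lemma finite_edges: "simple_graph G \<Longrightarrow> finite (edges G)"
  unfolding simple_graph_def by (rule finite_subset[of _ "Pow (verts G)"]) auto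

lemma finite_edge_inj_homs:
  assumes "finite (verts H)" "finite (verts G)"
  shows "finite (edge_inj_homs H G)"
  unfolding edge_inj_homs_def homs_def
  by (rule finite_subset[of _ "verts H \<rightarrow>\<^sub>E verts G"]) (auto intro: finite_PiE assms)

text \<open>Composing with \<open>p\<close> on one side and the inverse of \<open>q\<close> on the
  other is injective on homomorphisms. An inequality suffices: the inverse isomorphisms give the
  opposite one.\<close>

lemma card_edge_inj_homs_le_iso:
  assumes H: "simple_graph (V, E)" "simple_graph (V', E')" "bij_betw p V' V" "E = (`) p ` E'"
    and G: "simple_graph (X, F)" "simple_graph (X', F')" "bij_betw q X' X" "F = (`) q ` F'"
  shows "card (edge_inj_homs (V, E) (X, F)) \<le> card (edge_inj_homs (V', E') (X', F'))"
proof (rule card_inj_on_le)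
  define r where "r = inv_into X' q"
  define T where "T \<phi> = restrict (r \<circ> \<phi> \<circ> p) V'" for \<phi> :: "'a \<Rightarrow> 'c"
  have qX: "q ` X' = X" "inj_on q X'" and pV: "p ` V' = V" "inj_on p V'"
    using G(3) H(3) by (auto simp: bij_betw_def)
  have r: "r (q x) = x" if "x \<in> X'" for x
    using that G(3) unfolding r_def by (simp add: bij_betw_inv_into_left)
  have r': "q (r x) = x" "r x \<in> X'" if "x \<in> X" for x
    using that qX unfolding r_def by (simp_all add: f_inv_into_f inv_into_into)
  have injr: "inj_on r X" using r' by (metis inj_onI)
  show "inj_on T (edge_inj_homs (V, E) (X, F))"
  proof (rule inj_onI)
    fix \<phi> \<psi> assume *: "\<phi> \<in> edge_inj_homs (V, E) (X, F)" "\<psi> \<in> edge_inj_homs (V, E) (X, F)" "T \<phi> = T \<psi>"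
    then have m: "\<phi> \<in> V \<rightarrow>\<^sub>E X" "\<psi> \<in> V \<rightarrow>\<^sub>E X" unfolding edge_inj_homs_def homs_def by auto
    show "\<phi> = \<psi>"
    proof (rule PiE_ext[OF m])
      fix v assume "v \<in> V"
      then obtain w where w: "w \<in> V'" "v = p w" using pV by auto
      have "r (\<phi> v) = r (\<psi> v)" using fun_cong[OF *(3), of w] w unfolding T_def by simp
      then show "\<phi> v = \<psi> v" using injr m \<open>v \<in> V\<close> by (meson PiE_mem inj_onD)
    qed
  qed
  show "T ` edge_inj_homs (V, E) (X, F) \<subseteq> edge_inj_homs (V', E') (X', F')"
  proof (rule image_subsetI)
    fix \<phi> assume "\<phi> \<in> edge_inj_homs (V, E) (X, F)"
    then have \<phi>: "\<phi> \<in> V \<rightarrow>\<^sub>E X" "\<And>e. e \<in> E \<Longrightarrow> \<phi> ` e \<in> F" "inj_on ((`) \<phi>) E"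
      by (simp_all add: edge_inj_homs_iff[OF H(1)])
    have sub: "e \<subseteq> V'" if "e \<in> E'" for e using that H(2) unfolding simple_graph_def by auto
    have F': "f \<subseteq> X'" if "f \<in> F'" for f using that G(2) unfolding simple_graph_def by auto
    have T: "T \<phi> ` e = r ` \<phi> ` p ` e" if "e \<in> E'" for e
      using sub[OF that] unfolding T_def by (auto simp: image_def subset_iff)
    have E: "\<phi> ` p ` e \<in> F" if "e \<in> E'" for e using \<phi>(2) H(4) that by blast
    have rF: "r ` f \<in> F' \<and> q ` r ` f = f" if f: "f \<in> F" for f
    proof -
      obtain f' where f': "f' \<in> F'" "f = q ` f'" using f G(4) by auto
      have "r ` q ` f' = f'" using F'[OF f'(1)] r by (force simp: image_image)
      then show ?thesis using f' by simp
    qed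
    have "inj_on ((`) (T \<phi>)) E'"
    proof (rule inj_onI)
      fix e e' assume e: "e \<in> E'" "e' \<in> E'" "T \<phi> ` e = T \<phi> ` e'"
      then have "\<phi> ` p ` e = \<phi> ` p ` e'" using T E rF by metis
      then have "p ` e = p ` e'" using \<phi>(3) e H(4) by (meson image_eqI inj_onD)
      then show "e = e'" using sub e pV(2) by (meson inj_on_image_eq_iff)
    qed
    moreover have "T \<phi> \<in> V' \<rightarrow>\<^sub>E X'"
      using \<phi>(1) pV r' unfolding T_def by (auto simp: PiE_iff)
    ultimately show "T \<phi> \<in> edge_inj_homs (V', E') (X', F')"
      unfolding edge_inj_homs_iff[OF H(2)] using T E rF by simp
  qed
  show "finite (edge_inj_homs (V', E') (X', F'))"
    using H(2) G(2) by (intro finite_edge_inj_homs) (auto simp: simple_graph_def)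
qed

lemma image_inv_into_edges:
  assumes "bij_betw p V' V" "E = (`) p ` E'" "simple_graph (V', E')"
  shows "E' = (`) (inv_into V' p) ` E"
proof -
  have "inv_into V' p ` p ` e = e" if "e \<in> E'" for e
    using assms that by (intro inv_into_image_cancel) (auto simp: bij_betw_def simple_graph_def)
  then show ?thesis using assms(2) by (auto simp: image_iff)
qed

lemma card_edge_inj_homs_iso:
  assumes H: "simple_graph (V, E)" "simple_graph (V', E')" "bij_betw p V' V" "E = (`) p ` E'"
    and G: "simple_graph (X, F)" "simple_graph (X', F')" "bij_betw q X' X" "F = (`) q ` F'"
  shows "card (edge_inj_homs (V, E) (X, F)) = card (edge_inj_homs (V', E') (X', F'))"
  using card_edge_inj_homs_le_iso[OF assms]
    card_edge_inj_homs_le_iso[OF H(2,1) bij_betw_inv_into[OF H(3)] image_inv_into_edges[OF H(3,4,2)]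
      G(2,1) bij_betw_inv_into[OF G(3)] image_inv_into_edges[OF G(3,4,2)]]
  by (rule antisym)

section \<open>Factors contributed by isolated vertices and isolated edges\<close>

lemma card_edge_inj_homs_add_vertex:
  assumes "simple_graph (V, E)" "w \<notin> V"
  shows "card (edge_inj_homs (insert w V, E) G) = card (edge_inj_homs (V, E) G) * card (verts G)"
proof -
  have simple: "simple_graph (insert w V, E)" using assms unfolding simple_graph_def by auto
  \<comment> \<open>All conditions on edges, isolated as one predicate that depends only on the
    values on \<open>V\<close>; the image of \<open>w\<close> is therefore free.\<close>
  define good where "good \<phi> \<longleftrightarrow> (\<forall>e\<in>E. \<phi> ` e \<in> edges G) \<and> inj_on ((`) \<phi>) E" for \<phi>
  have good_cong: "good \<phi> = good \<psi>" if "\<And>v. v \<in> V \<Longrightarrow> \<phi> v = \<psi> v" for \<phi> \<psi>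
  proof -
    have "\<phi> ` e = \<psi> ` e" if "e \<in> E" for e
      using \<open>\<And>v. v \<in> V \<Longrightarrow> \<phi> v = \<psi> v\<close> that assms unfolding simple_graph_def
      by (intro image_cong) auto
    then show ?thesis unfolding good_def by (simp cong: inj_on_cong)
  qed
  have good: "good (\<phi>(w := x)) = good \<phi>" "good (restrict \<phi> V) = good \<phi>" for \<phi> x
    using assms(2) by (auto intro!: good_cong)
  have mem: "\<phi> \<in> edge_inj_homs (V, E) G \<longleftrightarrow> \<phi> \<in> V \<rightarrow>\<^sub>E verts G \<and> good \<phi>"
    "\<phi> \<in> edge_inj_homs (insert w V, E) G \<longleftrightarrow> \<phi> \<in> insert w V \<rightarrow>\<^sub>E verts G \<and> good \<phi>" for \<phi>
    unfolding edge_inj_homs_iff[OF assms(1)] edge_inj_homs_iff[OF simple] good_def by auto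
  have "bij_betw (\<lambda>(\<phi>, x). \<phi>(w := x)) (edge_inj_homs (V, E) G \<times> verts G) (edge_inj_homs (insert w V, E) G)"
    by (rule bij_betwI[of _ _ _ "\<lambda>\<phi>. (restrict \<phi> V, \<phi> w)"])
      (use assms(2) in \<open>auto simp: mem good[unfolded restrict_def] fun_eq_iff PiE_iff extensional_def restrict_def\<close>)
  from bij_betw_same_card[OF this] show ?thesis by (simp add: card_cartesian_product)
qed

lemma card_edge_inj_homs_add_vertices:
  assumes "simple_graph (V, E)" "finite I" "I \<inter> V = {}"
  shows "card (edge_inj_homs (V \<union> I, E) G) = card (edge_inj_homs (V, E) G) * card (verts G) ^ card I"
  using assms(2,3)
proof (induction I)
  case (insert w I)
  have "simple_graph (V \<union> I, E)" using assms(1) insert unfolding simple_graph_def by auto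
  moreover have "w \<notin> V \<union> I" using insert by auto
  ultimately have "card (edge_inj_homs (insert w (V \<union> I), E) G) = card (edge_inj_homs (V \<union> I, E) G) * card (verts G)"
    by (rule card_edge_inj_homs_add_vertex)
  with insert show ?case by simp
qed simp

text \<open>An isolated edge of \<open>H\<close> can be laid onto an edge of \<open>G\<close> in two
  directions; this is the origin of the factor 2 per isolated edge.\<close>

lemma card_ordered_pairs:
  assumes "finite F" "\<forall>e\<in>F. card e = 2"
  shows "card {(x, y). {x, y} \<in> F} = 2 * card F" "finite {(x, y). {x, y} \<in> F}"
proof -
  have "card {(x, y). {x, y} \<in> F} = 2 * card F \<and> finite {(x, y). {x, y} \<in> F}"
    using assms
  proof (induction F)
    case (insert e F)
    obtain a b where e: "e = {a, b}" "a \<noteq> b" using insert.prems by (auto simp: card_2_iff)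
    have "{(x, y). {x, y} \<in> insert e F} = {(a, b), (b, a)} \<union> {(x, y). {x, y} \<in> F}"
      using e by (auto simp: doubleton_eq_iff)
    moreover have "{(a, b), (b, a)} \<inter> {(x, y). {x, y} \<in> F} = {}"
      using e insert.hyps by (auto simp: insert_commute)
    ultimately show ?case using insert e by (simp add: card_Un_disjoint)
  qed simp
  then show "card {(x, y). {x, y} \<in> F} = 2 * card F" "finite {(x, y). {x, y} \<in> F}" by auto
qed

lemma card_edge_inj_homs_add_edge:
  assumes "simple_graph (V, E)" "simple_graph G" "u \<notin> V" "v \<notin> V" "u \<noteq> v"
  shows "card (edge_inj_homs (V \<union> {u, v}, insert {u, v} E) G) =
    card (edge_inj_homs (V, E) G) * (2 * (card (edges G) - card E))"
proof -
  define H where "H = (V \<union> {u, v}, insert {u, v} E)"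
  have simple: "simple_graph H" using assms unfolding simple_graph_def H_def by auto
  have VE: "verts H = V \<union> {u, v}" "edges H = insert {u, v} E" unfolding H_def by simp_all
  have sub: "u \<notin> e" "v \<notin> e" "e \<subseteq> V" if "e \<in> E" for e using that assms unfolding simple_graph_def by auto
  have uvE: "{u, v} \<notin> E" using sub by blast
  define good where "good \<phi> \<longleftrightarrow> (\<forall>e\<in>E. \<phi> ` e \<in> edges G) \<and> inj_on ((`) \<phi>) E" for \<phi>
  define used where "used \<phi> = (`) \<phi> ` E" for \<phi> :: "'a \<Rightarrow> 'b"
  have cong: "good \<phi> = good \<psi>" "used \<phi> = used \<psi>" if "\<And>v. v \<in> V \<Longrightarrow> \<phi> v = \<psi> v" for \<phi> \<psi>
  proof -
    have "\<phi> ` e = \<psi> ` e" if "e \<in> E" for e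
      using \<open>\<And>v. v \<in> V \<Longrightarrow> \<phi> v = \<psi> v\<close> sub(3)[OF that] by (intro image_cong) auto
    then show "good \<phi> = good \<psi>" "used \<phi> = used \<psi>"
      unfolding good_def used_def by (simp_all cong: inj_on_cong image_cong)
  qed
  have good: "good (\<phi>(u := x, v := y)) = good \<phi>" "used (\<phi>(u := x, v := y)) = used \<phi>"
      "good (restrict \<phi> V) = good \<phi>" "used (restrict \<phi> V) = used \<phi>" for \<phi> x y
    using assms(3,4) by (auto intro!: cong)
  have XG: "x \<in> verts G" "y \<in> verts G" if "{x, y} \<in> edges G" for x y
    using that assms(2) unfolding simple_graph_def by auto
  have mem: "\<phi> \<in> edge_inj_homs (V, E) G \<longleftrightarrow> \<phi> \<in> V \<rightarrow>\<^sub>E verts G \<and> good \<phi>"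
    "\<phi> \<in> edge_inj_homs H G \<longleftrightarrow>
      \<phi> \<in> V \<union> {u, v} \<rightarrow>\<^sub>E verts G \<and> good \<phi> \<and> {\<phi> u, \<phi> v} \<in> edges G \<and> {\<phi> u, \<phi> v} \<notin> used \<phi>" for \<phi>
    unfolding edge_inj_homs_iff[OF assms(1)] edge_inj_homs_iff[OF simple] good_def used_def VE
    using uvE by auto
  \<comment> \<open>Which edges of \<open>G\<close> remain free depends on \<phi>, but their number
    does not: \<phi> occupies exactly \<open>card E\<close> of them. Hence all fibres of this
    dependent product have equal size.\<close>
  let ?D = "SIGMA \<phi>:edge_inj_homs (V, E) G. {(x, y). {x, y} \<in> edges G - used \<phi>}"
  have "bij_betw (\<lambda>(\<phi>, x, y). \<phi>(u := x, v := y)) ?D (edge_inj_homs H G)"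
    by (rule bij_betwI[of _ _ _ "\<lambda>\<phi>. (restrict \<phi> V, \<phi> u, \<phi> v)"])
      (use assms(3-5) in \<open>auto simp: mem good[unfolded restrict_def] XG fun_eq_iff PiE_iff extensional_def restrict_def\<close>)
  then have "card (edge_inj_homs H G) = card ?D" by (metis bij_betw_same_card)
  also have "\<dots> = (\<Sum>\<phi>\<in>edge_inj_homs (V, E) G. card {(x, y). {x, y} \<in> edges G - used \<phi>})"
    using assms finite_edges[OF assms(2)]
    by (intro card_SigmaI ballI finite_edge_inj_homs card_ordered_pairs) (auto simp: simple_graph_def)
  also have "\<dots> = (\<Sum>\<phi>\<in>edge_inj_homs (V, E) G. 2 * (card (edges G) - card E))"
  proof (rule sum.cong[OF refl])
    fix \<phi> assume "\<phi> \<in> edge_inj_homs (V, E) G"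
    then have \<phi>: "used \<phi> \<subseteq> edges G" "card (used \<phi>) = card E"
      unfolding mem good_def used_def by (auto intro: card_image)
    have "card {(x, y). {x, y} \<in> edges G - used \<phi>} = 2 * card (edges G - used \<phi>)"
      using assms(2) finite_edges[OF assms(2)] by (intro card_ordered_pairs) (auto simp: simple_graph_def)
    also have "card (edges G - used \<phi>) = card (edges G) - card E"
      using \<phi> finite_edges[OF assms(2)] by (metis card_Diff_subset finite_subset)
    finally show "card {(x, y). {x, y} \<in> edges G - used \<phi>} = 2 * (card (edges G) - card E)" .
  qed
  finally show ?thesis by (simp add: H_def)
qed

text \<open>In the factor with index \<open>i\<close>, that many edges of the matching have already
  been placed. Truncated subtraction makes the product vanish when \<open>G\<close> runs out of
  edges.\<close>

lemma card_edge_inj_homs_add_matching: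
  assumes "simple_graph (V, E)" "simple_graph G" "finite K" "\<forall>e\<in>K. card e = 2 \<and> e \<inter> V = {}" "disjoint K"
  shows "card (edge_inj_homs (V \<union> \<Union>K, E \<union> K) G) =
    card (edge_inj_homs (V, E) G) * (2 ^ card K * (\<Prod>i<card K. card (edges G) - card E - i))"
  using assms(3-5)
proof (induction K)
  case (insert e K)
  obtain u v where e: "e = {u, v}" "u \<noteq> v" using insert.prems by (auto simp: card_2_iff)
  have dis: "e \<inter> e' = {}" if "e' \<in> K" for e'
    using insert.prems(2) insert.hyps(2) that unfolding disjoint_def by (metis insertCI)
  have K: "\<forall>e\<in>K. card e = 2 \<and> e \<inter> V = {}" "disjoint K"
    using insert.prems by (auto simp: disjoint_def)
  have "e \<inter> V = {}" using insert.prems by simp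
  with dis e have uv: "u \<notin> V \<union> \<Union>K" "v \<notin> V \<union> \<Union>K" by auto
  have simple: "simple_graph (V \<union> \<Union>K, E \<union> K)"
  proof -
    have "finite (\<Union>K)"
      using insert.hyps(1) K(1) by (metis card.infinite finite_Union zero_neq_numeral)
    then show ?thesis using assms(1) K(1) unfolding simple_graph_def by auto
  qed
  have "E \<inter> K = {}"
  proof -
    have "e \<subseteq> V" if "e \<in> E" for e using assms(1) that unfolding simple_graph_def by auto
    moreover have "e \<inter> V = {}" "e \<noteq> {}" if "e \<in> K" for e using K that by auto
    ultimately show ?thesis by (metis disjoint_iff inf.absorb_iff1)
  qed
  then have "card (E \<union> K) = card E + card K"
    using finite_edges[OF assms(1)] insert.hyps by (simp add: card_Un_disjoint)
  moreover have "card (edge_inj_homs ((V \<union> \<Union>K) \<union> {u, v}, insert {u, v} (E \<union> K)) G) =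
    card (edge_inj_homs (V \<union> \<Union>K, E \<union> K) G) * (2 * (card (edges G) - card (E \<union> K)))"
    by (rule card_edge_inj_homs_add_edge[OF simple assms(2) uv e(2)])
  moreover have "(V \<union> \<Union>K) \<union> {u, v} = V \<union> \<Union>(insert e K)" using e by auto
  ultimately show ?case
    using insert.IH[OF K] insert.hyps e(1) by (simp add: mult_ac)
qed simp

subsection \<open>Coefficient extraction\<close>

lemma sum_digits_less:
  fixes a :: "nat \<Rightarrow> nat"
  assumes "finite I" "\<forall>i\<in>I. i < n \<and> a i < M" "M > 0"
  shows "(\<Sum>i\<in>I. a i * M ^ i) < M ^ n"
  using assms(1,2)
proof (induction I arbitrary: n rule: finite_linorder_max_induct)
  case empty
  then show ?case using assms(3) by simp
next
  case (insert m I)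
  have "(\<Sum>i\<in>I. a i * M ^ i) < M ^ m" using insert by auto
  moreover have "m \<notin> I" using insert by auto
  moreover have "Suc (a m) * M ^ m \<le> M * M ^ m" using insert by (intro mult_le_mono1) auto
  moreover have "M ^ Suc m \<le> M ^ n" using insert assms(3) by (intro power_increasing) auto
  ultimately show ?case using insert.hyps(1) by simp
qed

text \<open>Induction on the largest index \<open>m\<close>: by \<open>sum_digits_less\<close> the
  rest contributes less than \<open>M ^ m\<close>, so division by \<open>M ^ m\<close> isolates the
  top digit.\<close>

lemma digits_unique:
  fixes a b :: "nat \<Rightarrow> nat"
  assumes "finite I" "\<forall>i\<in>I. a i < M \<and> b i < M"
    "(\<Sum>i\<in>I. a i * M ^ i) = (\<Sum>i\<in>I. b i * M ^ i)"
  shows "\<forall>i\<in>I. a i = b i"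
  using assms
proof (induction I rule: finite_linorder_max_induct)
  case (insert m I)
  have M: "M > 0" using insert.prems by auto
  have m: "m \<notin> I" using insert by auto
  have l: "(\<Sum>i\<in>I. a i * M ^ i) < M ^ m" "(\<Sum>i\<in>I. b i * M ^ i) < M ^ m"
    using insert M by (auto intro!: sum_digits_less)
  have eq: "a m * M ^ m + (\<Sum>i\<in>I. a i * M ^ i) = b m * M ^ m + (\<Sum>i\<in>I. b i * M ^ i)"
    using insert m by simp
  from arg_cong[OF this, of "\<lambda>t. t div M ^ m"] have "a m = b m" using l M by simp
  with eq insert show ?case by simp
qed simp

lemma weighted_digits_unique:
  fixes a b :: "'t \<Rightarrow> nat"
  assumes "finite \<Theta>" "inj_on idx \<Theta>" "\<And>\<theta>. \<theta> \<in> \<Theta> \<Longrightarrow> a \<theta> < M" "\<And>\<theta>. \<theta> \<in> \<Theta> \<Longrightarrow> b \<theta> < M"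
    "(\<Sum>\<theta>\<in>\<Theta>. a \<theta> * M ^ idx \<theta>) = (\<Sum>\<theta>\<in>\<Theta>. b \<theta> * M ^ idx \<theta>)" "\<theta> \<in> \<Theta>"
  shows "a \<theta> = b \<theta>"
proof -
  define r where "r = inv_into \<Theta> idx"
  have r: "r (idx \<theta>) = \<theta>" if "\<theta> \<in> \<Theta>" for \<theta> using assms(2) that by (simp add: r_def)
  have re: "(\<Sum>i\<in>idx ` \<Theta>. g (r i) * M ^ i) = (\<Sum>\<theta>\<in>\<Theta>. g \<theta> * M ^ idx \<theta>)" for g
    by (subst sum.reindex[OF assms(2)]) (simp add: r)
  have "\<forall>i\<in>idx ` \<Theta>. a (r i) = b (r i)"
    by (rule digits_unique[of _ _ M]) (use assms in \<open>auto simp: re[of a] re[of b] r\<close>)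
  then show ?thesis using r assms(6) by auto
qed

text \<open>Elements with exponent below \<open>k\<close> sum to less than \<open>B ^ k\<close> and
  vanish under \<open>div\<close>; those above \<open>k\<close> contribute multiples of
  \<open>B ^ Suc k\<close> and vanish under \<open>mod\<close>. The size of \<open>A\<close> being
  below \<open>B\<close> excludes carries.\<close>

lemma coefficient_extraction:
  fixes B :: nat
  assumes "finite A" "card A < B"
  shows "((\<Sum>a\<in>A. B ^ e a) div B ^ k) mod B = card {a \<in> A. e a = k}"
proof -
  let ?L = "{a \<in> A. e a < k}" and ?E = "{a \<in> A. e a = k}" and ?G = "{a \<in> A. e a > k}"
  have B: "B > 0" using assms by simp
  have "A = ?L \<union> (?E \<union> ?G)" by auto
  then have "(\<Sum>a\<in>A. B ^ e a) = (\<Sum>a\<in>?L \<union> (?E \<union> ?G). B ^ e a)" by simp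
  also have "\<dots> = (\<Sum>a\<in>?L. B ^ e a) + ((\<Sum>a\<in>?E. B ^ e a) + (\<Sum>a\<in>?G. B ^ e a))"
    using assms(1) by (subst sum.union_disjoint, auto)+
  also have "(\<Sum>a\<in>?E. B ^ e a) = card ?E * B ^ k" by simp
  also have "(\<Sum>a\<in>?G. B ^ e a) = (\<Sum>a\<in>?G. B ^ (e a - Suc k)) * B * B ^ k"
    unfolding sum_distrib_right
    by (rule sum.cong) (auto simp flip: power_Suc power_add simp: mult.assoc)
  finally have N: "(\<Sum>a\<in>A. B ^ e a) = (\<Sum>a\<in>?L. B ^ e a) +
      (card ?E + (\<Sum>a\<in>?G. B ^ (e a - Suc k)) * B) * B ^ k"
    by (simp add: algebra_simps)
  have "(\<Sum>a\<in>?L. B ^ e a) < B ^ k"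
  \<comment> \<open>For \<open>k = 0\<close> the sum is empty. Otherwise all exponents are at most
    \<open>k - 1\<close>, and there are fewer than \<open>B\<close> terms.\<close>
  proof (cases k)
    case (Suc j)
    have "(\<Sum>a\<in>?L. B ^ e a) \<le> (\<Sum>a\<in>?L. B ^ j)"
      using B Suc by (intro sum_mono power_increasing) auto
    also have "\<dots> = card ?L * B ^ j" by simp
    also have "card ?L \<le> card A" using assms(1) by (intro card_mono) auto
    then have "card ?L * B ^ j < B * B ^ j" using assms(2) B by (intro mult_strict_right_mono) auto
    finally show ?thesis using Suc by simp
  qed simp
  then have "(\<Sum>a\<in>A. B ^ e a) div B ^ k = card ?E + (\<Sum>a\<in>?G. B ^ (e a - Suc k)) * B"
    unfolding N using B by simp
  moreover have "card ?E \<le> card A" using assms(1) by (intro card_mono) auto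
  ultimately show ?thesis using assms(2) by simp
qed

text \<open>The weights multiply to \<open>B ^ e Q\<close>, where the base-\<open>M\<close> digits
  of \<open>e Q\<close> are the fibre sizes of \<open>Q\<close>. As fibre sizes and prescribed
  values stay below \<open>M\<close>, prescribing all fibres is the same as prescribing one
  exponent. \<open>B\<close> exceeds the number of all \<open>Q\<close>, so
  \<open>coefficient_extraction\<close> applies.\<close>

lemma card_fibres_extraction:
  fixes R :: "('b \<times> 't) set \<Rightarrow> bool" and k :: "'t \<Rightarrow> nat"
  assumes "finite X" "finite \<Theta>" "inj_on idx \<Theta>" "card X < M" "\<And>\<theta>. \<theta> \<in> \<Theta> \<Longrightarrow> k \<theta> < M"
    and B: "B = 2 ^ (card X * card \<Theta> + 1)"
  shows "card {Q \<in> Pow (X \<times> \<Theta>). R Q \<and> (\<forall>\<theta>\<in>\<Theta>. card {x. (x, \<theta>) \<in> Q} = k \<theta>)} =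
    (\<Sum>Q\<in>Pow (X \<times> \<Theta>). of_bool (R Q) * (\<Prod>(x, \<theta>)\<in>Q. B ^ (M ^ idx \<theta>))) div
      B ^ (\<Sum>\<theta>\<in>\<Theta>. k \<theta> * M ^ idx \<theta>) mod B"
proof -
  let ?P = "Pow (X \<times> \<Theta>)" and ?fib = "\<lambda>Q \<theta>. {x. (x, \<theta>) \<in> Q}"
  define e where "e Q = (\<Sum>(x, \<theta>)\<in>Q. M ^ idx \<theta>)" for Q :: "('b \<times> 't) set"
  have finP: "finite ?P" using assms by simp
  have e: "e Q = (\<Sum>\<theta>\<in>\<Theta>. card (?fib Q \<theta>) * M ^ idx \<theta>)" if "Q \<in> ?P" for Q
  proof -
    have finQ: "finite Q" using that assms by (auto intro: finite_subset)
    have "e Q = (\<Sum>\<theta>\<in>\<Theta>. \<Sum>p\<in>{p \<in> Q. snd p = \<theta>}. (case p of (x, \<theta>) \<Rightarrow> M ^ idx \<theta>))"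
      unfolding e_def using that by (intro sum.group[symmetric] finQ assms) auto
    also have "\<dots> = (\<Sum>\<theta>\<in>\<Theta>. card (?fib Q \<theta>) * M ^ idx \<theta>)"
    proof (rule sum.cong[OF refl])
      fix \<theta>
      have "{p \<in> Q. snd p = \<theta>} = (\<lambda>x. (x, \<theta>)) ` ?fib Q \<theta>" by auto
      moreover have "inj_on (\<lambda>x. (x, \<theta>)) (?fib Q \<theta>)" by (auto intro: inj_onI)
      ultimately show "(\<Sum>p\<in>{p \<in> Q. snd p = \<theta>}. (case p of (x, \<theta>) \<Rightarrow> M ^ idx \<theta>)) =
          card (?fib Q \<theta>) * M ^ idx \<theta>"
        by (simp add: sum.reindex)
    qed
    finally show ?thesis .
  qed
  have fib: "card (?fib Q \<theta>) < M" if "Q \<in> ?P" for Q \<theta>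
  proof -
    have "card (?fib Q \<theta>) \<le> card X" using that assms(1) by (intro card_mono) auto
    then show ?thesis using assms(4) by simp
  qed
  have "(\<forall>\<theta>\<in>\<Theta>. card (?fib Q \<theta>) = k \<theta>) \<longleftrightarrow> e Q = (\<Sum>\<theta>\<in>\<Theta>. k \<theta> * M ^ idx \<theta>)"
    if "Q \<in> ?P" for Q
    using weighted_digits_unique[OF assms(2,3), of "\<lambda>\<theta>. card (?fib Q \<theta>)" M k] fib[OF that] assms(5) e[OF that]
    by auto
  then have "{Q \<in> ?P. R Q \<and> (\<forall>\<theta>\<in>\<Theta>. card (?fib Q \<theta>) = k \<theta>)} =
      {Q \<in> {Q \<in> ?P. R Q}. e Q = (\<Sum>\<theta>\<in>\<Theta>. k \<theta> * M ^ idx \<theta>)}" by blast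
  also have "card \<dots> = (\<Sum>Q\<in>{Q \<in> ?P. R Q}. B ^ e Q) div B ^ (\<Sum>\<theta>\<in>\<Theta>. k \<theta> * M ^ idx \<theta>) mod B"
  proof (rule coefficient_extraction[symmetric])
    have "card {Q \<in> ?P. R Q} \<le> card ?P" using finP by (intro card_mono) auto
    also have "card ?P < B" unfolding B using assms by (simp add: card_Pow card_cartesian_product)
    finally show "card {Q \<in> ?P. R Q} < B" .
  qed (use finP in auto)
  also have "(\<Sum>Q\<in>{Q \<in> ?P. R Q}. B ^ e Q) = (\<Sum>Q\<in>?P. of_bool (R Q) * (\<Prod>(x, \<theta>)\<in>Q. B ^ (M ^ idx \<theta>)))"
    unfolding e_def using finP
    by (intro sum.mono_neutral_cong_left) (auto simp: power_sum split_def)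
  finally show ?thesis .
qed

subsection \<open>Maps with prescribed fibres over types\<close>

text \<open>Such a map is a family of bijections, one for each type, from the vertices of that type
  to the corresponding fibre of \<open>Q\<close>. In the induction the new vertex picks an element
  of its fibre, and the chosen pair is removed from \<open>Q\<close>.\<close>

lemma card_maps_with_graph:
  assumes "finite W" "finite \<Theta>" "\<tau> ` W \<subseteq> \<Theta>" "finite X" "Q \<subseteq> X \<times> \<Theta>"
    and "\<forall>\<theta>\<in>\<Theta>. card {x. (x, \<theta>) \<in> Q} = card {w \<in> W. \<tau> w = \<theta>}"
  shows "card {f \<in> W \<rightarrow>\<^sub>E X. inj_on (\<lambda>w. (f w, \<tau> w)) W \<and> (\<lambda>w. (f w, \<tau> w)) ` W = Q} =
    (\<Prod>\<theta>\<in>\<Theta>. fact (card {w \<in> W. \<tau> w = \<theta>}))"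
  using assms(1,3,5,6)
proof (induction W arbitrary: Q)
  case empty
  have "Q = {}"
  proof (rule ccontr)
    assume "Q \<noteq> {}"
    then obtain x \<theta> where q: "(x, \<theta>) \<in> Q" by auto
    then have "\<theta> \<in> \<Theta>" "finite {x. (x, \<theta>) \<in> Q}"
      using empty assms(4) by (auto intro: finite_subset[of _ X])
    then show False using empty q by auto
  qed
  then show ?case by simp
next
  case (insert w W)
  let ?A = "\<lambda>W Q. {f \<in> W \<rightarrow>\<^sub>E X. inj_on (\<lambda>w. (f w, \<tau> w)) W \<and> (\<lambda>w. (f w, \<tau> w)) ` W = Q}"
  let ?k = "\<lambda>\<theta>. card {w \<in> W. \<tau> w = \<theta>}"
  define \<theta>0 where "\<theta>0 = \<tau> w"
  let ?F = "{x. (x, \<theta>0) \<in> Q}"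
  have \<theta>0: "\<theta>0 \<in> \<Theta>" using insert.prems \<theta>0_def by auto
  have finF: "finite ?F" using insert.prems assms(4) by (auto intro: finite_subset[of _ X])
  have k: "card {v \<in> insert w W. \<tau> v = \<theta>} = ?k \<theta> + of_bool (\<theta> = \<theta>0)" for \<theta>
  proof (cases "\<theta> = \<theta>0")
    case True
    then have "{v \<in> insert w W. \<tau> v = \<theta>} = insert w {v \<in> W. \<tau> v = \<theta>}" by (auto simp: \<theta>0_def)
    then show ?thesis using insert.hyps True by simp
  next
    case False
    then have "{v \<in> insert w W. \<tau> v = \<theta>} = {v \<in> W. \<tau> v = \<theta>}" by (auto simp: \<theta>0_def)
    then show ?thesis using False by simp
  qed
  have upd: "(\<lambda>v. ((f(w := x)) v, \<tau> v)) ` W = (\<lambda>v. (f v, \<tau> v)) ` W"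
      "inj_on (\<lambda>v. ((f(w := x)) v, \<tau> v)) W = inj_on (\<lambda>v. (f v, \<tau> v)) W" for f :: "_ \<Rightarrow> _" and x
    using insert.hyps by (auto intro!: image_cong inj_on_cong)
  have WW: "W - {w} = W" using insert.hyps by simp
  have mem: "f \<in> ?A (insert w W) Q \<longleftrightarrow> f \<in> insert w W \<rightarrow>\<^sub>E X \<and> inj_on (\<lambda>v. (f v, \<tau> v)) W \<and>
      (f w, \<theta>0) \<in> Q \<and> (\<lambda>v. (f v, \<tau> v)) ` W = Q - {(f w, \<theta>0)}" for f
  proof -
    \<comment> \<open>Separates the pair contributed by the new vertex from the graph of the
      rest.\<close>
    have "p \<notin> A \<and> insert p A = Q \<longleftrightarrow> p \<in> Q \<and> A = Q - {p}" for p A by auto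
    from this[of "(f w, \<theta>0)" "(\<lambda>v. (f v, \<tau> v)) ` W"] show ?thesis
      unfolding mem_Collect_eq inj_on_insert image_insert \<theta>0_def WW
      by argo
  qed
  have "bij_betw (\<lambda>(x, f). f(w := x)) (SIGMA x:?F. ?A W (Q - {(x, \<theta>0)})) (?A (insert w W) Q)"
  \<comment> \<open>For an extensional map on \<open>insert w W\<close>, resetting \<open>w\<close>
    to \<open>undefined\<close> is restriction to \<open>W\<close>.\<close>
  proof (rule bij_betwI[of _ _ _ "\<lambda>f. (f w, f(w := undefined))"])
    show "(\<lambda>(x, f). f(w := x)) \<in> (SIGMA x:?F. ?A W (Q - {(x, \<theta>0)})) \<rightarrow> ?A (insert w W) Q"
    proof (rule Pi_I)
      fix z assume "z \<in> (SIGMA x:?F. ?A W (Q - {(x, \<theta>0)}))"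
      then obtain x f where z: "z = (x, f)" "(x, \<theta>0) \<in> Q" "f \<in> ?A W (Q - {(x, \<theta>0)})" by auto
      have "x \<in> X" using z insert.prems by auto
      then have "f(w := x) \<in> ?A (insert w W) Q"
        unfolding mem using z upd[of f x] by (auto simp: PiE_iff extensional_def)
      then show "(\<lambda>(x, f). f(w := x)) z \<in> ?A (insert w W) Q" using z by simp
    qed
    show "(\<lambda>f. (f w, f(w := undefined))) \<in> ?A (insert w W) Q \<rightarrow> (SIGMA x:?F. ?A W (Q - {(x, \<theta>0)}))"
    proof (rule Pi_I)
      fix f assume "f \<in> ?A (insert w W) Q"
      then show "(f w, f(w := undefined)) \<in> (SIGMA x:?F. ?A W (Q - {(x, \<theta>0)}))"
        unfolding mem using upd[of f undefined] insert.hyps by (auto simp: PiE_iff extensional_def)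
    qed
  next
    fix z assume "z \<in> (SIGMA x:?F. ?A W (Q - {(x, \<theta>0)}))"
    then show "(\<lambda>f. (f w, f(w := undefined))) ((\<lambda>(x, f). f(w := x)) z) = z"
      using insert.hyps by (auto simp: PiE_iff extensional_def fun_eq_iff)
  next
    fix f show "(\<lambda>(x, f). f(w := x)) (f w, f(w := undefined)) = f" by simp
  qed
  from bij_betw_same_card[OF this]
  have "card (?A (insert w W) Q) = card (SIGMA x:?F. ?A W (Q - {(x, \<theta>0)}))" by (rule sym)
  also have "\<dots> = (\<Sum>x\<in>?F. card (?A W (Q - {(x, \<theta>0)})))"
  proof (rule card_SigmaI[OF finF], rule ballI)
    show "finite (?A W (Q - {(x, \<theta>0)}))" for x
      by (rule finite_subset[of _ "W \<rightarrow>\<^sub>E X"]) (auto intro: finite_PiE insert.hyps assms(4))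
  qed
  also have "\<dots> = (\<Sum>x\<in>?F. \<Prod>\<theta>\<in>\<Theta>. fact (?k \<theta>))"
  proof (rule sum.cong[OF refl], rule insert.IH)
    fix x assume x: "x \<in> ?F"
    show "\<forall>\<theta>\<in>\<Theta>. card {y. (y, \<theta>) \<in> Q - {(x, \<theta>0)}} = ?k \<theta>"
    proof
      fix \<theta> assume \<theta>: "\<theta> \<in> \<Theta>"
      have "card {y. (y, \<theta>) \<in> Q} = ?k \<theta> + of_bool (\<theta> = \<theta>0)" using insert.prems(3) k \<theta> by simp
      moreover have "card {y. (y, \<theta>) \<in> Q - {(x, \<theta>0)}} = card {y. (y, \<theta>) \<in> Q} - of_bool (\<theta> = \<theta>0)"
      proof (cases "\<theta> = \<theta>0")
        case True
        have "{y. (y, \<theta>0) \<in> Q - {(x, \<theta>0)}} = ?F - {x}" by auto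
        then show ?thesis using True card_Diff_singleton[OF x] by simp
      next
        case False
        then have "{y. (y, \<theta>) \<in> Q - {(x, \<theta>0)}} = {y. (y, \<theta>) \<in> Q}" by auto
        then show ?thesis using False by simp
      qed
      ultimately show "card {y. (y, \<theta>) \<in> Q - {(x, \<theta>0)}} = ?k \<theta>" by simp
    qed
  qed (use insert.prems in auto)
  also have "\<dots> = (?k \<theta>0 + 1) * (\<Prod>\<theta>\<in>\<Theta>. fact (?k \<theta>))"
    using insert.prems(3) k[of \<theta>0] \<theta>0 by simp
  also have "\<dots> = (\<Prod>\<theta>\<in>\<Theta>. fact (?k \<theta> + of_bool (\<theta> = \<theta>0)))"
  proof -
    have "(\<Prod>\<theta>\<in>\<Theta>. fact (?k \<theta> + of_bool (\<theta> = \<theta>0))) =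
        fact (?k \<theta>0 + 1) * (\<Prod>\<theta>\<in>\<Theta> - {\<theta>0}. fact (?k \<theta> + of_bool (\<theta> = \<theta>0)))"
      using assms(2) \<theta>0 by (subst prod.remove[of _ \<theta>0]) auto
    also have "(\<Prod>\<theta>\<in>\<Theta> - {\<theta>0}. fact (?k \<theta> + of_bool (\<theta> = \<theta>0))) = (\<Prod>\<theta>\<in>\<Theta> - {\<theta>0}. fact (?k \<theta>) :: nat)"
      by (rule prod.cong) auto
    finally show ?thesis
      using assms(2) \<theta>0 by (subst prod.remove[of _ \<theta>0]) (auto simp: algebra_simps)
  qed
  finally show ?case unfolding k .
qed

text \<open>The condition \<open>R\<close> sees a map only through its graph. Grouping the maps by
  graph leaves classes of equal size, given by \<open>card_maps_with_graph\<close>.\<close>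

lemma card_maps_by_graph:
  assumes "finite W" "finite \<Theta>" "\<tau> ` W \<subseteq> \<Theta>" "finite X"
  shows "card {f \<in> W \<rightarrow>\<^sub>E X. inj_on (\<lambda>w. (f w, \<tau> w)) W \<and> R ((\<lambda>w. (f w, \<tau> w)) ` W)} =
    (\<Prod>\<theta>\<in>\<Theta>. fact (card {w \<in> W. \<tau> w = \<theta>})) *
    card {Q \<in> Pow (X \<times> \<Theta>). R Q \<and> (\<forall>\<theta>\<in>\<Theta>. card {x. (x, \<theta>) \<in> Q} = card {w \<in> W. \<tau> w = \<theta>})}"
    (is "card ?A = ?p * card ?Q")
proof -
  let ?g = "\<lambda>f w. (f w, \<tau> w)"
  have finA: "finite ?A"
    by (rule finite_subset[of _ "W \<rightarrow>\<^sub>E X"]) (auto intro: finite_PiE assms)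
  have finQ: "finite ?Q" using assms by simp
  have "?g f ` W \<in> ?Q" if f: "f \<in> ?A" for f
  proof -
    have "card {x. (x, \<theta>) \<in> ?g f ` W} = card {w \<in> W. \<tau> w = \<theta>}" for \<theta>
    proof -
      have "{x. (x, \<theta>) \<in> ?g f ` W} = f ` {w \<in> W. \<tau> w = \<theta>}" by auto
      moreover have "inj_on f {w \<in> W. \<tau> w = \<theta>}" using f by (auto simp: inj_on_def)
      ultimately show ?thesis by (simp add: card_image)
    qed
    then show ?thesis using f assms(3) by auto
  qed
  then have "(\<lambda>f. ?g f ` W) ` ?A \<subseteq> ?Q" by (rule image_subsetI)
  from sum.group[OF finA finQ this, of "\<lambda>_. 1", symmetric]
  have "card ?A = (\<Sum>Q\<in>?Q. card {f \<in> ?A. ?g f ` W = Q})" by (simp only: card_eq_sum)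
  also have "\<dots> = (\<Sum>Q\<in>?Q. ?p)"
  proof (rule sum.cong[OF refl])
    fix Q assume Q: "Q \<in> ?Q"
    then have "{f \<in> ?A. ?g f ` W = Q} = {f \<in> W \<rightarrow>\<^sub>E X. inj_on (?g f) W \<and> ?g f ` W = Q}" by auto
    also have "card \<dots> = ?p"
      using Q by (intro card_maps_with_graph assms) auto
    finally show "card {f \<in> ?A. ?g f ` W = Q} = ?p" .
  qed
  finally show ?thesis by simp
qed

subsection \<open>Homomorphisms extending a placement of the cover\<close>

text \<open>The cover has vertices \<open>s 0, \<dots>, s (c - 1)\<close>, mapped to \<open>\<psi> 0, \<dots>, \<psi> (c - 1)\<close>. A slot stands for
  an edge to be mapped: \<open>Inl (i, j)\<close> for an edge between \<open>s i\<close> and \<open>s j\<close>, and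
  \<open>Inr ((x, \<theta>), j)\<close> for the edge to \<open>s j\<close> of a vertex \<open>x\<close> of type \<open>\<theta>\<close>, that is, with
  neighbours \<open>s ` \<theta>\<close>.\<close>

type_synonym 'x slot = "nat \<times> nat + ('x \<times> nat set) \<times> nat"

definition slots :: "(nat \<times> nat) set \<Rightarrow> ('x \<times> nat set) set \<Rightarrow> 'x slot set" where
  "slots SS Q = Inl ` SS \<union> Inr ` (SIGMA p:Q. snd p)"

fun slot_edge :: "('x \<Rightarrow> 'b) \<Rightarrow> (nat \<Rightarrow> 'b) \<Rightarrow> 'x slot \<Rightarrow> 'b set" where
  "slot_edge z \<psi> (Inl (i, j)) = {\<psi> i, \<psi> j}"
| "slot_edge z \<psi> (Inr ((x, \<theta>), j)) = {z x, \<psi> j}"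

text \<open>The labels \<open>x\<close> and their positions \<open>z x\<close> are kept general for
  three uses: vertices of \<open>H\<close> placed by a homomorphism, vertices of \<open>G\<close>
  with \<open>z = id\<close>, and positions of the cover with \<open>z = \<psi>\<close>.\<close>

definition admissible ::
  "'b set set \<Rightarrow> (nat \<times> nat) set \<Rightarrow> ('x \<Rightarrow> 'b) \<Rightarrow> (nat \<Rightarrow> 'b) \<Rightarrow> ('x \<times> nat set) set \<Rightarrow> bool" where
  "admissible F SS z \<psi> Q \<longleftrightarrow> slot_edge z \<psi> ` slots SS Q \<subseteq> F \<and> inj_on (slot_edge z \<psi>) (slots SS Q)"

lemma slotsE:
  assumes "p \<in> slots SS Q"
  obtains i j where "p = Inl (i, j)" "(i, j) \<in> SS"
  | x \<theta> j where "p = Inr ((x, \<theta>), j)" "(x, \<theta>) \<in> Q" "j \<in> \<theta>"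
  using assms unfolding slots_def by fastforce

lemma slots_mono: "Q \<subseteq> Q' \<Longrightarrow> slots SS Q \<subseteq> slots SS Q'"
  unfolding slots_def by auto

text \<open>Relabelling maps slots to slots without changing their edges, so only its injectivity on
  slots is at stake. Nonempty types ensure that each pair owns a slot: two pairs that are identified
  then produce two slots with the same edge.\<close>

lemma admissible_map:
  fixes f :: "'x \<Rightarrow> 'y" and z :: "'y \<Rightarrow> 'b"
  assumes "\<And>x \<theta>. (x, \<theta>) \<in> Q \<Longrightarrow> \<theta> \<noteq> {}"
  shows "admissible F SS (z \<circ> f) \<psi> Q \<longleftrightarrow>
    inj_on (map_prod f id) Q \<and> admissible F SS z \<psi> (map_prod f id ` Q)"
proof -
  define lift :: "'x slot \<Rightarrow> 'y slot" where "lift = map_sum id (map_prod (map_prod f id) id)"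
  have edge: "slot_edge (z \<circ> f) \<psi> = slot_edge z \<psi> \<circ> lift"
  proof
    fix p show "slot_edge (z \<circ> f) \<psi> p = (slot_edge z \<psi> \<circ> lift) p"
      by (cases "(z \<circ> f, \<psi>, p)" rule: slot_edge.cases) (auto simp: lift_def)
  qed
  have image: "lift ` slots SS Q = slots SS (map_prod f id ` Q)"
  proof -
    have "lift ` slots SS Q = Inl ` SS \<union> (\<lambda>p. Inr (map_prod (map_prod f id) id p)) ` (SIGMA p:Q. snd p)"
      unfolding slots_def lift_def image_Un image_image by simp
    also have "(\<lambda>p. Inr (map_prod (map_prod f id) id p)) ` (SIGMA p:Q. snd p) =
        Inr ` (SIGMA p:map_prod f id ` Q. snd p)"
      by (force simp: image_iff)
    finally show ?thesis unfolding slots_def .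
  qed
  have inj: "inj_on lift (slots SS Q) \<longleftrightarrow> inj_on (map_prod f id) Q"
  proof
    assume L: "inj_on lift (slots SS Q)"
    show "inj_on (map_prod f id) Q"
    proof (rule inj_onI)
      fix p q assume pq: "p \<in> Q" "q \<in> Q" "map_prod f id p = map_prod f id q"
      then have "snd p = snd q" by (metis id_apply snd_map_prod)
      moreover obtain j where "j \<in> snd p" using assms[of "fst p" "snd p"] pq(1) by auto
      ultimately have "Inr (p, j) \<in> slots SS Q" "Inr (q, j) \<in> slots SS Q"
        using pq unfolding slots_def by auto
      moreover have "lift (Inr (p, j)) = lift (Inr (q, j))" using pq by (simp add: lift_def)
      ultimately show "p = q" using L by (auto dest: inj_onD)
    qed
  next
    assume I: "inj_on (map_prod f id) Q"
    show "inj_on lift (slots SS Q)"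
    proof (rule inj_onI)
      fix p q assume pq: "p \<in> slots SS Q" "q \<in> slots SS Q" "lift p = lift q"
      show "p = q"
      proof (cases p; cases q)
        fix a b assume "p = Inr a" "q = Inr b"
        then have "fst a \<in> Q" "fst b \<in> Q" "map_prod f id (fst a) = map_prod f id (fst b)" "snd a = snd b"
          using pq unfolding slots_def lift_def by (auto simp: prod_eq_iff)
        then have "a = b" using inj_onD[OF I, of "fst a" "fst b"] by (simp add: prod_eq_iff)
        then show ?thesis using \<open>p = Inr a\<close> \<open>q = Inr b\<close> by simp
      qed (use pq in \<open>auto simp: lift_def\<close>)
    qed
  qed
  have "inj_on (slot_edge z \<psi> \<circ> lift) (slots SS Q) \<longleftrightarrow>
      inj_on lift (slots SS Q) \<and> inj_on (slot_edge z \<psi>) (lift ` slots SS Q)"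
    using comp_inj_on_iff inj_on_imageI2 by blast
  then show ?thesis
    unfolding admissible_def edge image_comp[symmetric] image inj by blast
qed

definition graph_on :: "'x set \<Rightarrow> ('x \<Rightarrow> nat set) \<Rightarrow> ('x \<times> nat set) set" where
  "graph_on W \<tau> = (\<lambda>w. (w, \<tau> w)) ` W"

text \<open>In \<open>H\<close> itself distinct slots name distinct edges: \<open>i < j\<close>
  lists an edge inside the cover once, and an edge to \<open>W\<close> has a unique end outside the
  cover. Edge-injectivity can thus be tested on slots.\<close>

lemma inj_on_slot_edge:
  assumes "inj_on s {..<c}" "W \<inter> s ` {..<c} = {}" "SS \<subseteq> {(i, j). i < j \<and> j < c}"
    "\<And>w. w \<in> W \<Longrightarrow> \<tau> w \<subseteq> {..<c}"
  shows "inj_on (slot_edge id s) (slots SS (graph_on W \<tau>))"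
proof -
  have s: "s i = s j \<longleftrightarrow> i = j" if "i < c" "j < c" for i j using assms(1) that by (auto simp: inj_on_def)
  have sW: "s j \<noteq> w" if "j < c" "w \<in> W" for j w using assms(2) that by auto
  have SS: "i < j" "j < c" "i < c" if "(i, j) \<in> SS" for i j using assms(3) that by auto
  have W: "w \<in> W" "\<theta> = \<tau> w" "j \<in> \<theta> \<Longrightarrow> j < c" if "(w, \<theta>) \<in> graph_on W \<tau>" for w \<theta> j
    using that assms(4) unfolding graph_on_def by auto
  show ?thesis
  proof (rule inj_onI)
    fix p q assume p: "p \<in> slots SS (graph_on W \<tau>)" and q: "q \<in> slots SS (graph_on W \<tau>)"
      and eq: "slot_edge id s p = slot_edge id s q"
    from p show "p = q"
    proof (cases rule: slotsE)
      case p: (1 i j)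
      from q show ?thesis
      proof (cases rule: slotsE)
        case (1 a b)
        with p eq SS[of i j] SS[of a b] s show ?thesis by (auto simp: doubleton_eq_iff)
      next
        case (2 w \<theta> k)
        with p eq SS[of i j] W[of w \<theta>] sW show ?thesis by (auto simp: doubleton_eq_iff)
      qed
    next
      case p: (2 v \<eta> l)
      from q show ?thesis
      proof (cases rule: slotsE)
        case (1 i j)
        with p eq SS[of i j] W[of v \<eta>] sW[of i v] sW[of j v] show ?thesis
          by (auto simp: doubleton_eq_iff)
      next
        case (2 w \<theta> k)
        then have "v = w \<and> s l = s k"
          using p eq W[of w \<theta>] W[of v \<eta>] sW by (auto simp: doubleton_eq_iff)
        with p 2 W[of w \<theta>] W[of v \<eta>] s show ?thesis by auto
      qed
    qed
  qed
qed

text \<open>A homomorphism is a placement \<psi> of the cover together with a map of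
  \<open>W\<close>. Since the slots enumerate \<open>E\<close> exactly, preserving edges and
  edge-injectivity jointly become \<open>admissible\<close>.\<close>

lemma card_edge_inj_homs_cover:
  fixes s :: "nat \<Rightarrow> 'a" and X :: "'b set"
  assumes s: "inj_on s {..<c}" "W \<inter> s ` {..<c} = {}" "SS \<subseteq> {(i, j). i < j \<and> j < c}"
    and \<tau>: "\<And>w. w \<in> W \<Longrightarrow> \<tau> w \<subseteq> {..<c}" "\<And>w. w \<in> W \<Longrightarrow> \<tau> w \<noteq> {}"
    and fin: "finite W" "finite X"
    and simple: "simple_graph (s ` {..<c} \<union> W, E)" and E: "E = slot_edge id s ` slots SS (graph_on W \<tau>)"
  shows "card (edge_inj_homs (s ` {..<c} \<union> W, E) (X, F)) = (\<Sum>\<psi>\<in>{..<c} \<rightarrow>\<^sub>E X.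
    card {f \<in> W \<rightarrow>\<^sub>E X. inj_on (\<lambda>w. (f w, \<tau> w)) W \<and> admissible F SS id \<psi> ((\<lambda>w. (f w, \<tau> w)) ` W)})"
proof -
  let ?S = "s ` {..<c}" and ?g = "\<lambda>f w. (f w, \<tau> w)"
  let ?H = "(?S \<union> W, E)"
  define A where "A \<psi> = {f \<in> W \<rightarrow>\<^sub>E X. inj_on (?g f) W \<and> admissible F SS id \<psi> (?g f ` W)}" for \<psi>
  define r where "r = inv_into {..<c} s"
  have r: "r (s j) = j" if "j < c" for j using s(1) that by (simp add: r_def)
  \<comment> \<open>Injectivity of vertex-with-type is automatic: two vertices of the same nonempty
    type with the same image would produce a doubled edge.\<close>
  have graph: "inj_on (?g f) W \<and> admissible F SS id \<psi> (?g f ` W) \<longleftrightarrow> admissible F SS f \<psi> (graph_on W \<tau>)" for f \<psi>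
  proof -
    have "inj_on (map_prod f id) (graph_on W \<tau>) \<longleftrightarrow> inj_on (?g f) W"
      unfolding graph_on_def
      by (subst comp_inj_on_iff) (auto simp: inj_on_def)
    moreover have "map_prod f id ` graph_on W \<tau> = ?g f ` W"
      unfolding graph_on_def by (simp add: image_image)
    ultimately show ?thesis
      using admissible_map[of "graph_on W \<tau>" F SS id f \<psi>] \<tau>(2) unfolding graph_on_def by auto
  qed
  have edge: "\<phi> ` slot_edge id s p = slot_edge \<phi> (\<phi> \<circ> s) p" for \<phi> :: "'a \<Rightarrow> 'b" and p
    by (cases "(id :: 'a \<Rightarrow> 'a, s, p)" rule: slot_edge.cases) auto
  have hom: "\<phi> \<in> edge_inj_homs ?H (X, F) \<longleftrightarrow>
      \<phi> \<in> ?S \<union> W \<rightarrow>\<^sub>E X \<and> admissible F SS \<phi> (\<phi> \<circ> s) (graph_on W \<tau>)" for \<phi>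
  proof -
    have "inj_on ((`) \<phi>) E \<longleftrightarrow> inj_on ((`) \<phi> \<circ> slot_edge id s) (slots SS (graph_on W \<tau>))"
      unfolding E by (rule comp_inj_on_iff[OF inj_on_slot_edge[OF s \<tau>(1)]])
    also have "(`) \<phi> \<circ> slot_edge id s = slot_edge \<phi> (\<phi> \<circ> s)" by (simp add: fun_eq_iff edge)
    finally have "inj_on ((`) \<phi>) E \<longleftrightarrow> inj_on (slot_edge \<phi> (\<phi> \<circ> s)) (slots SS (graph_on W \<tau>))" .
    moreover have "(\<forall>e\<in>E. \<phi> ` e \<in> F) \<longleftrightarrow> slot_edge \<phi> (\<phi> \<circ> s) ` slots SS (graph_on W \<tau>) \<subseteq> F"
      unfolding E by (auto simp: edge)
    ultimately show ?thesis
      unfolding edge_inj_homs_iff[OF simple] fst_conv snd_conv admissible_def by blast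
  qed
  have cong: "admissible F SS f \<psi> (graph_on W \<tau>) = admissible F SS f' \<psi>' (graph_on W \<tau>)"
    if "\<And>w. w \<in> W \<Longrightarrow> f w = f' w" "\<And>j. j < c \<Longrightarrow> \<psi> j = \<psi>' j" for f f' :: "'a \<Rightarrow> 'b" and \<psi> \<psi>'
  proof -
    have "slot_edge f \<psi> p = slot_edge f' \<psi>' p" if "p \<in> slots SS (graph_on W \<tau>)" for p
      using that
    proof (cases rule: slotsE)
      case (1 i j)
      then have "i < c" "j < c" using s(3) by auto
      then show ?thesis using 1 \<open>\<And>j. j < c \<Longrightarrow> \<psi> j = \<psi>' j\<close> by simp
    next
      case (2 w \<theta> j)
      then have "w \<in> W" "j < c" using \<tau>(1) by (auto simp: graph_on_def)
      then show ?thesis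
        using 2 \<open>\<And>j. j < c \<Longrightarrow> \<psi> j = \<psi>' j\<close> \<open>\<And>w. w \<in> W \<Longrightarrow> f w = f' w\<close> by simp
    qed
    then show ?thesis unfolding admissible_def by (simp cong: image_cong inj_on_cong)
  qed
  define join where "join \<psi> f v = (if v \<in> ?S then \<psi> (r v) else f v)" for \<psi> :: "nat \<Rightarrow> 'b" and f v
  have j1: "join \<psi> f (s j) = \<psi> j" if "j < c" for \<psi> f j using that r by (simp add: join_def)
  have j2: "join \<psi> f w = f w" if "w \<in> W" for \<psi> f w using that s(2) by (auto simp: join_def)
  have memA: "f \<in> A \<psi> \<longleftrightarrow> f \<in> W \<rightarrow>\<^sub>E X \<and> admissible F SS f \<psi> (graph_on W \<tau>)" for f \<psi>
    unfolding A_def using graph by auto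
  have "bij_betw (\<lambda>(\<psi>, f). join \<psi> f) (SIGMA \<psi>:{..<c} \<rightarrow>\<^sub>E X. A \<psi>) (edge_inj_homs ?H (X, F))"
  proof (rule bij_betwI[of _ _ _ "\<lambda>\<phi>. (restrict (\<phi> \<circ> s) {..<c}, restrict \<phi> W)"])
    show "(\<lambda>(\<psi>, f). join \<psi> f) \<in> (SIGMA \<psi>:{..<c} \<rightarrow>\<^sub>E X. A \<psi>) \<rightarrow> edge_inj_homs ?H (X, F)"
    proof (rule Pi_I)
      fix z assume "z \<in> (SIGMA \<psi>:{..<c} \<rightarrow>\<^sub>E X. A \<psi>)"
      then obtain \<psi> f where z: "z = (\<psi>, f)" "\<psi> \<in> {..<c} \<rightarrow>\<^sub>E X" "f \<in> W \<rightarrow>\<^sub>E X"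
        "admissible F SS f \<psi> (graph_on W \<tau>)" by (auto simp: memA)
      have "admissible F SS (join \<psi> f) (join \<psi> f \<circ> s) (graph_on W \<tau>)"
        using z(4) cong[of "join \<psi> f" f "join \<psi> f \<circ> s" \<psi>] j1 j2 by simp
      moreover have "join \<psi> f \<in> ?S \<union> W \<rightarrow>\<^sub>E X"
      proof (rule PiE_I)
        fix v assume "v \<in> ?S \<union> W"
        then show "join \<psi> f v \<in> X" using z(2,3) j1 j2 by auto
      next
        fix v assume "v \<notin> ?S \<union> W"
        then show "join \<psi> f v = undefined" using z(3) by (auto simp: join_def PiE_iff extensional_def)
      qed
      ultimately show "(\<lambda>(\<psi>, f). join \<psi> f) z \<in> edge_inj_homs ?H (X, F)" using z(1) hom by simp
    qed
    show "(\<lambda>\<phi>. (restrict (\<phi> \<circ> s) {..<c}, restrict \<phi> W)) \<in>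
        edge_inj_homs ?H (X, F) \<rightarrow> (SIGMA \<psi>:{..<c} \<rightarrow>\<^sub>E X. A \<psi>)"
    proof (rule Pi_I)
      fix \<phi> assume "\<phi> \<in> edge_inj_homs ?H (X, F)"
      then have \<phi>: "\<phi> \<in> ?S \<union> W \<rightarrow>\<^sub>E X" "admissible F SS \<phi> (\<phi> \<circ> s) (graph_on W \<tau>)" using hom by auto
      have "admissible F SS (restrict \<phi> W) (restrict (\<phi> \<circ> s) {..<c}) (graph_on W \<tau>)"
        using \<phi>(2) cong[of "restrict \<phi> W" \<phi> "restrict (\<phi> \<circ> s) {..<c}" "\<phi> \<circ> s"] by simp
      then show "(restrict (\<phi> \<circ> s) {..<c}, restrict \<phi> W) \<in> (SIGMA \<psi>:{..<c} \<rightarrow>\<^sub>E X. A \<psi>)"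
        using \<phi>(1) by (auto simp: memA PiE_iff)
    qed
  next
    fix z assume "z \<in> (SIGMA \<psi>:{..<c} \<rightarrow>\<^sub>E X. A \<psi>)"
    then obtain \<psi> f where z: "z = (\<psi>, f)" "\<psi> \<in> {..<c} \<rightarrow>\<^sub>E X" "f \<in> W \<rightarrow>\<^sub>E X" by (auto simp: memA)
    have "restrict (join \<psi> f \<circ> s) {..<c} = \<psi>" "restrict (join \<psi> f) W = f"
      using z(2,3) j1 j2 by (auto simp: PiE_iff extensional_def fun_eq_iff)
    then show "(\<lambda>\<phi>. (restrict (\<phi> \<circ> s) {..<c}, restrict \<phi> W)) ((\<lambda>(\<psi>, f). join \<psi> f) z) = z"
      using z(1) by simp
  next
    fix \<phi> assume "\<phi> \<in> edge_inj_homs ?H (X, F)"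
    then have \<phi>: "\<phi> \<in> ?S \<union> W \<rightarrow>\<^sub>E X" using hom by auto
    have "join (restrict (\<phi> \<circ> s) {..<c}) (restrict \<phi> W) v = \<phi> v" for v
      using \<phi> r by (cases "v \<in> ?S") (auto simp: join_def PiE_iff extensional_def)
    then show "(\<lambda>(\<psi>, f). join \<psi> f) (restrict (\<phi> \<circ> s) {..<c}, restrict \<phi> W) = \<phi>" by auto
  qed
  from bij_betw_same_card[OF this]
  have "card (edge_inj_homs ?H (X, F)) = card (SIGMA \<psi>:{..<c} \<rightarrow>\<^sub>E X. A \<psi>)" by (rule sym)
  also have "\<dots> = (\<Sum>\<psi>\<in>{..<c} \<rightarrow>\<^sub>E X. card (A \<psi>))"
  proof (rule card_SigmaI)
    show "\<forall>\<psi>\<in>{..<c} \<rightarrow>\<^sub>E X. finite (A \<psi>)"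
      unfolding A_def using fin by (auto intro: finite_subset[of _ "W \<rightarrow>\<^sub>E X"] finite_PiE)
  qed (use fin in \<open>auto intro: finite_PiE\<close>)
  finally show ?thesis unfolding A_def .
qed

subsection \<open>The generating function of a placement of the cover\<close>

text \<open>Induction on \<open>Z\<close>: a relation over one more vertex \<open>z\<close> is a
  relation over the others together with an arbitrary fibre at \<open>z\<close>. Condition and
  weight both split along this bijection, so the sum factors.\<close>

lemma sum_Pow_Times_decompose:
  fixes wt :: "'t \<Rightarrow> nat"
  assumes "finite Z" "finite Y" "finite \<Theta>" "Y \<inter> Z = {}"
  shows "(\<Sum>Q\<in>Pow ((Y \<union> Z) \<times> \<Theta>). of_bool (R0 (Q \<inter> Y \<times> \<Theta>) \<and> (\<forall>x\<in>Z. R1 x (Q `` {x}))) * (\<Prod>(x, \<theta>)\<in>Q. wt \<theta>)) =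
    (\<Sum>Q\<in>Pow (Y \<times> \<Theta>). of_bool (R0 Q) * (\<Prod>(x, \<theta>)\<in>Q. wt \<theta>)) *
    (\<Prod>x\<in>Z. \<Sum>T\<in>Pow \<Theta>. of_bool (R1 x T) * (\<Prod>\<theta>\<in>T. wt \<theta>))"
  using assms(1,4)
proof (induction Z)
  case empty
  show ?case by (rule trans[OF sum.cong]) (auto simp: Int_absorb2)
next
  case (insert z Z)
  let ?U = "(Y \<union> Z) \<times> \<Theta>"
  let ?h = "\<lambda>(Q, T). Q \<union> {z} \<times> T"
  define P where "P Q \<longleftrightarrow> R0 (Q \<inter> Y \<times> \<Theta>) \<and> (\<forall>x\<in>Z. R1 x (Q `` {x}))" for Q
  define P' where "P' Q \<longleftrightarrow> R0 (Q \<inter> Y \<times> \<Theta>) \<and> (\<forall>x\<in>insert z Z. R1 x (Q `` {x}))" for Q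
  have z: "z \<notin> Y" "z \<notin> Z" using insert by auto
  have bij: "bij_betw ?h (Pow ?U \<times> Pow \<Theta>) (Pow ((Y \<union> insert z Z) \<times> \<Theta>))"
  proof (rule bij_betwI[of _ _ _ "\<lambda>Q. (Q \<inter> ?U, Q `` {z})"])
    fix Q assume "Q \<in> Pow ((Y \<union> insert z Z) \<times> \<Theta>)"
    then show "?h (Q \<inter> ?U, Q `` {z}) = Q" by auto
  next
    fix p assume "p \<in> Pow ?U \<times> Pow \<Theta>"
    then show "(\<lambda>Q. (Q \<inter> ?U, Q `` {z})) (?h p) = p" using z by auto
  qed auto
  have P': "P' (Q \<union> {z} \<times> T) \<longleftrightarrow> P Q \<and> R1 z T" if "Q \<subseteq> ?U" for Q T
  proof -
    have "(Q \<union> {z} \<times> T) \<inter> Y \<times> \<Theta> = Q \<inter> Y \<times> \<Theta>" using z by auto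
    moreover have "(Q \<union> {z} \<times> T) `` {z} = T" using z that by auto
    moreover have "(Q \<union> {z} \<times> T) `` {x} = Q `` {x}" if "x \<in> Z" for x using z that by auto
    ultimately show ?thesis unfolding P_def P'_def by auto
  qed
  have w: "(\<Prod>(x, \<theta>)\<in>Q \<union> {z} \<times> T. wt \<theta>) = (\<Prod>(x, \<theta>)\<in>Q. wt \<theta>) * (\<Prod>\<theta>\<in>T. wt \<theta>)"
    if "Q \<subseteq> ?U" "T \<subseteq> \<Theta>" for Q T
  proof -
    have "finite Q" "finite T" using that assms(2,3) insert.hyps(1) by (auto intro: finite_subset)
    then have "(\<Prod>(x, \<theta>)\<in>Q \<union> {z} \<times> T. wt \<theta>) = (\<Prod>(x, \<theta>)\<in>Q. wt \<theta>) * (\<Prod>(x, \<theta>)\<in>{z} \<times> T. wt \<theta>)"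
      using that z by (intro prod.union_disjoint) auto
    also have "(\<Prod>(x, \<theta>)\<in>{z} \<times> T. wt \<theta>) = (\<Prod>\<theta>\<in>T. wt \<theta>)"
      by (rule prod.reindex_bij_witness[of _ "\<lambda>\<theta>. (z, \<theta>)" snd]) auto
    finally show ?thesis .
  qed
  have "(\<Sum>Q\<in>Pow ((Y \<union> insert z Z) \<times> \<Theta>). of_bool (P' Q) * (\<Prod>(x, \<theta>)\<in>Q. wt \<theta>)) =
      (\<Sum>p\<in>Pow ?U \<times> Pow \<Theta>. of_bool (P' (?h p)) * (\<Prod>(x, \<theta>)\<in>?h p. wt \<theta>))"
    by (rule sum.reindex_bij_betw[OF bij, symmetric])
  also have "\<dots> = (\<Sum>(Q, T)\<in>Pow ?U \<times> Pow \<Theta>. (of_bool (P Q) * (\<Prod>(x, \<theta>)\<in>Q. wt \<theta>)) *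
      (of_bool (R1 z T) * (\<Prod>\<theta>\<in>T. wt \<theta>)))"
    by (rule sum.cong) (auto simp: P' w)
  also have "\<dots> = (\<Sum>Q\<in>Pow ?U. of_bool (P Q) * (\<Prod>(x, \<theta>)\<in>Q. wt \<theta>)) *
      (\<Sum>T\<in>Pow \<Theta>. of_bool (R1 z T) * (\<Prod>\<theta>\<in>T. wt \<theta>))"
    by (simp add: sum_product sum.cartesian_product)
  finally show ?case using insert unfolding P_def P'_def by (simp add: mult_ac)
qed

text \<open>Here \<open>T\<close> is the set of types occurring at \<open>x\<close>. Because
  \<open>{x, a} = {x, b}\<close> forces \<open>a = b\<close>, the second clause is injectivity on
  the slots at \<open>x\<close>.\<close>

definition star :: "'b set set \<Rightarrow> (nat \<Rightarrow> 'b) \<Rightarrow> 'b \<Rightarrow> nat set set \<Rightarrow> bool" where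
  "star F \<psi> x T \<longleftrightarrow> (\<forall>\<theta>\<in>T. \<forall>j\<in>\<theta>. {x, \<psi> j} \<in> F) \<and>
    (\<forall>\<theta>\<in>T. \<forall>\<theta>'\<in>T. \<forall>j\<in>\<theta>. \<forall>j'\<in>\<theta>'. \<psi> j = \<psi> j' \<longrightarrow> \<theta> = \<theta>' \<and> j = j')"

text \<open>Edges at a vertex outside the image of the cover can collide only with edges at the same
  vertex.\<close>

lemma admissible_decompose:
  fixes \<psi> :: "nat \<Rightarrow> 'b"
  assumes SS: "SS \<subseteq> {(i, j). i < j \<and> j < c}" and \<Theta>: "\<And>\<theta>. \<theta> \<in> \<Theta> \<Longrightarrow> \<theta> \<subseteq> {..<c}"
    and Q: "Q \<subseteq> X \<times> \<Theta>" and Y: "Y = \<psi> ` {..<c}"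
  shows "admissible F SS id \<psi> Q \<longleftrightarrow> admissible F SS id \<psi> (Q \<inter> Y \<times> \<Theta>) \<and> (\<forall>x\<in>X - Y. star F \<psi> x (Q `` {x}))"
proof
  assume A: "admissible F SS id \<psi> Q"
  then have F: "slot_edge id \<psi> ` slots SS Q \<subseteq> F" and inj: "inj_on (slot_edge id \<psi>) (slots SS Q)"
    unfolding admissible_def by auto
  have "slots SS (Q \<inter> Y \<times> \<Theta>) \<subseteq> slots SS Q" by (rule slots_mono) auto
  then have "admissible F SS id \<psi> (Q \<inter> Y \<times> \<Theta>)"
    using F inj unfolding admissible_def by (meson image_mono inj_on_subset subset_trans)
  moreover have "star F \<psi> x (Q `` {x})" for x
  proof -
    have slot: "Inr ((x, \<theta>), j) \<in> slots SS Q" if "\<theta> \<in> Q `` {x}" "j \<in> \<theta>" for \<theta> j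
      using that by (auto simp: slots_def image_iff)
    have "{x, \<psi> j} \<in> F" if "\<theta> \<in> Q `` {x}" "j \<in> \<theta>" for \<theta> j
      using subsetD[OF F imageI[OF slot[OF that]]] by simp
    moreover have "\<theta> = \<theta>' \<and> j = j'"
      if "\<theta> \<in> Q `` {x}" "\<theta>' \<in> Q `` {x}" "j \<in> \<theta>" "j' \<in> \<theta>'" "\<psi> j = \<psi> j'" for \<theta> \<theta>' j j'
      using inj_onD[OF inj _ slot[OF that(1,3)] slot[OF that(2,4)]] that(5) by simp
    ultimately show ?thesis unfolding star_def by blast
  qed
  ultimately show "admissible F SS id \<psi> (Q \<inter> Y \<times> \<Theta>) \<and> (\<forall>x\<in>X - Y. star F \<psi> x (Q `` {x}))" by blast
next
  assume A: "admissible F SS id \<psi> (Q \<inter> Y \<times> \<Theta>) \<and> (\<forall>x\<in>X - Y. star F \<psi> x (Q `` {x}))"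
  let ?I = "slots SS (Q \<inter> Y \<times> \<Theta>)"
  have F: "slot_edge id \<psi> ` ?I \<subseteq> F" and inj: "inj_on (slot_edge id \<psi>) ?I"
    using A unfolding admissible_def by auto
  have star: "star F \<psi> x (Q `` {x})" if "x \<in> X" "x \<notin> Y" for x using A that by blast
  \<comment> \<open>Either the edge of a slot lies inside \<open>Y\<close>, or it has exactly one
    end outside \<open>Y\<close>. Edges of different kinds differ, and equal edges of the second
    kind share that end.\<close>
  have cases: "p \<in> ?I \<and> slot_edge id \<psi> p \<subseteq> Y \<or>
      (\<exists>x \<theta> j. p = Inr ((x, \<theta>), j) \<and> x \<in> X \<and> x \<notin> Y \<and> \<theta> \<in> Q `` {x} \<and> j \<in> \<theta> \<and> \<psi> j \<in> Y)" if "p \<in> slots SS Q" for p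
    using that
  proof (cases rule: slotsE)
    case (1 i j)
    then have "i < c" "j < c" using SS by auto
    then show ?thesis using 1 Y by (auto simp: slots_def)
  next
    case (2 x \<theta> j)
    then have "x \<in> X" "\<theta> \<in> \<Theta>" "j < c" using Q \<Theta>[of \<theta>] by auto
    then show ?thesis
      using 2 Y by (cases "x \<in> Y") (auto simp: slots_def image_iff)
  qed
  have "slot_edge id \<psi> ` slots SS Q \<subseteq> F"
  proof (rule image_subsetI)
    fix p assume "p \<in> slots SS Q"
    from cases[OF this] show "slot_edge id \<psi> p \<in> F"
      using F star unfolding star_def by fastforce
  qed
  moreover have "inj_on (slot_edge id \<psi>) (slots SS Q)"
  proof (rule inj_onI)
    fix p q assume pq: "p \<in> slots SS Q" "q \<in> slots SS Q" "slot_edge id \<psi> p = slot_edge id \<psi> q"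
    from cases[OF pq(1)] show "p = q"
    proof (elim disjE exE conjE)
      assume p: "p \<in> ?I" "slot_edge id \<psi> p \<subseteq> Y"
      from cases[OF pq(2)] show ?thesis using p pq(3) inj_onD[OF inj] by auto
    next
      fix x \<theta> j assume p: "p = Inr ((x, \<theta>), j)" "x \<in> X" "x \<notin> Y" "\<theta> \<in> Q `` {x}" "j \<in> \<theta>" "\<psi> j \<in> Y"
      from cases[OF pq(2)] show ?thesis
      proof (elim disjE exE conjE)
        assume "slot_edge id \<psi> q \<subseteq> Y"
        then show ?thesis using p pq(3) by auto
      next
        fix x' \<theta>' j'
        assume q: "q = Inr ((x', \<theta>'), j')" "x' \<in> X" "x' \<notin> Y" "\<theta>' \<in> Q `` {x'}" "j' \<in> \<theta>'" "\<psi> j' \<in> Y"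
        have "x = x'" "\<psi> j = \<psi> j'" using pq(3) p q by (auto simp: doubleton_eq_iff)
        then have "\<theta> = \<theta>' \<and> j = j'" using star[OF p(2,3)] p q unfolding star_def by blast
        then show ?thesis using p q \<open>x = x'\<close> by simp
      qed
    qed
  qed
  ultimately show "admissible F SS id \<psi> Q" unfolding admissible_def by blast
qed

text \<open>A vertex in the image of the cover is represented by the first position placed on it.\<close>

definition first_positions :: "(nat \<Rightarrow> 'b) \<Rightarrow> (nat \<times> 't) set \<Rightarrow> bool" where
  "first_positions \<psi> Q \<longleftrightarrow> (\<forall>p\<in>Q. \<forall>i<fst p. \<psi> i \<noteq> \<psi> (fst p))"

lemma sum_admissible_positions:
  fixes \<psi> :: "nat \<Rightarrow> 'b" and wt :: "nat set \<Rightarrow> nat"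
  assumes \<Theta>: "\<And>\<theta>. \<theta> \<in> \<Theta> \<Longrightarrow> \<theta> \<noteq> {}" "finite \<Theta>"
  shows "(\<Sum>Q\<in>Pow (\<psi> ` {..<c} \<times> \<Theta>). of_bool (admissible F SS id \<psi> Q) * (\<Prod>(x, \<theta>)\<in>Q. wt \<theta>)) =
    (\<Sum>Q\<in>Pow ({..<c} \<times> \<Theta>). of_bool (first_positions \<psi> Q \<and> admissible F SS \<psi> \<psi> Q) * (\<Prod>(i, \<theta>)\<in>Q. wt \<theta>))"
proof -
  \<comment> \<open>The first positions form a transversal: \<psi> maps \<open>J\<close> bijectively
    onto the image of the cover.\<close>
  define J where "J = {j. j < c \<and> (\<forall>i<j. \<psi> i \<noteq> \<psi> j)}"
  have inj: "inj_on \<psi> J" unfolding J_def by (rule inj_onI) (metis (mono_tags, lifting) mem_Collect_eq nat_neq_iff)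
  have "\<psi> j \<in> \<psi> ` J" if "j < c" for j
  proof -
    define i where "i = (LEAST i. \<psi> i = \<psi> j)"
    have "\<psi> i = \<psi> j" unfolding i_def by (rule LeastI) (rule refl)
    moreover have "i \<le> j" unfolding i_def by (rule Least_le) (rule refl)
    moreover have "\<psi> k \<noteq> \<psi> i" if "k < i" for k
      using not_less_Least[OF that[unfolded i_def]] \<open>\<psi> i = \<psi> j\<close> by simp
    ultimately show ?thesis using that unfolding J_def by (intro image_eqI[of _ _ i]) auto
  qed
  then have image: "\<psi> ` J = \<psi> ` {..<c}" unfolding J_def by auto
  let ?h = "map_prod \<psi> id :: nat \<times> nat set \<Rightarrow> 'b \<times> nat set"
  have "bij_betw ?h (J \<times> \<Theta>) (\<psi> ` {..<c} \<times> \<Theta>)"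
    unfolding bij_betw_def using map_prod_inj_on[OF inj, of id \<Theta>] map_prod_surj_on[OF image, of id \<Theta> \<Theta>] by simp
  then have bij: "bij_betw ((`) ?h) (Pow (J \<times> \<Theta>)) (Pow (\<psi> ` {..<c} \<times> \<Theta>))" by (rule bij_betw_Pow)
  have injQ: "inj_on ?h Q" if "Q \<subseteq> J \<times> \<Theta>" for Q
    using map_prod_inj_on[OF inj, of id \<Theta>] that by (auto intro: inj_on_subset)
  have "(\<Sum>Q\<in>Pow (\<psi> ` {..<c} \<times> \<Theta>). of_bool (admissible F SS id \<psi> Q) * (\<Prod>(x, \<theta>)\<in>Q. wt \<theta>)) =
      (\<Sum>Q\<in>Pow (J \<times> \<Theta>). of_bool (admissible F SS id \<psi> (?h ` Q)) * (\<Prod>(x, \<theta>)\<in>?h ` Q. wt \<theta>))"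
    by (rule sum.reindex_bij_betw[OF bij, symmetric])
  also have "\<dots> = (\<Sum>Q\<in>Pow (J \<times> \<Theta>). of_bool (admissible F SS \<psi> \<psi> Q) * (\<Prod>(i, \<theta>)\<in>Q. wt \<theta>))"
  proof (rule sum.cong[OF refl])
    fix Q assume "Q \<in> Pow (J \<times> \<Theta>)"
    then have Q: "Q \<subseteq> J \<times> \<Theta>" by simp
    have "\<theta> \<noteq> {}" if "(x, \<theta>) \<in> Q" for x \<theta> using Q \<Theta> that by auto
    then have "admissible F SS (id \<circ> \<psi>) \<psi> Q \<longleftrightarrow> inj_on ?h Q \<and> admissible F SS id \<psi> (?h ` Q)"
      by (rule admissible_map)
    moreover have "(\<Prod>(x, \<theta>)\<in>?h ` Q. wt \<theta>) = (\<Prod>(i, \<theta>)\<in>Q. wt \<theta>)"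
      using injQ[OF Q] by (simp add: prod.reindex split_def)
    ultimately show "of_bool (admissible F SS id \<psi> (?h ` Q)) * (\<Prod>(x, \<theta>)\<in>?h ` Q. wt \<theta>) =
        of_bool (admissible F SS \<psi> \<psi> Q) * (\<Prod>(i, \<theta>)\<in>Q. wt \<theta>)"
      using injQ[OF Q] by simp
  qed
  also have "\<dots> = (\<Sum>Q\<in>Pow ({..<c} \<times> \<Theta>). of_bool (first_positions \<psi> Q \<and> admissible F SS \<psi> \<psi> Q) * (\<Prod>(i, \<theta>)\<in>Q. wt \<theta>))"
  proof (rule sum.mono_neutral_cong_left)
    show "finite (Pow ({..<c} \<times> \<Theta>))" using \<Theta> by simp
    show "Pow (J \<times> \<Theta>) \<subseteq> Pow ({..<c} \<times> \<Theta>)" unfolding J_def by auto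
    show "\<forall>Q\<in>Pow ({..<c} \<times> \<Theta>) - Pow (J \<times> \<Theta>).
        of_bool (first_positions \<psi> Q \<and> admissible F SS \<psi> \<psi> Q) * (\<Prod>(i, \<theta>)\<in>Q. wt \<theta>) = 0"
      unfolding J_def first_positions_def by fastforce
    fix Q assume "Q \<in> Pow (J \<times> \<Theta>)"
    then have "first_positions \<psi> Q" unfolding J_def first_positions_def by auto
    then show "of_bool (admissible F SS \<psi> \<psi> Q) * (\<Prod>(i, \<theta>)\<in>Q. wt \<theta>) =
        of_bool (first_positions \<psi> Q \<and> admissible F SS \<psi> \<psi> Q) * (\<Prod>(i, \<theta>)\<in>Q. wt \<theta>)" by simp
  qed
  finally show ?thesis .
qed

definition generating_value ::
  "nat \<Rightarrow> 'b set \<Rightarrow> 'b set set \<Rightarrow> (nat \<times> nat) set \<Rightarrow> (nat set \<Rightarrow> nat) \<Rightarrow> (nat \<Rightarrow> 'b) \<Rightarrow> nat"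
where
  "generating_value c X F SS wt \<psi> =
    (\<Sum>Q\<in>Pow ({..<c} \<times> (Pow {..<c} - {{}})).
      of_bool (first_positions \<psi> Q \<and> admissible F SS \<psi> \<psi> Q) * (\<Prod>(i, \<theta>)\<in>Q. wt \<theta>)) *
    (\<Prod>x\<in>X - \<psi> ` {..<c}. \<Sum>T\<in>Pow (Pow {..<c} - {{}}). of_bool (star F \<psi> x T) * (\<Prod>\<theta>\<in>T. wt \<theta>))"

text \<open>This is the gain in efficiency: exponentially many sets of pairs on the left, but on the
  right one sum of constant size times a product over vertices of sums of constant size.\<close>

lemma sum_admissible:
  fixes \<psi> :: "nat \<Rightarrow> 'b"
  assumes "SS \<subseteq> {(i, j). i < j \<and> j < c}" "finite X" "\<psi> \<in> {..<c} \<rightarrow> X"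
  shows "(\<Sum>Q\<in>Pow (X \<times> (Pow {..<c} - {{}})). of_bool (admissible F SS id \<psi> Q) * (\<Prod>(x, \<theta>)\<in>Q. wt \<theta>)) =
    generating_value c X F SS wt \<psi>"
proof -
  let ?\<Theta> = "Pow {..<c} - {{}}" and ?Y = "\<psi> ` {..<c}"
  have X: "X = ?Y \<union> (X - ?Y)" using assms(3) by auto
  have dec: "admissible F SS id \<psi> Q \<longleftrightarrow>
      admissible F SS id \<psi> (Q \<inter> ?Y \<times> ?\<Theta>) \<and> (\<forall>x\<in>X - ?Y. star F \<psi> x (Q `` {x}))" if "Q \<subseteq> X \<times> ?\<Theta>" for Q
    using that by (intro admissible_decompose[OF assms(1)]) auto
  have "(\<Sum>Q\<in>Pow (X \<times> ?\<Theta>). of_bool (admissible F SS id \<psi> Q) * (\<Prod>(x, \<theta>)\<in>Q. wt \<theta>)) =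
      (\<Sum>Q\<in>Pow ((?Y \<union> (X - ?Y)) \<times> ?\<Theta>). of_bool (admissible F SS id \<psi> (Q \<inter> ?Y \<times> ?\<Theta>) \<and>
        (\<forall>x\<in>X - ?Y. star F \<psi> x (Q `` {x}))) * (\<Prod>(x, \<theta>)\<in>Q. wt \<theta>))"
    unfolding X[symmetric] by (rule sum.cong) (use dec in auto)
  also have "\<dots> = (\<Sum>Q\<in>Pow (?Y \<times> ?\<Theta>). of_bool (admissible F SS id \<psi> Q) * (\<Prod>(x, \<theta>)\<in>Q. wt \<theta>)) *
      (\<Prod>x\<in>X - ?Y. \<Sum>T\<in>Pow ?\<Theta>. of_bool (star F \<psi> x T) * (\<Prod>\<theta>\<in>T. wt \<theta>))"
    using assms(2) by (intro sum_Pow_Times_decompose) auto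
  also have "(\<Sum>Q\<in>Pow (?Y \<times> ?\<Theta>). of_bool (admissible F SS id \<psi> Q) * (\<Prod>(x, \<theta>)\<in>Q. wt \<theta>)) =
      (\<Sum>Q\<in>Pow ({..<c} \<times> ?\<Theta>). of_bool (first_positions \<psi> Q \<and> admissible F SS \<psi> \<psi> Q) * (\<Prod>(i, \<theta>)\<in>Q. wt \<theta>))"
    by (rule sum_admissible_positions) auto
  finally show ?thesis unfolding generating_value_def .
qed

section \<open>The count obtained from one cover of \<open>H\<close>\<close>

definition cover_type :: "'a set set \<Rightarrow> (nat \<Rightarrow> 'a) \<Rightarrow> nat \<Rightarrow> 'a \<Rightarrow> nat set" where
  "cover_type E s c w = {j. j < c \<and> {w, s j} \<in> E}"

definition cover_pairs :: "'a set set \<Rightarrow> (nat \<Rightarrow> 'a) \<Rightarrow> nat \<Rightarrow> (nat \<times> nat) set" where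
  "cover_pairs E s c = {(i, j). i < j \<and> j < c \<and> {s i, s j} \<in> E}"

text \<open>The empty type is left out: a vertex outside the cover without neighbours in it is
  isolated or lies on an isolated edge, and is accounted for by the explicit factors.\<close>

abbreviation types :: "nat \<Rightarrow> nat set set" where
  "types c \<equiv> Pow {..<c} - {{}}"

definition type_count :: "'a set \<Rightarrow> 'a set set \<Rightarrow> (nat \<Rightarrow> 'a) \<Rightarrow> nat \<Rightarrow> nat set \<Rightarrow> nat" where
  "type_count V E s c \<theta> = card {w \<in> V. w \<notin> s ` {..<c} \<and> cover_type E s c w = \<theta>}"

text \<open>The parameter \<open>M\<close> separates the exponents of different types, \<open>B\<close> the coefficients of
  the generating function.\<close>

definition placement_count ::
  "nat \<Rightarrow> nat \<Rightarrow> 'a set \<Rightarrow> 'a set set \<Rightarrow> 'b set \<Rightarrow> 'b set set \<Rightarrow> (nat \<Rightarrow> 'a) \<Rightarrow> nat \<Rightarrow> (nat \<Rightarrow> 'b) \<Rightarrow> nat"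
where
  "placement_count M B V E X F s c \<psi> = (\<Prod>\<theta>\<in>types c. fact (type_count V E s c \<theta>)) *
    (generating_value c X F (cover_pairs E s c) (\<lambda>\<theta>. B ^ (M ^ set_encode \<theta>)) \<psi> div
      B ^ (\<Sum>\<theta>\<in>types c. type_count V E s c \<theta> * M ^ set_encode \<theta>) mod B)"

text \<open>\<open>H\<close> is rebuilt from the core on the cover and the typed vertices
  \<open>W\<close>, whose edges \<open>E0\<close> all meet the cover, by adding the edges
  \<open>K\<close> that miss the cover and then the isolated vertices \<open>I\<close>. Each
  addition multiplies the count by an explicit factor.\<close>

lemma card_edge_inj_homs_placements:
  fixes s :: "nat \<Rightarrow> 'a" and X :: "'b set"
  assumes H: "simple_graph (V, E)" and G: "simple_graph (X, F)" and s: "inj_on s {..<c}"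
    and cover: "weak_vertex_cover (V, E) (s ` {..<c})"
    and M: "card V < M" "card X < M" and B: "B = 2 ^ (card X * card (types c) + 1)"
    and m: "m = card {e \<in> E. e \<inter> s ` {..<c} = {}}"
    and q: "q = card {w \<in> V. w \<notin> s ` {..<c} \<and> (\<forall>e\<in>E. w \<notin> e)}"
  shows "card (edge_inj_homs (V, E) (X, F)) =
    (\<Sum>\<psi>\<in>{..<c} \<rightarrow>\<^sub>E X. placement_count M B V E X F s c \<psi>) *
    (2 ^ m * (\<Prod>i<m. card F - (card E - m) - i)) * card X ^ q"
proof -
  let ?S = "s ` {..<c}"
  let ?\<tau> = "cover_type E s c" and ?SS = "cover_pairs E s c"
  define W where "W = {w \<in> V. w \<notin> ?S \<and> ?\<tau> w \<noteq> {}}"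
  define K where "K = {e \<in> E. e \<inter> ?S = {}}"
  define I where "I = {w \<in> V. w \<notin> ?S \<and> (\<forall>e\<in>E. w \<notin> e)}"
  define E0 where "E0 = E - K"
  have fin: "finite V" "finite X" "finite E" "finite W" "finite K" "finite I"
    using H G finite_edges[OF H] unfolding simple_graph_def W_def K_def I_def by auto
  have S: "?S \<subseteq> V" and cov: "\<And>e e'. e \<in> E \<Longrightarrow> e' \<in> E \<Longrightarrow> e' \<noteq> e \<Longrightarrow> e \<inter> ?S = {} \<Longrightarrow> e \<inter> e' = {}"
    using cover unfolding weak_vertex_cover_def by auto
  have edge: "e \<subseteq> V" "card e = 2" if "e \<in> E" for e using H that unfolding simple_graph_def by auto
  \<comment> \<open>A vertex of \<open>W\<close> has an edge to the cover. If it also lay on an edge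
    missing the cover, that edge would have another edge incident to it, against the weak cover
    property.\<close>
  have KW: "e \<inter> (?S \<union> W) = {}" if "e \<in> K" for e
  proof -
    have "w \<notin> e" if w: "w \<in> W" for w
    proof
      assume "w \<in> e"
      obtain j where j: "j < c" "{w, s j} \<in> E" using w unfolding W_def cover_type_def by auto
      have "{w, s j} \<noteq> e" using \<open>e \<in> K\<close> j(1) unfolding K_def by auto
      then show False using cov[of e "{w, s j}"] \<open>e \<in> K\<close> \<open>w \<in> e\<close> j(2) unfolding K_def by auto
    qed
    then show ?thesis using that unfolding K_def by auto
  qed
  \<comment> \<open>One end is in the cover; the other is in the cover too, or has a neighbour there
    and hence a nonempty type.\<close>
  have other: "\<exists>u v. e = {u, v} \<and> u \<noteq> v \<and> u \<in> ?S \<and> v \<in> ?S \<union> W" if "e \<in> E0" for e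
  proof -
    have e: "e \<in> E" "e \<inter> ?S \<noteq> {}" using that unfolding E0_def K_def by auto
    obtain a b where ab: "e = {a, b}" "a \<noteq> b" using edge[OF e(1)] by (auto simp: card_2_iff)
    have *: "\<exists>u v. e = {u, v} \<and> u \<noteq> v \<and> u \<in> ?S \<and> v \<in> ?S \<union> W" if ab: "e = {a, b}" "a \<noteq> b" "a \<in> ?S" for a b
    proof -
      obtain j where j: "j < c" "a = s j" using ab(3) by auto
      have "b \<in> V" using edge(1)[OF e(1)] ab by auto
      moreover have "j \<in> ?\<tau> b" using j e(1) ab unfolding cover_type_def by (simp add: insert_commute)
      ultimately have "b \<in> ?S \<union> W" unfolding W_def by auto
      then show ?thesis using ab by blast
    qed
    show ?thesis using *[OF ab] *[of b a] ab e(2) by (auto simp: insert_commute)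
  qed
  have E0: "E0 = slot_edge id s ` slots ?SS (graph_on W ?\<tau>)"
  proof (intro equalityI subsetI)
    fix e assume e: "e \<in> E0"
    then obtain u v where uv: "e = {u, v}" "u \<noteq> v" "u \<in> ?S" "v \<in> ?S \<union> W" using other by blast
    then obtain i where i: "u = s i" "i < c" by auto
    have eE: "{s i, v} \<in> E" "{v, s i} \<in> E" using e uv i unfolding E0_def by (auto simp: insert_commute)
    show "e \<in> slot_edge id s ` slots ?SS (graph_on W ?\<tau>)"
    proof (cases "v \<in> ?S")
      case True
      then obtain j where j: "v = s j" "j < c" by auto
      then consider "i < j" | "j < i" using uv i by (metis nat_neq_iff)
      then show ?thesis
      proof cases
        case 1
        then show ?thesis using i j uv eE unfolding slots_def cover_pairs_def
          by (intro image_eqI[of _ _ "Inl (i, j)"]) auto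
      next
        case 2
        then show ?thesis using i j uv eE unfolding slots_def cover_pairs_def
          by (intro image_eqI[of _ _ "Inl (j, i)"]) auto
      qed
    next
      case False
      then have "v \<in> W" using uv by auto
      moreover have "i \<in> ?\<tau> v" using i eE unfolding cover_type_def by simp
      ultimately show ?thesis using i uv unfolding slots_def graph_on_def
        by (intro image_eqI[of _ _ "Inr ((v, ?\<tau> v), i)"]) auto
    qed
  next
    fix e assume "e \<in> slot_edge id s ` slots ?SS (graph_on W ?\<tau>)"
    then obtain p where p: "p \<in> slots ?SS (graph_on W ?\<tau>)" "e = slot_edge id s p" by auto
    from p(1) have "e \<in> E \<and> e \<inter> ?S \<noteq> {}"
      by (cases rule: slotsE) (use p(2) in \<open>auto simp: cover_pairs_def cover_type_def graph_on_def\<close>)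
    then show "e \<in> E0" unfolding E0_def K_def by auto
  qed
  have simple0: "simple_graph (?S \<union> W, E0)"
    unfolding simple_graph_def using fin other edge E0_def by (fastforce)
  have KE: "K \<subseteq> E" unfolding K_def by auto
  have EK: "E0 \<union> K = E" unfolding E0_def using KE by auto
  have V: "V = (?S \<union> W \<union> \<Union>K) \<union> I" and I: "I \<inter> (?S \<union> W \<union> \<Union>K) = {}"
  proof -
    have "v \<in> ?S \<union> W \<union> \<Union>K \<union> I" if v: "v \<in> V" for v
    proof (cases "v \<in> ?S \<or> v \<in> I")
      case False
      then obtain e where e: "e \<in> E" "v \<in> e" using v unfolding I_def by auto
      show ?thesis
      proof (cases "e \<in> K")
        case True
        then show ?thesis using e by auto
      next
        case nK: False
        then have "e \<in> E0" using e unfolding E0_def by simp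
        then show ?thesis using other[of e] e by auto
      qed
    qed auto
    then have "V \<subseteq> (?S \<union> W \<union> \<Union>K) \<union> I" by (rule subsetI)
    moreover have "W \<subseteq> V" "I \<subseteq> V" unfolding W_def I_def by auto
    moreover have "\<Union>K \<subseteq> V" using KE edge(1) by (intro Union_least) auto
    ultimately show "V = (?S \<union> W \<union> \<Union>K) \<union> I" using S by (intro equalityI Un_least)
    show "I \<inter> (?S \<union> W \<union> \<Union>K) = {}" using KE unfolding W_def I_def cover_type_def by auto
  qed
  have disj: "disjoint K" using cov unfolding K_def disjoint_def by auto
  have cardK: "\<forall>e\<in>K. card e = 2 \<and> e \<inter> (?S \<union> W) = {}" using KW KE edge(2) by auto
  have simple1: "simple_graph (?S \<union> W \<union> \<Union>K, E0 \<union> K)"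
  proof -
    have "finite (?S \<union> W \<union> \<Union>K)" using fin(1) by (rule finite_subset[rotated]) (use V in auto)
    then show ?thesis using simple0 cardK unfolding simple_graph_def by auto
  qed
  have "card (edge_inj_homs (V, E) (X, F)) =
      card (edge_inj_homs (?S \<union> W \<union> \<Union>K, E0 \<union> K) (X, F)) * card X ^ q"
    using card_edge_inj_homs_add_vertices[OF simple1 fin(6) I, of "(X, F)"] V EK q unfolding I_def by simp
  also have "card (edge_inj_homs (?S \<union> W \<union> \<Union>K, E0 \<union> K) (X, F)) =
      card (edge_inj_homs (?S \<union> W, E0) (X, F)) * (2 ^ m * (\<Prod>i<m. card F - card E0 - i))"
    using card_edge_inj_homs_add_matching[OF simple0 G fin(5) cardK disj] m unfolding K_def by simp
  also have "card E0 = card E - m"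
    unfolding E0_def using fin KE m by (simp add: card_Diff_subset K_def)
  also have "card (edge_inj_homs (?S \<union> W, E0) (X, F)) = (\<Sum>\<psi>\<in>{..<c} \<rightarrow>\<^sub>E X.
      card {f \<in> W \<rightarrow>\<^sub>E X. inj_on (\<lambda>w. (f w, ?\<tau> w)) W \<and> admissible F ?SS id \<psi> ((\<lambda>w. (f w, ?\<tau> w)) ` W)})"
    by (rule card_edge_inj_homs_cover[OF s _ _ _ _ fin(4,2) simple0 E0])
      (auto simp: W_def cover_pairs_def cover_type_def)
  also have "\<dots> = (\<Sum>\<psi>\<in>{..<c} \<rightarrow>\<^sub>E X. placement_count M B V E X F s c \<psi>)"
  proof (rule sum.cong[OF refl])
    fix \<psi> assume \<psi>: "\<psi> \<in> {..<c} \<rightarrow>\<^sub>E X"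
    have k: "card {w \<in> W. ?\<tau> w = \<theta>} = type_count V E s c \<theta>" if "\<theta> \<in> types c" for \<theta>
      unfolding type_count_def by (rule arg_cong[of _ _ card]) (use that in \<open>auto simp: W_def\<close>)
    have kM: "type_count V E s c \<theta> < M" for \<theta>
    proof -
      have "type_count V E s c \<theta> \<le> card V" unfolding type_count_def by (rule card_mono[OF fin(1)]) auto
      then show ?thesis using M by simp
    qed
    have pairs: "?SS \<subseteq> {(i, j). i < j \<and> j < c}" unfolding cover_pairs_def by auto
    have inj: "inj_on set_encode (types c)"
      by (rule inj_on_subset[OF inj_on_set_encode]) (auto intro: finite_subset)
    have "card {f \<in> W \<rightarrow>\<^sub>E X. inj_on (\<lambda>w. (f w, ?\<tau> w)) W \<and> admissible F ?SS id \<psi> ((\<lambda>w. (f w, ?\<tau> w)) ` W)} =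
        (\<Prod>\<theta>\<in>types c. fact (card {w \<in> W. ?\<tau> w = \<theta>})) * card {Q \<in> Pow (X \<times> types c).
          admissible F ?SS id \<psi> Q \<and> (\<forall>\<theta>\<in>types c. card {x. (x, \<theta>) \<in> Q} = card {w \<in> W. ?\<tau> w = \<theta>})}"
      using fin by (intro card_maps_by_graph) (auto simp: W_def cover_type_def)
    also have "{Q \<in> Pow (X \<times> types c).
          admissible F ?SS id \<psi> Q \<and> (\<forall>\<theta>\<in>types c. card {x. (x, \<theta>) \<in> Q} = card {w \<in> W. ?\<tau> w = \<theta>})} =
        {Q \<in> Pow (X \<times> types c).
          admissible F ?SS id \<psi> Q \<and> (\<forall>\<theta>\<in>types c. card {x. (x, \<theta>) \<in> Q} = type_count V E s c \<theta>)}"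
      using k by auto
    also have "card \<dots> =
        (\<Sum>Q\<in>Pow (X \<times> types c). of_bool (admissible F ?SS id \<psi> Q) * (\<Prod>(x, \<theta>)\<in>Q. B ^ (M ^ set_encode \<theta>))) div
          B ^ (\<Sum>\<theta>\<in>types c. type_count V E s c \<theta> * M ^ set_encode \<theta>) mod B"
      using fin kM M B inj by (intro card_fibres_extraction) auto
    also have "(\<Sum>Q\<in>Pow (X \<times> types c). of_bool (admissible F ?SS id \<psi> Q) * (\<Prod>(x, \<theta>)\<in>Q. B ^ (M ^ set_encode \<theta>))) =
        generating_value c X F ?SS (\<lambda>\<theta>. B ^ (M ^ set_encode \<theta>)) \<psi>"
      using \<psi> by (intro sum_admissible[OF pairs fin(2)]) auto
    also have "(\<Prod>\<theta>\<in>types c. fact (card {w \<in> W. ?\<tau> w = \<theta>})) = (\<Prod>\<theta>\<in>types c. fact (type_count V E s c \<theta>) :: nat)"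
      using k by (intro prod.cong) auto
    finally show "card {f \<in> W \<rightarrow>\<^sub>E X. inj_on (\<lambda>w. (f w, ?\<tau> w)) W \<and>
        admissible F ?SS id \<psi> ((\<lambda>w. (f w, ?\<tau> w)) ` W)} = placement_count M B V E X F s c \<psi>"
      unfolding placement_count_def .
  qed
  finally show ?thesis .
qed

subsection \<open>Encodings\<close>

text \<open>The \<open>c\<close> base-\<open>n\<close> digits of a loop counter enumerate the maps
  from \<open>{..<c}\<close> to \<open>{..<n}\<close>; both covers and placements are coded this
  way. Extensionality makes it match the function space used for placements.\<close>

definition digits :: "nat \<Rightarrow> nat \<Rightarrow> nat \<Rightarrow> nat \<Rightarrow> nat" where
  "digits c n a = (\<lambda>j\<in>{..<c}. a div n ^ j mod n)"

lemma digits_eqD: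
  fixes a b n :: nat
  assumes "a < n ^ c" "b < n ^ c" "\<And>j. j < c \<Longrightarrow> a div n ^ j mod n = b div n ^ j mod n"
  shows "a = b"
  using assms
proof (induction c arbitrary: a b)
  case (Suc c)
  have "a div n = b div n"
  proof (rule Suc.IH)
    show "a div n < n ^ c" "b div n < n ^ c"
      using Suc.prems(1,2) by (simp_all add: less_mult_imp_div_less mult.commute)
    show "a div n div n ^ j mod n = b div n div n ^ j mod n" if "j < c" for j
      using Suc.prems(3)[of "Suc j"] that by (simp add: div_mult2_eq)
  qed
  moreover have "a mod n = b mod n" using Suc.prems(3)[of 0] by simp
  ultimately show ?case by (metis div_mult_mod_eq)
qed simp

lemma bij_betw_digits: "bij_betw (digits c n) {..<n ^ c} ({..<c} \<rightarrow>\<^sub>E {..<n})"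
proof -
  have "inj_on (digits c n) {..<n ^ c}"
  proof (rule inj_onI)
    fix a b assume ab: "a \<in> {..<n ^ c}" "b \<in> {..<n ^ c}" "digits c n a = digits c n b"
    have "a div n ^ j mod n = b div n ^ j mod n" if "j < c" for j
      using fun_cong[OF ab(3), of j] that by (simp add: digits_def)
    then show "a = b" using ab by (intro digits_eqD[of a n c b]) auto
  qed
  moreover have "digits c n ` {..<n ^ c} = {..<c} \<rightarrow>\<^sub>E {..<n}"
  proof (rule card_subset_eq)
    show "finite ({..<c} \<rightarrow>\<^sub>E {..<n})" by (simp add: finite_PiE)
    show "digits c n ` {..<n ^ c} \<subseteq> {..<c} \<rightarrow>\<^sub>E {..<n}"
    proof (rule image_subsetI)
      fix a assume "a \<in> {..<n ^ c}"
      \<comment> \<open>Remainders are below \<open>n\<close> only for positive \<open>n\<close>; a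
        code below \<open>n ^ c\<close> with \<open>c > 0\<close> forces this.\<close>
      then have "n > 0" if "c > 0" using that by (cases n) (auto simp: power_0_left)
      then show "digits c n a \<in> {..<c} \<rightarrow>\<^sub>E {..<n}" by (auto simp: digits_def)
    qed
    show "card (digits c n ` {..<n ^ c}) = card ({..<c} \<rightarrow>\<^sub>E {..<n})"
      using calculation by (simp add: card_image card_funcsetE)
  qed
  ultimately show ?thesis unfolding bij_betw_def by blast
qed

text \<open>The length of the run of ones starting at position \<open>a\<close>, written as a number
  of all-one prefixes so that it uses only sums and bounded quantifiers.\<close>

definition unary_at :: "bool list \<Rightarrow> nat \<Rightarrow> nat" where
  "unary_at x a = (\<Sum>i<length x. of_bool (\<forall>j<length x. j \<le> i \<longrightarrow> input_bit x (a + j)))"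

definition edges_at :: "bool list \<Rightarrow> nat \<Rightarrow> nat set set" where
  "edges_at x a = (let n = unary_at x a in
    {{u, v} | u v. u < n \<and> v < n \<and> input_bit x (a + n + 1 + u * n + v)})"

lemma nth_concat_map:
  assumes "u < length xs" "v < m" "\<And>y. y \<in> set xs \<Longrightarrow> length (f y) = m"
  shows "u * m + v < length (concat (map f xs)) \<and> concat (map f xs) ! (u * m + v) = f (xs ! u) ! v"
  using assms
proof (induction xs arbitrary: u)
  case (Cons y xs)
  show ?case
  proof (cases u)
    case 0
    then show ?thesis using Cons.prems by (simp add: nth_append)
  next
    case (Suc k)
    have "k * m + v < length (concat (map f xs)) \<and> concat (map f xs) ! (k * m + v) = f (xs ! k) ! v"
      using Cons.prems Suc by (intro Cons.IH) auto
    then show ?thesis using Suc Cons.prems(3)[of y] by (simp add: nth_append)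
  qed
qed simp

lemma length_encode_graph: "length (encode_graph vs G) = length vs + 1 + length vs * length vs"
  unfolding encode_graph_def by (simp add: length_concat comp_def sum_list_triv)

lemma encode_graph_nth:
  shows "i < length vs \<Longrightarrow> encode_graph vs G ! i"
    and "\<not> encode_graph vs G ! length vs"
    and "u < length vs \<Longrightarrow> v < length vs \<Longrightarrow>
      encode_graph vs G ! (length vs + 1 + u * length vs + v) \<longleftrightarrow> {vs ! u, vs ! v} \<in> edges G"
proof -
  let ?m = "concat (map (\<lambda>u. map (\<lambda>v. {u, v} \<in> edges G) vs) vs)"
  show "i < length vs \<Longrightarrow> encode_graph vs G ! i" "\<not> encode_graph vs G ! length vs"
    unfolding encode_graph_def by (simp_all add: nth_append)
  assume uv: "u < length vs" "v < length vs"
  have "encode_graph vs G ! (length vs + 1 + u * length vs + v) = ?m ! (u * length vs + v)"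
    unfolding encode_graph_def by (simp add: nth_append)
  also have "\<dots> = map (\<lambda>v. {vs ! u, v} \<in> edges G) vs ! v"
    using nth_concat_map[OF uv, of "\<lambda>u. map (\<lambda>v. {u, v} \<in> edges G) vs"] by simp
  finally show "encode_graph vs G ! (length vs + 1 + u * length vs + v) \<longleftrightarrow> {vs ! u, vs ! v} \<in> edges G"
    using uv by simp
qed

text \<open>The graph read off at position \<open>a\<close> lives on an initial segment of the
  naturals, and indexing into \<open>vs\<close> is an isomorphism onto \<open>G\<close>. The
  surrounding \<open>ys\<close> and \<open>zs\<close> let it serve both graphs of the input.\<close>

lemma decode_graph:
  fixes G :: "'a ugraph"
  assumes "x = ys @ encode_graph vs G @ zs" "a = length ys" "distinct vs" "set vs = verts G" "simple_graph G"
  shows "unary_at x a = length vs"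
    and "bij_betw ((!) vs) {..<unary_at x a} (verts G)"
    and "edges G = (`) ((!) vs) ` edges_at x a"
    and "simple_graph ({..<unary_at x a}, edges_at x a)"
proof -
  let ?n = "length vs"
  have len: "length x = a + (?n + 1 + ?n * ?n) + length zs"
    using assms(1,2) length_encode_graph[of vs G] by simp
  have bit: "input_bit x (a + i) = encode_graph vs G ! i" if "i < ?n + 1 + ?n * ?n" for i
    using that len assms(1,2) length_encode_graph[of vs G] by (simp add: input_bit_def nth_append)
  have all: "(\<forall>j<length x. j \<le> i \<longrightarrow> input_bit x (a + j)) \<longleftrightarrow> i < ?n" if "i < length x" for i
  proof
    assume *: "\<forall>j<length x. j \<le> i \<longrightarrow> input_bit x (a + j)"
    show "i < ?n"
    proof (rule ccontr)
      assume "\<not> i < ?n"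
      then have "input_bit x (a + ?n)" using * that by simp
      then show False using bit[of ?n] encode_graph_nth(2)[of vs G] by simp
    qed
  next
    assume "i < ?n"
    then show "\<forall>j<length x. j \<le> i \<longrightarrow> input_bit x (a + j)"
      using bit encode_graph_nth(1)[of _ vs G] by simp
  qed
  have "unary_at x a = (\<Sum>i<length x. of_bool (i < ?n))"
    unfolding unary_at_def by (rule sum.cong) (use all in auto)
  also have "\<dots> = card ({..<length x} \<inter> {i. i < ?n})" by simp
  also have "{..<length x} \<inter> {i. i < ?n} = {..<?n}" using len by auto
  finally show n: "unary_at x a = ?n" by simp
  show bij: "bij_betw ((!) vs) {..<unary_at x a} (verts G)"
    using assms(3,4) n by (simp add: bij_betw_nth)
  have adj: "input_bit x (a + ?n + 1 + u * ?n + v) \<longleftrightarrow> {vs ! u, vs ! v} \<in> edges G" if "u < ?n" "v < ?n" for u v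
  proof -
    have "Suc u * ?n \<le> ?n * ?n" using that by (intro mult_le_mono1) simp
    then have "u * ?n + v < ?n * ?n" using that by simp
    then show ?thesis
      using bit[of "?n + 1 + u * ?n + v"] encode_graph_nth(3)[OF that, of G] by (simp add: add.assoc)
  qed
  have E: "edges_at x a = {{u, v} | u v. u < ?n \<and> v < ?n \<and> {vs ! u, vs ! v} \<in> edges G}"
    unfolding edges_at_def n Let_def using adj by blast
  show "edges G = (`) ((!) vs) ` edges_at x a"
  proof (intro equalityI subsetI)
    fix e assume e: "e \<in> edges G"
    then obtain y z where yz: "e = {y, z}" using assms(5) by (auto simp: simple_graph_def card_2_iff)
    then have "y \<in> set vs" "z \<in> set vs" using e assms(4,5) by (auto simp: simple_graph_def)
    then obtain u v where "u < ?n" "v < ?n" "y = vs ! u" "z = vs ! v" by (metis in_set_conv_nth)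
    then show "e \<in> (`) ((!) vs) ` edges_at x a"
      using e yz unfolding E by (intro image_eqI[of _ _ "{u, v}"]) auto
  qed (auto simp: E)
  show "simple_graph ({..<unary_at x a}, edges_at x a)"
    unfolding simple_graph_def n E using assms(5) unfolding simple_graph_def
    by (auto simp: card_2_iff')
qed

subsection \<open>The answer as a function computable in polynomial time\<close>

lemma ptime_pred_Collect_card:
  assumes "ptime b" "bounded_value b" "v > 0" "ptime_pred (\<lambda>x \<rho>. p x \<rho> (\<rho> v))"
    and "\<And>x \<rho> i j. p x (\<rho>(v := j)) i = p x \<rho> i"
  shows "ptime (\<lambda>x \<rho>. card {i. i < b x \<rho> \<and> p x \<rho> i})"
proof -
  have "ptime (\<lambda>x \<rho>. \<Sum>i<b x \<rho>. of_bool (p x \<rho> i))"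
    using assms by (intro ptime_sum[where v = v]) auto
  moreover have "(\<Sum>i<n. of_bool (P i)) = card {i. i < n \<and> P i}" for n and P :: "nat \<Rightarrow> bool"
    by (simp add: Int_def lessThan_def)
  ultimately show ?thesis by simp
qed

lemma bounded_value_unary_at: "bounded_value (\<lambda>x \<rho>. unary_at x (a x))"
proof (rule bounded_valueI[OF pbound_id])
  fix x \<rho>
  have "unary_at x (a x) \<le> (\<Sum>i<length x. 1)" unfolding unary_at_def by (rule sum_mono) simp
  then show "unary_at x (a x) \<le> length x" by simp
qed

lemma bounded_value_length: "bounded_value (\<lambda>x \<rho>. length x)"
  by (rule bounded_valueI[OF pbound_id]) simp

lemma ptime_unary_at:
  assumes "ptime (\<lambda>x \<rho>. a x)"
  shows "ptime (\<lambda>x \<rho>. unary_at x (a x))"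
  unfolding unary_at_def
\<comment> \<open>Reusing variables 6 and 2 is harmless: the result does not depend on the
  environment, and loops restore their counters.\<close>
proof (rule ptime_sum[where v = 6])
  show "ptime (\<lambda>x \<rho>. of_bool (\<forall>j<length x. j \<le> \<rho> 6 \<longrightarrow> input_bit x (a x + j)))"
  proof (rule ptime_pred_all_less[where v = 2])
    show "ptime_pred (\<lambda>x \<rho>. \<rho> 2 \<le> \<rho> 6 \<longrightarrow> input_bit x (a x + \<rho> 2))"
      unfolding not_less[symmetric]
      by (intro ptime_pred_imp ptime_pred_not ptime_pred_less ptime_bit ptime_add ptime_var assms)
  qed (auto intro: ptime_length bounded_value_length)
qed (auto intro: ptime_length bounded_value_length)

text \<open>On an arbitrary bit string the matrix need not be symmetric, and \<open>edges_at\<close>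
  accepts an unordered pair if either entry is set; hence both entries are tested.\<close>

lemma ptime_pred_edges_at:
  assumes "ptime (\<lambda>x \<rho>. a x)" "ptime f" "ptime g"
  shows "ptime_pred (\<lambda>x \<rho>. {f x \<rho>, g x \<rho>} \<in> edges_at x (a x))"
proof -
  let ?n = "\<lambda>x. unary_at x (a x)"
  let ?b = "\<lambda>x u v. input_bit x (a x + ?n x + 1 + u * ?n x + v)"
  have n: "ptime (\<lambda>x \<rho>. ?n x)" by (rule ptime_unary_at[OF assms(1)])
  have b: "ptime_pred (\<lambda>x \<rho>. ?b x (p x \<rho>) (q x \<rho>))" if "ptime p" "ptime q" for p q
    by (intro ptime_bit ptime_add ptime_mult ptime_const n assms that)
  have "ptime_pred (\<lambda>x \<rho>. f x \<rho> < ?n x \<and> g x \<rho> < ?n x \<and>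
      (?b x (f x \<rho>) (g x \<rho>) \<or> ?b x (g x \<rho>) (f x \<rho>)))"
    by (intro ptime_pred_conj ptime_pred_disj ptime_pred_less n assms b)
  moreover have "{u, v} \<in> edges_at x (a x) \<longleftrightarrow> u < ?n x \<and> v < ?n x \<and> (?b x u v \<or> ?b x v u)" for x u v
    unfolding edges_at_def Let_def by (auto simp: doubleton_eq_iff)
  ultimately show ?thesis by simp
qed

text \<open>Variable 6 holds the code of the cover, variable 2 that of its placement; the encoding of \<open>G\<close>
  starts at position \<open>gpos x\<close>.\<close>

definition gpos :: "bool list \<Rightarrow> nat" where
  "gpos x = unary_at x 0 + 1 + unary_at x 0 * unary_at x 0"
abbreviation hverts :: "bool list \<Rightarrow> nat" where "hverts x \<equiv> unary_at x 0"
abbreviation hedges :: "bool list \<Rightarrow> nat set set" where "hedges x \<equiv> edges_at x 0"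
abbreviation gverts :: "bool list \<Rightarrow> nat" where "gverts x \<equiv> unary_at x (gpos x)"
abbreviation gedges :: "bool list \<Rightarrow> nat set set" where "gedges x \<equiv> edges_at x (gpos x)"
abbreviation cov :: "nat \<Rightarrow> bool list \<Rightarrow> nat \<Rightarrow> nat \<Rightarrow> nat" where "cov c x a \<equiv> digits c (hverts x) a"
abbreviation plc :: "nat \<Rightarrow> bool list \<Rightarrow> nat \<Rightarrow> nat \<Rightarrow> nat" where "plc c x b \<equiv> digits c (gverts x) b"

lemma ptime_hverts: "ptime (\<lambda>x \<rho>. hverts x)"
  by (intro ptime_unary_at ptime_const)

lemma ptime_gpos: "ptime (\<lambda>x \<rho>. gpos x)"
  unfolding gpos_def by (intro ptime_add ptime_mult ptime_const ptime_hverts)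

lemma ptime_gverts: "ptime (\<lambda>x \<rho>. gverts x)"
  by (intro ptime_unary_at ptime_gpos)

lemmas bounded_verts = bounded_value_unary_at[of "\<lambda>_. 0"] bounded_value_unary_at[of gpos]

lemmas ptime_pred_hedges = ptime_pred_edges_at[OF ptime_const[of 0]]
lemmas ptime_pred_gedges = ptime_pred_edges_at[OF ptime_gpos]

lemma ptime_digits: "ptime (\<lambda>x \<rho>. n x) \<Longrightarrow> ptime f \<Longrightarrow> ptime (\<lambda>x \<rho>. digits c (n x) (f x \<rho>) j)"
proof (cases "j < c")
  case True
  assume "ptime (\<lambda>x \<rho>. n x)" "ptime f"
  then have "ptime (\<lambda>x \<rho>. f x \<rho> div n x ^ j mod n x)"
    by (intro ptime_mod ptime_div ptime_power_const)
  then show ?thesis using True by (simp add: digits_def)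
qed (simp add: digits_def ptime_const)

lemmas ptime_cov = ptime_digits[OF ptime_hverts ptime_var]
lemmas ptime_plc = ptime_digits[OF ptime_gverts ptime_var]

lemma ptime_pred_in_cov:
  assumes "ptime f"
  shows "ptime_pred (\<lambda>x \<rho>. f x \<rho> \<in> cov c x (\<rho> 6) ` {..<c})"
proof -
  have "ptime_pred (\<lambda>x \<rho>. \<exists>j\<in>{..<c}. f x \<rho> = cov c x (\<rho> 6) j)"
    by (intro ptime_pred_Bex ptime_pred_eq ptime_cov assms) simp
  then show ?thesis by (simp add: image_iff)
qed

text \<open>Each edge is counted at its representation \<open>{u, v}\<close> with
  \<open>v \<le> u\<close>. Equality is included because a string that encodes no graph may yield
  loops.\<close>

lemma ptime_card_edges:
  assumes a: "ptime (\<lambda>x \<rho>. a x)" and p: "ptime_pred (\<lambda>x \<rho>. p x (\<rho> 6) {\<rho> 3, \<rho> 4})"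
  shows "ptime (\<lambda>x \<rho>. card {e \<in> edges_at x (a x). p x (\<rho> 6) e})"
proof -
  let ?n = "\<lambda>x. unary_at x (a x)"
  let ?P = "\<lambda>x r u v. v \<le> u \<and> {u, v} \<in> edges_at x (a x) \<and> p x r {u, v}"
  have "ptime (\<lambda>x \<rho>. \<Sum>u<?n x. card {v. v < ?n x \<and> ?P x (\<rho> 6) u v})"
  proof (rule ptime_sum[where v = 3])
    show "ptime (\<lambda>x \<rho>. card {v. v < ?n x \<and> ?P x (\<rho> 6) (\<rho> 3) v})"
      by (rule ptime_pred_Collect_card[where v = 4])
        (auto intro!: ptime_unary_at a bounded_value_unary_at ptime_pred_conj ptime_pred_edges_at p ptime_var
          ptime_pred_not[OF ptime_pred_less, unfolded not_less])
  qed (auto intro: ptime_unary_at a bounded_value_unary_at)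
  moreover have "(\<Sum>u<?n x. card {v. v < ?n x \<and> ?P x r u v}) = card {e \<in> edges_at x (a x). p x r e}" for x r
  proof -
    have "bij_betw (\<lambda>(u, v). {u, v}) (SIGMA u:{..<?n x}. {v. v < ?n x \<and> ?P x r u v})
        {e \<in> edges_at x (a x). p x r e}"
      unfolding bij_betw_def
    proof
      show "inj_on (\<lambda>(u, v). {u, v}) (SIGMA u:{..<?n x}. {v. v < ?n x \<and> ?P x r u v})"
        by (auto simp: inj_on_def doubleton_eq_iff)
      show "(\<lambda>(u, v). {u, v}) ` (SIGMA u:{..<?n x}. {v. v < ?n x \<and> ?P x r u v}) =
          {e \<in> edges_at x (a x). p x r e}"
      proof (intro equalityI subsetI)
        fix e assume e: "e \<in> {e \<in> edges_at x (a x). p x r e}"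
        then obtain u v where "e = {u, v}" "u < ?n x" "v < ?n x" unfolding edges_at_def Let_def by auto
        then have "e = {max u v, min u v}" "max u v < ?n x" "min u v < ?n x" by (auto simp: max_def min_def)
        then show "e \<in> (\<lambda>(u, v). {u, v}) ` (SIGMA u:{..<?n x}. {v. v < ?n x \<and> ?P x r u v})"
          using e by (intro image_eqI[of _ _ "(max u v, min u v)"]) auto
      qed auto
    qed
    from bij_betw_same_card[OF this] show ?thesis by (subst card_SigmaI[symmetric]) auto
  qed
  ultimately show ?thesis by simp
qed

lemma ptime_type_count:
  "ptime (\<lambda>x \<rho>. type_count {..<hverts x} (hedges x) (cov c x (\<rho> 6)) c \<theta>)"
proof (cases "\<theta> \<subseteq> {..<c}")
  case True
  let ?p = "\<lambda>x r w. w \<notin> cov c x r ` {..<c} \<and> (\<forall>j\<in>{..<c}. {w, cov c x r j} \<in> hedges x \<longleftrightarrow> j \<in> \<theta>)"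
  have "ptime (\<lambda>x \<rho>. card {w. w < hverts x \<and> ?p x (\<rho> 6) w})"
  proof (rule ptime_pred_Collect_card[where v = 3])
    show "ptime_pred (\<lambda>x \<rho>. ?p x (\<rho> 6) (\<rho> 3))"
      by (intro ptime_pred_conj ptime_pred_not ptime_pred_in_cov ptime_pred_Ball ptime_pred_iff
        ptime_pred_hedges ptime_pred_const ptime_var ptime_cov) simp
  qed (auto intro: ptime_hverts bounded_verts)
  moreover have "{w. w < hverts x \<and> ?p x r w} =
      {w \<in> {..<hverts x}. w \<notin> cov c x r ` {..<c} \<and> cover_type (hedges x) (cov c x r) c w = \<theta>}" for x r
    using True unfolding cover_type_def by fastforce
  ultimately show ?thesis unfolding type_count_def by simp
next
  case False
  then have "cover_type E s c w \<noteq> \<theta>" for E s and w :: nat unfolding cover_type_def by auto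
  then show ?thesis unfolding type_count_def by (simp add: ptime_const)
qed

lemma bounded_type_count:
  "bounded_value (\<lambda>x \<rho>. type_count {..<hverts x} (hedges x) (cov c x (\<rho> 6)) c \<theta>)"
proof -
  have "type_count {..<n} E s c \<theta> \<le> n" for n E s
    unfolding type_count_def using card_mono[of "{..<n}" "{w \<in> {..<n}. w \<notin> s ` {..<c} \<and> cover_type E s c w = \<theta>}"] by auto
  then show ?thesis using bounded_verts(1) unfolding bounded_value_def by (meson le_trans)
qed

lemma ptime_fact:
  assumes "ptime f" "bounded_value f" "\<And>x \<rho> i. f x (\<rho>(5 := i)) = f x \<rho>"
  shows "ptime (\<lambda>x \<rho>. fact (f x \<rho>))"
proof -
  have "ptime (\<lambda>x \<rho>. \<Prod>i<f x \<rho>. Suc i)"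
  proof (rule ptime_prod[where v = 5])
    show "ptime (\<lambda>x \<rho>. Suc (\<rho> 5))"
      using ptime_add[OF ptime_var ptime_const[of 1]] by simp
  qed (use assms in auto)
  moreover have "fact n = (\<Prod>i<n. Suc i)" for n
    by (simp add: fact_prod_Suc atLeast0LessThan)
  ultimately show ?thesis by simp
qed

text \<open>The slots of the edges inside the cover depend on the input, hence the restriction of the
  finitely many possible slots by the predicate \<open>active\<close>.\<close>

definition active :: "'a set set \<Rightarrow> (nat \<Rightarrow> 'a) \<Rightarrow> 'x slot \<Rightarrow> bool" where
  "active E s p = (case p of Inl (i, j) \<Rightarrow> {s i, s j} \<in> E | Inr _ \<Rightarrow> True)"

definition slot_left :: "('x \<Rightarrow> 'b) \<Rightarrow> (nat \<Rightarrow> 'b) \<Rightarrow> 'x slot \<Rightarrow> 'b" where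
  "slot_left z \<psi> p = (case p of Inl (i, j) \<Rightarrow> \<psi> i | Inr ((x, \<theta>), j) \<Rightarrow> z x)"

definition slot_right :: "(nat \<Rightarrow> 'b) \<Rightarrow> 'x slot \<Rightarrow> 'b" where
  "slot_right \<psi> p = (case p of Inl (i, j) \<Rightarrow> \<psi> j | Inr ((x, \<theta>), j) \<Rightarrow> \<psi> j)"

lemma slot_edge_eq: "slot_edge z \<psi> p = {slot_left z \<psi> p, slot_right \<psi> p}"
  by (cases "(z, \<psi>, p)" rule: slot_edge.cases) (auto simp: slot_left_def slot_right_def)

text \<open>For fixed \<open>Q\<close> this is a Boolean combination of fixed shape: the quantifiers
  range over all conceivable slots, and the input enters only through adjacency tests and equalities
  of ends.\<close>

lemma admissible_cover_pairs:
  "admissible F (cover_pairs E s c) z \<psi> Q \<longleftrightarrow>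
    (\<forall>p\<in>slots {(i, j). i < j \<and> j < c} Q. active E s p \<longrightarrow> {slot_left z \<psi> p, slot_right \<psi> p} \<in> F \<and>
      (\<forall>q\<in>slots {(i, j). i < j \<and> j < c} Q - {p}. active E s q \<longrightarrow>
        \<not> (slot_left z \<psi> p = slot_left z \<psi> q \<and> slot_right \<psi> p = slot_right \<psi> q \<or>
           slot_left z \<psi> p = slot_right \<psi> q \<and> slot_right \<psi> p = slot_left z \<psi> q)))"
proof -
  have "slots (cover_pairs E s c) Q = {p \<in> slots {(i, j). i < j \<and> j < c} Q. active E s p}"
  proof (rule set_eqI)
    show "p \<in> slots (cover_pairs E s c) Q \<longleftrightarrow> p \<in> {p \<in> slots {(i, j). i < j \<and> j < c} Q. active E s p}" for p
      by (cases p) (auto simp: slots_def cover_pairs_def active_def image_iff split: prod.splits)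
  qed
  then show ?thesis
    unfolding admissible_def inj_on_def slot_edge_eq doubleton_eq_iff by blast
qed

lemma ptime_slot_ends:
  "ptime (\<lambda>x \<rho>. slot_left (plc c x (\<rho> 2)) (plc c x (\<rho> 2)) p)" "ptime (\<lambda>x \<rho>. slot_right (plc c x (\<rho> 2)) p)"
  by (cases p; simp add: slot_left_def slot_right_def split_def ptime_plc)+

lemma finite_pairs: "finite {(i :: nat, j). i < j \<and> j < c}"
  by (rule finite_subset[of _ "{..<c} \<times> {..<c}"]) auto

lemma finite_slots:
  assumes "finite SS" "finite Q" "\<And>x \<theta>. (x, \<theta>) \<in> Q \<Longrightarrow> finite \<theta>"
  shows "finite (slots SS Q)"
  unfolding slots_def using assms by (intro finite_UnI finite_imageI finite_SigmaI) auto

lemma ptime_admissible: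
  assumes Q: "Q \<subseteq> {..<c} \<times> types c"
  shows "ptime_pred (\<lambda>x \<rho>. admissible (gedges x) (cover_pairs (hedges x) (cov c x (\<rho> 6)) c)
    (plc c x (\<rho> 2)) (plc c x (\<rho> 2)) Q)"
proof -
  have "finite Q" using Q by (rule finite_subset) simp
  then have fin: "finite (slots {(i, j). i < j \<and> j < c} Q)"
    using Q by (intro finite_slots finite_pairs) (auto intro: finite_subset)
  have "ptime_pred (\<lambda>x \<rho>. active (hedges x) (cov c x (\<rho> 6)) p)" for p :: "nat slot"
  proof (cases p)
    case (Inl a)
    then show ?thesis by (cases a) (simp add: active_def ptime_pred_hedges ptime_cov)
  qed (simp add: active_def ptime_const)
  then show ?thesis
    unfolding admissible_cover_pairs
    by (intro ptime_pred_Ball ptime_pred_imp ptime_pred_conj ptime_pred_not ptime_pred_disj ptime_pred_eq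
      ptime_pred_gedges ptime_slot_ends finite_Diff fin)
qed

lemma ptime_first_positions:
  assumes "finite Q"
  shows "ptime_pred (\<lambda>x \<rho>. first_positions (plc c x (\<rho> 2)) Q)"
proof -
  have "first_positions \<psi> Q \<longleftrightarrow> (\<forall>p\<in>Q. \<forall>i\<in>{..<fst p}. \<not> \<psi> i = \<psi> (fst p))" for \<psi> :: "nat \<Rightarrow> nat"
    unfolding first_positions_def by auto
  then show ?thesis
    by (simp only:) (intro ptime_pred_Ball ptime_pred_not ptime_pred_eq ptime_plc assms finite_lessThan)
qed

lemma ptime_star:
  assumes "T \<subseteq> types c"
  shows "ptime_pred (\<lambda>x \<rho>. star (gedges x) (plc c x (\<rho> 2)) (\<rho> 3) T)"
proof -
  have fin: "finite T" using assms by (rule finite_subset) simp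
  have fin': "finite \<theta>" if "\<theta> \<in> T" for \<theta> using that assms by (auto intro: finite_subset)
  show ?thesis
    unfolding star_def
    by (intro ptime_pred_conj ptime_pred_Ball ptime_pred_imp ptime_pred_eq ptime_pred_gedges ptime_plc
      ptime_pred_const ptime_var fin fin')
qed

lemma ptime_generating_value:
  assumes wt: "\<And>\<theta>. \<theta> \<in> types c \<Longrightarrow> ptime (\<lambda>x \<rho>. wt x \<theta>)"
  shows "ptime (\<lambda>x \<rho>. generating_value c {..<gverts x} (gedges x)
    (cover_pairs (hedges x) (cov c x (\<rho> 6)) c) (wt x) (plc c x (\<rho> 2)))"
proof -
  let ?f = "\<lambda>x b y. \<Sum>T\<in>Pow (types c). of_bool (star (gedges x) (plc c x b) y T) * (\<Prod>\<theta>\<in>T. wt x \<theta>)"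
  \<comment> \<open>The product over vertices outside the image of the cover becomes a plain loop
    over all vertices, with factor 1 on the image.\<close>
  let ?g = "\<lambda>x b y. if \<exists>j\<in>{..<c}. y = plc c x b j then 1 else ?f x b y"
  have "ptime (\<lambda>x \<rho>. ?f x (\<rho> 2) (\<rho> 3))"
    by (intro ptime_finite_sum ptime_mult ptime_star ptime_finite_prod wt) auto
  then have "ptime (\<lambda>x \<rho>. ?g x (\<rho> 2) (\<rho> 3))"
    by (intro ptime_if ptime_pred_Bex ptime_pred_eq ptime_var ptime_plc ptime_const) auto
  then have "ptime (\<lambda>x \<rho>. \<Prod>y<gverts x. ?g x (\<rho> 2) y)"
    by (rule ptime_prod[where v = 3, rotated 3]) (auto intro: ptime_gverts bounded_verts)
  moreover have "(\<Prod>y<gverts x. ?g x b y) = (\<Prod>y\<in>{..<gverts x} - plc c x b ` {..<c}. ?f x b y)" for x b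
    by (rule prod.mono_neutral_cong_right) (auto simp: image_iff)
  ultimately have outer: "ptime (\<lambda>x \<rho>. \<Prod>y\<in>{..<gverts x} - plc c x (\<rho> 2) ` {..<c}. ?f x (\<rho> 2) y)" by simp
  have inner: "ptime (\<lambda>x \<rho>. of_bool (first_positions (plc c x (\<rho> 2)) Q \<and>
      admissible (gedges x) (cover_pairs (hedges x) (cov c x (\<rho> 6)) c) (plc c x (\<rho> 2)) (plc c x (\<rho> 2)) Q) *
      (\<Prod>(i, \<theta>)\<in>Q. wt x \<theta>))" if "Q \<in> Pow ({..<c} \<times> types c)" for Q
  proof -
    have Q: "Q \<subseteq> {..<c} \<times> types c" using that by simp
    then have "finite Q" by (rule finite_subset) simp
    moreover have "ptime (\<lambda>x \<rho>. case p of (i, \<theta>) \<Rightarrow> wt x \<theta>)" if "p \<in> Q" for p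
      unfolding split_def using subsetD[OF Q that] by (intro wt) auto
    ultimately show ?thesis
      using Q by (intro ptime_mult ptime_pred_conj ptime_first_positions ptime_admissible ptime_finite_prod)
  qed
  show ?thesis
    unfolding generating_value_def by (rule ptime_mult[OF ptime_finite_sum[OF inner] outer])
qed

text \<open>The value chosen for \<open>M\<close>: larger than both vertex numbers, hence than every
  type count and fibre size.\<close>

definition base :: "bool list \<Rightarrow> nat" where
  "base x = hverts x + gverts x + 1"

definition coefficient_base :: "nat \<Rightarrow> bool list \<Rightarrow> nat" where
  "coefficient_base c x = 2 ^ (gverts x * card (types c) + 1)"

lemma ptime_base: "ptime (\<lambda>x \<rho>. base x)"
  unfolding base_def by (intro ptime_add ptime_hverts ptime_gverts ptime_const)

lemma bounded_base: "bounded_value (\<lambda>x \<rho>. base x)"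
  unfolding base_def by (intro bounded_value_add bounded_verts bounded_value_const)

lemma ptime_coefficient_base: "ptime (\<lambda>x \<rho>. coefficient_base c x)"
  unfolding coefficient_base_def
  by (intro ptime_power ptime_add ptime_mult ptime_gverts ptime_const bounded_value_add bounded_value_mult
    bounded_verts bounded_value_const)

text \<open>The exponents of \<open>B\<close> are fixed powers of \<open>base x\<close>, possibly
  times type counts and summed over finitely many types. They are bounded in value, as
  exponentiation by a loop requires.\<close>

lemma ptime_placement_count:
  "ptime (\<lambda>x \<rho>. placement_count (base x) (coefficient_base c x) {..<hverts x} (hedges x)
    {..<gverts x} (gedges x) (cov c x (\<rho> 6)) c (plc c x (\<rho> 2)))"
  unfolding placement_count_def
  by (intro ptime_mult ptime_finite_prod ptime_fact ptime_mod ptime_div ptime_generating_value ptime_power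
    ptime_finite_sum ptime_type_count bounded_type_count ptime_coefficient_base ptime_base bounded_base
    ptime_power_const bounded_value_power bounded_value_finite_sum bounded_value_mult) auto

text \<open>The formula of \<open>card_edge_inj_homs_placements\<close> for the decoded graphs and
  the cover with code \<open>a\<close>. For a code that is not a valid cover the value has no
  meaning; \<open>answer\<close> multiplies it by 0.\<close>

definition candidate_value :: "nat \<Rightarrow> bool list \<Rightarrow> nat \<Rightarrow> nat" where
  "candidate_value c x a =
    (let m = card {e \<in> hedges x. e \<inter> cov c x a ` {..<c} = {}};
         q = card {w. w < hverts x \<and> w \<notin> cov c x a ` {..<c} \<and> (\<forall>e\<in>hedges x. w \<notin> e)}
     in (\<Sum>b<gverts x ^ c. placement_count (base x) (coefficient_base c x) {..<hverts x} (hedges x)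
          {..<gverts x} (gedges x) (cov c x a) c (plc c x b)) *
        (2 ^ m * (\<Prod>i<m. card (gedges x) - (card (hedges x) - m) - i)) * gverts x ^ q)"

lemma edges_at_iff:
  "(\<forall>e\<in>edges_at x a. P e) \<longleftrightarrow> (\<forall>u<unary_at x a. \<forall>v<unary_at x a. {u, v} \<in> edges_at x a \<longrightarrow> P {u, v})"
  unfolding edges_at_def Let_def by auto

lemma card_edges_at_le: "card (edges_at x a) \<le> unary_at x a * unary_at x a"
proof -
  have "edges_at x a \<subseteq> (\<lambda>(u, v). {u, v}) ` ({..<unary_at x a} \<times> {..<unary_at x a})"
    unfolding edges_at_def Let_def by auto
  from surj_card_le[OF _ this] show ?thesis by (simp add: card_cartesian_product)
qed

lemma finite_edges_at: "finite (edges_at x a)"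
  by (rule finite_subset[of _ "(\<lambda>(u, v). {u, v}) ` ({..<unary_at x a} \<times> {..<unary_at x a})"])
    (auto simp: edges_at_def Let_def)

lemma ptime_candidate_value: "ptime (\<lambda>x \<rho>. candidate_value c x (\<rho> 6))"
proof -
  let ?m = "\<lambda>x a. card {e \<in> hedges x. e \<inter> cov c x a ` {..<c} = {}}"
  let ?q = "\<lambda>x a. card {w. w < hverts x \<and> w \<notin> cov c x a ` {..<c} \<and> (\<forall>e\<in>hedges x. w \<notin> e)}"
  have m: "ptime (\<lambda>x \<rho>. ?m x (\<rho> 6))"
  proof (rule ptime_card_edges[OF ptime_const])
    have "ptime_pred (\<lambda>x \<rho>. \<not> \<rho> 3 \<in> cov c x (\<rho> 6) ` {..<c} \<and> \<not> \<rho> 4 \<in> cov c x (\<rho> 6) ` {..<c})"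
      by (intro ptime_pred_conj ptime_pred_not ptime_pred_in_cov ptime_var)
    then show "ptime_pred (\<lambda>x \<rho>. {\<rho> 3, \<rho> 4} \<inter> cov c x (\<rho> 6) ` {..<c} = {})"
      by simp
  qed
  have bm: "bounded_value (\<lambda>x \<rho>. ?m x (\<rho> 6))"
  proof -
    have "?m x a \<le> hverts x * hverts x" for x a
      using card_mono[OF finite_edges_at, of "{e \<in> hedges x. e \<inter> cov c x a ` {..<c} = {}}" x 0] card_edges_at_le[of x 0]
      by auto
    moreover have "bounded_value (\<lambda>x \<rho>. hverts x * hverts x)" by (intro bounded_value_mult bounded_verts)
    ultimately show ?thesis unfolding bounded_value_def by (meson le_trans)
  qed
  have "ptime (\<lambda>x \<rho>. card {w. w < hverts x \<and> w \<notin> cov c x (\<rho> 6) ` {..<c} \<and>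
      (\<forall>u<hverts x. \<forall>v<hverts x. {u, v} \<in> hedges x \<longrightarrow> w \<notin> {u, v})})"
  proof (rule ptime_pred_Collect_card[where v = 3])
    have "ptime_pred (\<lambda>x \<rho>. \<forall>u<hverts x. \<forall>v<hverts x. {u, v} \<in> hedges x \<longrightarrow> \<rho> 3 \<notin> {u, v})"
    proof (rule ptime_pred_all_less[where v = 4])
      show "ptime_pred (\<lambda>x \<rho>. \<forall>v<hverts x. {\<rho> 4, v} \<in> hedges x \<longrightarrow> \<rho> 3 \<notin> {\<rho> 4, v})"
      proof (rule ptime_pred_all_less[where v = 5])
        have "ptime_pred (\<lambda>x \<rho>. {\<rho> 4, \<rho> 5} \<in> hedges x \<longrightarrow> \<not> (\<rho> 3 = \<rho> 4 \<or> \<rho> 3 = \<rho> 5))"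
          by (intro ptime_pred_imp ptime_pred_not ptime_pred_disj ptime_pred_hedges ptime_pred_eq ptime_var)
        then show "ptime_pred (\<lambda>x \<rho>. {\<rho> 4, \<rho> 5} \<in> hedges x \<longrightarrow> \<rho> 3 \<notin> {\<rho> 4, \<rho> 5})" by simp
      qed (auto intro: ptime_hverts bounded_verts)
    qed (auto intro: ptime_hverts bounded_verts)
    then show "ptime_pred (\<lambda>x \<rho>. \<rho> 3 \<notin> cov c x (\<rho> 6) ` {..<c} \<and>
        (\<forall>u<hverts x. \<forall>v<hverts x. {u, v} \<in> hedges x \<longrightarrow> \<rho> 3 \<notin> {u, v}))"
      by (intro ptime_pred_conj ptime_pred_not ptime_pred_in_cov ptime_var)
  qed (auto intro: ptime_hverts bounded_verts)
  then have q: "ptime (\<lambda>x \<rho>. ?q x (\<rho> 6))" unfolding edges_at_iff .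
  have bq: "bounded_value (\<lambda>x \<rho>. ?q x (\<rho> 6))"
  proof -
    have "?q x a \<le> hverts x" for x a
      using card_mono[of "{..<hverts x}" "{w. w < hverts x \<and> w \<notin> cov c x a ` {..<c} \<and> (\<forall>e\<in>hedges x. w \<notin> e)}"]
      by auto
    then show ?thesis using bounded_verts(1) unfolding bounded_value_def by (meson le_trans)
  qed
  have e: "ptime (\<lambda>x \<rho>. card (edges_at x (a x)))" if "ptime (\<lambda>x \<rho>. a x)" for a
    using ptime_card_edges[OF that, of "\<lambda>_ _ _. True"] by (simp add: ptime_const)
  have P: "ptime (\<lambda>x \<rho>. \<Sum>b<gverts x ^ c. placement_count (base x) (coefficient_base c x) {..<hverts x}
      (hedges x) {..<gverts x} (gedges x) (cov c x (\<rho> 6)) c (plc c x b))"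
    by (rule ptime_sum[where v = 2])
      (auto intro: ptime_power_const ptime_gverts bounded_value_power bounded_verts ptime_placement_count)
  have F: "ptime (\<lambda>x \<rho>. \<Prod>i<?m x (\<rho> 6). card (gedges x) - (card (hedges x) - ?m x (\<rho> 6)) - i)"
  proof (rule ptime_prod[where v = 2])
    show "ptime (\<lambda>x \<rho>. card (gedges x) - (card (hedges x) - ?m x (\<rho> 6)) - \<rho> 2)"
      by (intro ptime_sub e ptime_gpos ptime_const m ptime_var)
  qed (auto intro: m bm)
  show ?thesis
    unfolding candidate_value_def Let_def
    by (intro ptime_mult P F ptime_power ptime_const ptime_gverts m bm q bq)
qed

definition valid_candidate :: "nat \<Rightarrow> bool list \<Rightarrow> nat \<Rightarrow> bool" where
  "valid_candidate c x a \<longleftrightarrow> inj_on (cov c x a) {..<c} \<and>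
    weak_vertex_cover ({..<hverts x}, hedges x) (cov c x a ` {..<c})"

lemma ptime_valid_candidate: "ptime_pred (\<lambda>x \<rho>. valid_candidate c x (\<rho> 6))"
proof -
  let ?S = "\<lambda>x a. cov c x a ` {..<c}"
  let ?n = hverts and ?E = hedges
  let ?A = "\<lambda>x a. (\<forall>i\<in>{..<c}. \<forall>j\<in>{..<c}. cov c x a i = cov c x a j \<longrightarrow> i = j) \<and>
    (\<forall>j\<in>{..<c}. cov c x a j < ?n x)"
  \<comment> \<open>The two edges are equal or disjoint, written as equalities between their
    ends.\<close>
  let ?D = "\<lambda>u v u' v'. (u = u' \<and> v = v' \<or> u = v' \<and> v = u') \<or> u \<noteq> u' \<and> u \<noteq> v' \<and> v \<noteq> u' \<and> (v :: nat) \<noteq> v'"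
  let ?B = "\<lambda>x u v. \<forall>u'<?n x. \<forall>v'<?n x. {u', v'} \<in> ?E x \<longrightarrow> ?D u v u' v'"
  let ?C = "\<lambda>x a. \<forall>u<?n x. \<forall>v<?n x. {u, v} \<in> ?E x \<longrightarrow> (u \<in> ?S x a \<or> v \<in> ?S x a) \<or> ?B x u v"
  have "ptime_pred (\<lambda>x \<rho>. ?A x (\<rho> 6))"
    by (intro ptime_pred_conj ptime_pred_Ball ptime_pred_imp ptime_pred_eq ptime_pred_less ptime_cov
      ptime_pred_const ptime_hverts) auto
  moreover have "ptime_pred (\<lambda>x \<rho>. ?C x (\<rho> 6))"
  proof (rule ptime_pred_all_less[where v = 2])
    show "ptime_pred (\<lambda>x \<rho>. \<forall>v<?n x. {\<rho> 2, v} \<in> ?E x \<longrightarrow>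
        (\<rho> 2 \<in> ?S x (\<rho> 6) \<or> v \<in> ?S x (\<rho> 6)) \<or> ?B x (\<rho> 2) v)"
    proof (rule ptime_pred_all_less[where v = 3])
      have "ptime_pred (\<lambda>x \<rho>. ?B x (\<rho> 2) (\<rho> 3))"
      proof (rule ptime_pred_all_less[where v = 4])
        show "ptime_pred (\<lambda>x \<rho>. \<forall>v'<?n x. {\<rho> 4, v'} \<in> ?E x \<longrightarrow> ?D (\<rho> 2) (\<rho> 3) (\<rho> 4) v')"
        proof (rule ptime_pred_all_less[where v = 5])
          show "ptime_pred (\<lambda>x \<rho>. {\<rho> 4, \<rho> 5} \<in> ?E x \<longrightarrow> ?D (\<rho> 2) (\<rho> 3) (\<rho> 4) (\<rho> 5))"
            by (intro ptime_pred_imp ptime_pred_disj ptime_pred_conj ptime_pred_not ptime_pred_eq ptime_var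
              ptime_pred_hedges)
        qed (auto intro: ptime_hverts bounded_verts)
      qed (auto intro: ptime_hverts bounded_verts)
      then show "ptime_pred (\<lambda>x \<rho>. {\<rho> 2, \<rho> 3} \<in> ?E x \<longrightarrow>
          (\<rho> 2 \<in> ?S x (\<rho> 6) \<or> \<rho> 3 \<in> ?S x (\<rho> 6)) \<or> ?B x (\<rho> 2) (\<rho> 3))"
        by (intro ptime_pred_imp ptime_pred_disj ptime_pred_hedges ptime_pred_in_cov ptime_var)
    qed (auto intro: ptime_hverts bounded_verts)
  qed (auto intro: ptime_hverts bounded_verts)
  ultimately have "ptime_pred (\<lambda>x \<rho>. ?A x (\<rho> 6) \<and> ?C x (\<rho> 6))" by (rule ptime_pred_conj)
  moreover have "?A x a \<and> ?C x a \<longleftrightarrow> valid_candidate c x a" for x a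
  proof -
    have "?A x a \<longleftrightarrow> inj_on (cov c x a) {..<c} \<and> ?S x a \<subseteq> {..<?n x}"
      by (auto simp: inj_on_def)
    moreover have "?D u v u' v' \<longleftrightarrow> ({u', v'} \<noteq> {u, v} \<longrightarrow> {u, v} \<inter> {u', v'} = {})" for u v u' v'
      by (auto simp: doubleton_eq_iff)
    moreover have "(u \<in> ?S x a \<or> v \<in> ?S x a) \<longleftrightarrow> {u, v} \<inter> ?S x a \<noteq> {}" for u v by auto
    ultimately show ?thesis
      unfolding valid_candidate_def weak_vertex_cover_def fst_conv snd_conv edges_at_iff by simp
  qed
  ultimately show ?thesis by simp
qed

text \<open>Covers are coded injectively, so every size \<open>k\<close> up to \<open>c\<close> is
  tried. Different codes of one cover, and different covers, are counted alike in numerator and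
  denominator.\<close>

definition answer :: "nat \<Rightarrow> bool list \<Rightarrow> nat" where
  "answer c x =
    (\<Sum>k\<le>c. \<Sum>a<hverts x ^ k. of_bool (valid_candidate k x a) * candidate_value k x a) div
    (\<Sum>k\<le>c. \<Sum>a<hverts x ^ k. of_bool (valid_candidate k x a))"

lemma ptime_answer: "ptime (\<lambda>x \<rho>. answer c x)"
proof -
  have "ptime (\<lambda>x \<rho>. \<Sum>a<hverts x ^ k. of_bool (valid_candidate k x a) * candidate_value k x a)" for k
    by (rule ptime_sum[where v = 6])
      (auto intro!: ptime_power_const ptime_hverts bounded_value_power bounded_verts ptime_mult
        ptime_valid_candidate ptime_candidate_value)
  moreover have "ptime (\<lambda>x \<rho>. \<Sum>a<hverts x ^ k. of_bool (valid_candidate k x a))" for k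
    by (rule ptime_sum[where v = 6])
      (auto intro!: ptime_power_const ptime_hverts bounded_value_power bounded_verts ptime_valid_candidate)
  ultimately show ?thesis
    unfolding answer_def by (intro ptime_div ptime_finite_sum)
qed

lemma answer_eq:
  fixes H :: "'a ugraph" and G :: "'b ugraph"
  assumes simple: "simple_graph H" "simple_graph G" and S: "weak_vertex_cover H S" "card S \<le> c"
    and rep: "represents x H G"
  shows "answer c x = card (edge_inj_homs H G)"
proof -
  obtain vs ws where vs: "distinct vs" "set vs = verts H" and ws: "distinct ws" "set ws = verts G"
    and x: "x = encode_graph vs H @ encode_graph ws G"
    using rep unfolding represents_def by auto
  let ?n = "hverts x" and ?E = "hedges x" and ?X = "gverts x" and ?F = "gedges x"
  have x1: "x = [] @ encode_graph vs H @ encode_graph ws G" "0 = length ([] :: bool list)" using x by auto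
  note dH = decode_graph[OF x1 vs simple(1)]
  have "gpos x = length (encode_graph vs H)" "x = encode_graph vs H @ encode_graph ws G @ []"
    using dH(1) x by (simp_all add: gpos_def length_encode_graph)
  note dG = decode_graph[OF this(2,1) ws simple(2)]
  have count: "card (edge_inj_homs H G) = card (edge_inj_homs ({..<?n}, ?E) ({..<?X}, ?F))"
    using card_edge_inj_homs_iso[OF _ dH(4,2,3) _ dG(4,2,3)] simple by (simp only: prod.collapse)
  have cand: "candidate_value k x a = card (edge_inj_homs H G)" if "valid_candidate k x a" "a < ?n ^ k" for k a
  proof -
    let ?g = "\<lambda>\<psi>. placement_count (base x) (coefficient_base k x) {..<?n} ?E {..<?X} ?F (cov k x a) k \<psi>"
    have "(\<Sum>b<?X ^ k. ?g (plc k x b)) = (\<Sum>\<psi>\<in>{..<k} \<rightarrow>\<^sub>E {..<?X}. ?g \<psi>)"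
      by (rule sum.reindex_bij_betw[OF bij_betw_digits])
    moreover have "card (edge_inj_homs ({..<?n}, ?E) ({..<?X}, ?F)) = (\<Sum>\<psi>\<in>{..<k} \<rightarrow>\<^sub>E {..<?X}. ?g \<psi>) *
        (2 ^ card {e \<in> ?E. e \<inter> cov k x a ` {..<k} = {}} * (\<Prod>i<card {e \<in> ?E. e \<inter> cov k x a ` {..<k} = {}}.
          card ?F - (card ?E - card {e \<in> ?E. e \<inter> cov k x a ` {..<k} = {}}) - i)) *
        card {..<?X} ^ card {w \<in> {..<?n}. w \<notin> cov k x a ` {..<k} \<and> (\<forall>e\<in>?E. w \<notin> e)}"
      using that(1) dH(4) dG(4) unfolding valid_candidate_def
      by (intro card_edge_inj_homs_placements) (auto simp: base_def coefficient_base_def)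
    ultimately show ?thesis
      unfolding count candidate_value_def Let_def by simp
  qed
  \<comment> \<open>The denominator is nonzero: the cover promised for \<open>H\<close>, pulled back
    along the vertex enumeration and listed in some order, has a code.\<close>
  have "\<exists>k\<le>c. \<exists>a<?n ^ k. valid_candidate k x a"
  proof -
    define S' where "S' = {i \<in> {..<?n}. vs ! i \<in> S}"
    have isolated: "e \<inter> e' = {}" if "e \<in> edges H" "e \<inter> S = {}" "e' \<in> edges H" "e' \<noteq> e" for e e'
      using S(1) that unfolding weak_vertex_cover_def by auto
    have SH: "S \<subseteq> verts H" using S(1) unfolding weak_vertex_cover_def by blast
    have inj: "inj_on ((!) vs) {..<?n}" and img: "(!) vs ` {..<?n} = verts H" using dH(2) by (auto simp: bij_betw_def)
    have S': "(!) vs ` S' = S" "S' \<subseteq> {..<?n}" using SH img unfolding S'_def by (auto simp: image_iff subset_iff)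
    have "card S' = card S" using S' inj by (metis card_image inj_on_subset)
    have E: "e \<subseteq> {..<?n}" "(!) vs ` e \<in> edges H" if "e \<in> ?E" for e
      using that dH(3,4) unfolding simple_graph_def by auto
    have cov: "weak_vertex_cover ({..<?n}, ?E) S'"
      unfolding weak_vertex_cover_def fst_conv snd_conv
    proof (intro conjI ballI S')
      fix e assume e: "e \<in> ?E"
      show "e \<inter> S' \<noteq> {} \<or> (\<forall>e'\<in>?E. e' \<noteq> e \<longrightarrow> e \<inter> e' = {})"
      proof (cases "(!) vs ` e \<inter> S = {}")
        case False
        then show ?thesis using E(1)[OF e] unfolding S'_def by auto
      next
        case True
        have "e \<inter> e' = {}" if "e' \<in> ?E" "e' \<noteq> e" for e'
        proof -
          have "(!) vs ` e' \<noteq> (!) vs ` e"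
            using inj_on_image_eq_iff[OF inj E(1)[OF that(1)] E(1)[OF e]] that(2) by simp
          then have "(!) vs ` e \<inter> (!) vs ` e' = {}"
            using isolated[OF E(2)[OF e] True E(2)[OF that(1)]] by simp
          then show ?thesis by auto
        qed
        then show ?thesis by blast
      qed
    qed
    have "finite S'" using S'(2) by (rule finite_subset) simp
    then obtain h where h: "bij_betw h {..<card S'} S'"
      using ex_bij_betw_nat_finite[of S'] by (auto simp: atLeast0LessThan)
    have "restrict h {..<card S'} \<in> {..<card S'} \<rightarrow>\<^sub>E {..<?n}"
      using h S'(2) by (auto simp: bij_betw_def)
    then have "restrict h {..<card S'} \<in> digits (card S') ?n ` {..<?n ^ card S'}"
      by (simp only: bij_betw_imp_surj_on[OF bij_betw_digits])
    then obtain a where a: "a < ?n ^ card S'" "digits (card S') ?n a = restrict h {..<card S'}"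
      by (elim imageE) simp
    have "valid_candidate (card S') x a"
      unfolding valid_candidate_def a(2) using h cov by (auto simp: bij_betw_def inj_on_def)
    then show ?thesis using a(1) S(2) \<open>card S' = card S\<close> by auto
  qed
  then obtain k a where ka: "k \<le> c" "a < ?n ^ k" "valid_candidate k x a" by blast
  let ?D = "\<Sum>k\<le>c. \<Sum>a<?n ^ k. of_bool (valid_candidate k x a) :: nat"
  have "?D \<noteq> 0" using ka by (auto simp: Int_def)
  moreover have "(\<Sum>k\<le>c. \<Sum>a<?n ^ k. of_bool (valid_candidate k x a) * candidate_value k x a) =
      ?D * card (edge_inj_homs H G)"
    unfolding sum_distrib_right by (intro sum.cong refl) (auto simp: cand)
  ultimately show ?thesis unfolding answer_def by simp
qed

theorem theorem8:
  fixes c :: nat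
  shows "\<exists>c' :: nat. \<exists>(P :: com) (T :: nat \<Rightarrow> nat).
    (\<lambda>n. real (T n)) \<in> O(\<lambda>n. real n ^ c') \<and>
    (\<forall>(H :: nat ugraph) (G :: nat ugraph) x.
       simple_graph H \<longrightarrow> simple_graph G \<longrightarrow>
       (\<exists>S. weak_vertex_cover H S \<and> card S \<le> c) \<longrightarrow>
       represents x H G \<longrightarrow>
       outputs_within P x (card (edge_inj_homs H G)) (T (length x)))"
proof -
  obtain P k where P: "\<And>x. outputs_within P x (answer c x) ((length x + 2) ^ k)"
    using ptime_program[OF ptime_answer refl] by blast
  have "(\<lambda>n. real ((n + 2) ^ k)) \<in> O(\<lambda>n. real n ^ k)"
  proof (rule bigoI)
    show "\<forall>\<^sub>F n in sequentially. norm (real ((n + 2) ^ k)) \<le> 3 ^ k * norm (real n ^ k)"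
      \<comment> \<open>For \<open>n \<ge> 1\<close> the base \<open>n + 2\<close> is at most
        \<open>3 * n\<close>, which gives the constant \<open>3 ^ k\<close>.\<close>
      using eventually_ge_at_top[of 1]
    proof eventually_elim
      case (elim n)
      then have "(n + 2) ^ k \<le> (3 * n) ^ k" by (intro power_mono) auto
      then have "real ((n + 2) ^ k) \<le> real ((3 * n) ^ k)" by (rule of_nat_mono)
      then show ?case by (simp add: power_mult_distrib)
    qed
  qed
  moreover have "outputs_within P x (card (edge_inj_homs H G)) ((length x + 2) ^ k)"
    if "simple_graph H" "simple_graph G" "weak_vertex_cover H S" "card S \<le> c" "represents x H G"
    for H G :: "nat ugraph" and x S
    using P[of x] answer_eq[OF that] by simp
  ultimately show ?thesis by (intro exI[of _ k] exI[of _ P] exI[of _ "\<lambda>n. (n + 2) ^ k"]) blast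
qed

end
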